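(* There is a randomized polynomial-time algorithm (in the value-oracle model) for the problem of maximizing a monotone submodular function $f:2^{[n]}\to\mathbb{R}_+$ subject to $k$-column sparse packing constraints, i.e. $\max\{f(T)\mid \sum_{i\in T}s_{ij}\le c_j\ \forall j\in[m],\ T\subseteq[n]\}$, achieving approximation ratio $\frac{e^2}{e-1}k+o(k)$: it always outputs a feasible set $T$ with $E[f(T)]\ge \mathrm{OPT}/\left(\frac{e^2}{e-1}k+o(k)\right)$, where $o(k)/k\to0$ as $k\to\infty$.
   Context: Here $S=(s_{ij})\in\mathbb{R}_+^{m\times n}$ and $c\in\mathbb{R}^m_+$, and the constraint matrix is $k$-column sparse: for each item $i\in[n]$ there are at most $k$ constraints $j$ with $s_{ij}>0$. The function $f$ is monotone ($A\subseteq B\Rightarrow f(A)\le f(B)$) and submodular, and is accessed only through a value oracle returning $f(T)$ for any queried $T\subseteq[n]$. $\mathrm{OPT}$ is the maximum value of $f$ over feasible sets. *)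

theory Defs
  imports "HOL-Probability.Probability" "HOL-Library.Landau_Symbols"
    "HOL-Computational_Algebra.Polynomial"
begin

section \<open>Packing constraints and submodular functions\<close>

text \<open>Items are \<open>{..<n}\<close> and constraints are \<open>{..<m}\<close>; \<open>S i j\<close> is the size of item \<open>i\<close> in
  constraint \<open>j\<close> (first index: item, as in \<open>s\<^sub>i\<^sub>j\<close>). Only values at indices in range matter.\<close>

definition nonneg_data :: "nat \<Rightarrow> nat \<Rightarrow> (nat \<Rightarrow> nat \<Rightarrow> real) \<Rightarrow> (nat \<Rightarrow> real) \<Rightarrow> bool" where
  "nonneg_data n m S c \<longleftrightarrow> (\<forall>i<n. \<forall>j<m. 0 \<le> S i j) \<and> (\<forall>j<m. 0 \<le> c j)"

definition column_sparse :: "nat \<Rightarrow> nat \<Rightarrow> nat \<Rightarrow> (nat \<Rightarrow> nat \<Rightarrow> real) \<Rightarrow> bool" where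
  "column_sparse k n m S \<longleftrightarrow> (\<forall>i<n. card {j. j < m \<and> S i j > 0} \<le> k)"

definition feasible :: "nat \<Rightarrow> nat \<Rightarrow> (nat \<Rightarrow> nat \<Rightarrow> real) \<Rightarrow> (nat \<Rightarrow> real) \<Rightarrow> nat set \<Rightarrow> bool" where
  "feasible n m S c T \<longleftrightarrow> T \<subseteq> {..<n} \<and> (\<forall>j<m. (\<Sum>i\<in>T. S i j) \<le> c j)"

definition OPT ::
  "nat \<Rightarrow> nat \<Rightarrow> (nat \<Rightarrow> nat \<Rightarrow> real) \<Rightarrow> (nat \<Rightarrow> real) \<Rightarrow> (nat set \<Rightarrow> real) \<Rightarrow> real" where
  "OPT n m S c f = Max (f ` {T. feasible n m S c T})"

definition nonneg_set_fun :: "'a set \<Rightarrow> ('a set \<Rightarrow> real) \<Rightarrow> bool" where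
  "nonneg_set_fun V f \<longleftrightarrow> (\<forall>A. A \<subseteq> V \<longrightarrow> 0 \<le> f A)"

definition monotone_set_fun :: "'a set \<Rightarrow> ('a set \<Rightarrow> real) \<Rightarrow> bool" where
  "monotone_set_fun V f \<longleftrightarrow> (\<forall>A B. A \<subseteq> B \<and> B \<subseteq> V \<longrightarrow> f A \<le> f B)"

definition submodular :: "'a set \<Rightarrow> ('a set \<Rightarrow> real) \<Rightarrow> bool" where
  "submodular V f \<longleftrightarrow> (\<forall>A B. A \<subseteq> V \<and> B \<subseteq> V \<longrightarrow> f (A \<union> B) + f (A \<inter> B) \<le> f A + f B)"


section \<open>Randomized real-RAM programs with a value oracle\<close>

text \<open>
  The input data are arbitrary reals, so running time is measured in the real-RAM (arithmetic)
  model: field operations and comparisons of reals have unit cost. There is no rounding from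
  reals to integers, and the only constants a program may contain are natural numbers (an arbitrary
  real constant could serve as advice). Index arithmetic on naturals is restricted to addition
  and truncated subtraction, so that \<open>t\<close> steps produce only indices of bit length \<open>O(t)\<close>.
  Randomness consists of fair coin flips.

  Memory consists of arrays of naturals and arrays of reals. The cell \<open>(a, i, j)\<close> is entry
  \<open>(i, j)\<close> of the array named \<open>a\<close>; names are fixed in the program text, indices are computed.
\<close>

type_synonym 'v mem = "nat \<times> nat \<times> nat \<Rightarrow> 'v"

type_synonym state = "nat mem \<times> real mem"

datatype nexp =
    NConst nat
  | NGet nat nexp nexp
  | NAdd nexp nexp
  | NSub nexp nexp

datatype rexp =
    ROfNat nexp
  | RGet nat nexp nexp
  | RAdd rexp rexp
  | RSub rexp rexp
  | RMul rexp rexp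
  | RDiv rexp rexp

datatype bexp =
    NLess nexp nexp
  | RLess rexp rexp
  | BNot bexp
  | BAnd bexp bexp

text \<open>
  \<open>Query a x b y z\<close> asks for the value of the set whose indicator is row \<open>x\<close> of the
  natural array \<open>a\<close>, and stores the answer in cell \<open>(b, y, z)\<close> of the real memory.
\<close>

datatype com =
    Skip
  | NSet nat nexp nexp nexp
  | RSet nat nexp nexp rexp
  | Flip nat nexp nexp
  | Query nat nexp nat nexp nexp
  | Seq com com
  | Cond bexp com com
  | While bexp com

primrec nval :: "nexp \<Rightarrow> state \<Rightarrow> nat" where
  "nval (NConst v) s = v"
| "nval (NGet a x y) s = fst s (a, nval x s, nval y s)"
| "nval (NAdd x y) s = nval x s + nval y s"
| "nval (NSub x y) s = nval x s - nval y s"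

primrec rval :: "rexp \<Rightarrow> state \<Rightarrow> real" where
  "rval (ROfNat x) s = real (nval x s)"
| "rval (RGet a x y) s = snd s (a, nval x s, nval y s)"
| "rval (RAdd u v) s = rval u s + rval v s"
| "rval (RSub u v) s = rval u s - rval v s"
| "rval (RMul u v) s = rval u s * rval v s"
| "rval (RDiv u v) s = rval u s / rval v s"

primrec bval :: "bexp \<Rightarrow> state \<Rightarrow> bool" where
  "bval (NLess x y) s \<longleftrightarrow> nval x s < nval y s"
| "bval (RLess u v) s \<longleftrightarrow> rval u s < rval v s"
| "bval (BNot b) s \<longleftrightarrow> \<not> bval b s"
| "bval (BAnd b b') s \<longleftrightarrow> bval b s \<and> bval b' s"

definition row_set :: "nat \<Rightarrow> nat \<Rightarrow> nat \<Rightarrow> state \<Rightarrow> nat set" where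
  "row_set n a x s = {l. l < n \<and> fst s (a, x, l) \<noteq> 0}"

text \<open>
  One step of a program on an instance with \<open>n\<close> items and oracle \<open>f\<close>. A step evaluates at most
  the expressions of one command, whose sizes are bounded by the fixed program, so the number of
  steps equals the number of elementary operations up to a constant factor (a query is one step).
\<close>

primrec step :: "nat \<Rightarrow> (nat set \<Rightarrow> real) \<Rightarrow> com \<Rightarrow> state \<Rightarrow> (com \<times> state) pmf" where
  "step n f Skip s = return_pmf (Skip, s)"
| "step n f (NSet a x y v) s =
     return_pmf (Skip, ((fst s)((a, nval x s, nval y s) := nval v s), snd s))"
| "step n f (RSet a x y v) s =
     return_pmf (Skip, (fst s, (snd s)((a, nval x s, nval y s) := rval v s)))"
| "step n f (Flip a x y) s =
     map_pmf (\<lambda>b. (Skip, ((fst s)((a, nval x s, nval y s) := (if b then 1 else 0)), snd s)))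
       (bernoulli_pmf (1 / 2))"
| "step n f (Query a x b y z) s =
     return_pmf (Skip,
       (fst s, (snd s)((b, nval y s, nval z s) := f (row_set n a (nval x s) s))))"
| "step n f (Seq C D) s =
     (if C = Skip then return_pmf (D, s)
      else map_pmf (\<lambda>(C', s'). (Seq C' D, s')) (step n f C s))"
| "step n f (Cond b C D) s = return_pmf (if bval b s then C else D, s)"
| "step n f (While b C) s = return_pmf (if bval b s then Seq C (While b C) else Skip, s)"

text \<open>
  Input convention: natural array 0 holds \<open>n\<close> and \<open>m\<close> in its cells \<open>(0, 0)\<close> and \<open>(0, 1)\<close>, real
  array 0 holds \<open>S\<close>, row 0 of real array 1 holds \<open>c\<close>, and all other cells are 0. The sparsity
  parameter is not supplied separately.
\<close>

definition init_state :: "nat \<Rightarrow> nat \<Rightarrow> (nat \<Rightarrow> nat \<Rightarrow> real) \<Rightarrow> (nat \<Rightarrow> real) \<Rightarrow> state" where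
  "init_state n m S c =
     ((\<lambda>_. 0)((0, 0, 0) := n, (0, 0, 1) := m),
      (\<lambda>(a, i, j).
         if a = 0 \<and> i < n \<and> j < m then S i j
         else if a = 1 \<and> i = 0 \<and> j < m then c j
         else 0))"

definition run ::
  "com \<Rightarrow> nat \<Rightarrow> nat \<Rightarrow> (nat \<Rightarrow> nat \<Rightarrow> real) \<Rightarrow> (nat \<Rightarrow> real) \<Rightarrow> (nat set \<Rightarrow> real) \<Rightarrow> nat
    \<Rightarrow> (com \<times> state) pmf" where
  "run P n m S c f t =
     ((\<lambda>D. bind_pmf D (\<lambda>(C, s). step n f C s)) ^^ t) (return_pmf (P, init_state n m S c))"

definition halts_within ::
  "com \<Rightarrow> nat \<Rightarrow> nat \<Rightarrow> (nat \<Rightarrow> nat \<Rightarrow> real) \<Rightarrow> (nat \<Rightarrow> real) \<Rightarrow> (nat set \<Rightarrow> real) \<Rightarrow> nat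
    \<Rightarrow> bool" where
  "halts_within P n m S c f t \<longleftrightarrow> (\<forall>(C, s) \<in> set_pmf (run P n m S c f t). C = Skip)"

text \<open>
  The output set is read from row 0 of natural array 1. Since \<open>Skip\<close> steps to itself, the
  distribution below does not depend on \<open>t\<close> once the program halts within \<open>t\<close> steps.
\<close>

definition out_dist ::
  "com \<Rightarrow> nat \<Rightarrow> nat \<Rightarrow> (nat \<Rightarrow> nat \<Rightarrow> real) \<Rightarrow> (nat \<Rightarrow> real) \<Rightarrow> (nat set \<Rightarrow> real) \<Rightarrow> nat
    \<Rightarrow> nat set pmf" where
  "out_dist P n m S c f t = map_pmf (\<lambda>(C, s). row_set n 1 0 s) (run P n m S c f t)"

end

theory Submission
  imports Defs
begin

text \<open>
  Call an item big for a constraint if it takes more than half of its capacity. A feasible set has at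
  most one big item per constraint, so after normalization it is a point of the polytope with one row
  for the big and one row for the small items of each constraint, and one row per item. Multiplicative
  weights on these rows pick, one after the other, items with the best ratio of marginal value to
  price until some row has received load \<open>D\<close>; each picked item is sampled with probability \<open>p\<close>,
  where \<open>p * D = 1 / (2 * k)\<close>. A sampled item survives if the others do not conflict with it: no
  big item at any of its constraints, and no pairwise products of small sizes adding up to \<open>1/9\<close>. The
  latter has probability \<open>O(1 / k\<^sup>2)\<close> per constraint, the former at most \<open>1 / (2 * k)\<close>, so by the union
  bound over \<open>k\<close> constraints about half of the value survives.

  The picks depend on earlier samples, so survival is measured by a pessimistic estimator (\<open>risk\<close>) that
  never increases in expectation, and marginal values are discounted by it. As only a \<open>1 / (2 * k)\<close>
  fraction of a fractional solution is sampled, the sampled set has negligible value compared with the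
  optimum, and no factor \<open>1 - 1 / e\<close> is lost to the submodularity of \<open>f\<close>. This gives ratio
  \<open>4 * k\<close> up to constants close to \<open>1\<close>, which leaves room for a bound of \<open>17 / 4 * k\<close>,
  below \<open>e\<^sup>2 / (e - 1) * k\<close>.
\<close>

section \<open>Marginal values of monotone submodular functions\<close>

lemma submodular_marginal_antimono:
  assumes submod: "submodular V f" and mono: "monotone_set_fun V f"
    and "A \<subseteq> B" "B \<subseteq> V" "a \<in> V"
  shows "f (insert a B) - f B \<le> f (insert a A) - f A"
proof (cases "a \<in> B")
  case True
  have "f A \<le> f (insert a A)"
    using mono assms(3-5) unfolding monotone_set_fun_def
    by (metis insert_subset subset_insertI subset_trans)
  with True show ?thesis by (simp add: insert_absorb)
next
  case False
  have "f (insert a A \<union> B) + f (insert a A \<inter> B) \<le> f (insert a A) + f B"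
    using submod assms(3-5) unfolding submodular_def by (metis insert_subset subset_trans)
  moreover have "insert a A \<union> B = insert a B" "insert a A \<inter> B = A" using assms(3) False by auto
  ultimately show ?thesis by simp
qed

definition chain_marginal :: "('a::linorder set \<Rightarrow> real) \<Rightarrow> 'a set \<Rightarrow> 'a set \<Rightarrow> 'a \<Rightarrow> real" where
  "chain_marginal f R A a = f (R \<union> {x \<in> A. x \<le> a}) - f (R \<union> {x \<in> A. x < a})"

lemma sum_chain_marginal:
  assumes "finite A"
  shows "(\<Sum>a\<in>A. chain_marginal f R A a) = f (R \<union> A) - f R"
  using assms
proof (induction A rule: finite_linorder_max_induct)
  case empty
  show ?case by simp
next
  case (insert b A)
  have "(\<Sum>a\<in>A. chain_marginal f R (insert b A) a) = (\<Sum>a\<in>A. chain_marginal f R A a)"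
  proof (rule sum.cong)
    fix a assume "a \<in> A"
    then have "{x \<in> insert b A. x \<le> a} = {x \<in> A. x \<le> a}" "{x \<in> insert b A. x < a} = {x \<in> A. x < a}"
      using insert.hyps by auto
    then show "chain_marginal f R (insert b A) a = chain_marginal f R A a"
      by (simp add: chain_marginal_def)
  qed simp
  moreover have "{x \<in> insert b A. x \<le> b} = insert b A" "{x \<in> insert b A. x < b} = A"
    using insert.hyps by auto
  then have "chain_marginal f R (insert b A) b = f (R \<union> insert b A) - f (R \<union> A)"
    by (simp add: chain_marginal_def)
  moreover have "b \<notin> A" using insert.hyps(2) by blast
  ultimately show ?case using insert.hyps(1) insert.IH by simp
qed

lemma chain_marginal_nonneg:
  assumes "monotone_set_fun V f" "R \<union> A \<subseteq> V"
  shows "0 \<le> chain_marginal f R A a"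
proof -
  have "R \<union> {x \<in> A. x < a} \<subseteq> R \<union> {x \<in> A. x \<le> a}" "R \<union> {x \<in> A. x \<le> a} \<subseteq> V"
    using assms(2) by auto
  then show ?thesis using assms(1) by (simp add: monotone_set_fun_def chain_marginal_def)
qed

lemma chain_marginal_eq_marginal:
  assumes "a \<in> A"
  shows "chain_marginal f R A a = f (insert a (R \<union> {x \<in> A. x < a})) - f (R \<union> {x \<in> A. x < a})"
proof -
  have "{x \<in> A. x \<le> a} = insert a {x \<in> A. x < a}" using assms by auto
  then show ?thesis by (simp add: chain_marginal_def)
qed

lemma
  assumes "submodular V f" "monotone_set_fun V f" "R \<union> A \<subseteq> V" "a \<in> A"
  shows chain_marginal_le_marginal: "chain_marginal f R A a \<le> f (insert a R) - f R"
    and chain_marginal_antimono: "R' \<subseteq> R \<Longrightarrow> chain_marginal f R A a \<le> chain_marginal f R' A a"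
  unfolding chain_marginal_eq_marginal[OF assms(4)] using assms(3,4)
  by (auto intro!: submodular_marginal_antimono[OF assms(1,2)])

section \<open>Sums over pairs of distinct elements\<close>

definition pair_sum :: "('a \<Rightarrow> real) \<Rightarrow> 'a set \<Rightarrow> real" where
  "pair_sum q X = (\<Sum>i\<in>X. q i)\<^sup>2 - (\<Sum>i\<in>X. (q i)\<^sup>2)"

lemma pair_sum_cong: "(\<And>i. i \<in> X \<Longrightarrow> q i = q' i) \<Longrightarrow> pair_sum q X = pair_sum q' X"
  by (simp add: pair_sum_def cong: sum.cong)

lemma pair_sum_nonneg:
  assumes "\<And>i. i \<in> X \<Longrightarrow> 0 \<le> q i"
  shows "0 \<le> pair_sum q X"
proof -
  have "sqrt (\<Sum>i\<in>X. (q i)\<^sup>2) \<le> (\<Sum>i\<in>X. q i)"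
    using L2_set_le_sum[of X q] assms by (simp add: L2_set_def)
  then show ?thesis unfolding pair_sum_def using sqrt_le_D by force
qed

lemma pair_sum_mono:
  assumes "finite Y" "X \<subseteq> Y" and nonneg: "\<And>i. i \<in> Y \<Longrightarrow> 0 \<le> q i"
  shows "pair_sum q X \<le> pair_sum q Y"
proof -
  let ?Z = "Y - X"
  have split: "(\<Sum>i\<in>Y. h i) = (\<Sum>i\<in>X. h i) + (\<Sum>i\<in>?Z. h i)" for h :: "'a \<Rightarrow> real"
    using assms(1,2) by (metis add.commute sum.subset_diff)
  have "pair_sum q Y = pair_sum q X + pair_sum q ?Z + 2 * (\<Sum>i\<in>X. q i) * (\<Sum>i\<in>?Z. q i)"
    unfolding pair_sum_def split by (simp add: power2_sum)
  moreover have "0 \<le> pair_sum q ?Z" using nonneg by (intro pair_sum_nonneg) auto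
  moreover have "0 \<le> (\<Sum>i\<in>X. q i) * (\<Sum>i\<in>?Z. q i)"
    using assms(2) nonneg by (intro mult_nonneg_nonneg sum_nonneg) auto
  ultimately show ?thesis by linarith
qed

lemma sum_remove_ge_twice_min:
  fixes q :: "'a \<Rightarrow> real"
  assumes "finite T" "i \<in> T" and bounds: "\<And>x. x \<in> T \<Longrightarrow> q i \<le> q x \<and> 0 < q x \<and> q x \<le> b"
    and over: "2 * b < (\<Sum>x\<in>T. q x)"
  shows "2 * q i \<le> (\<Sum>x\<in>T - {i}. q x)"
proof -
  have "\<not> T \<subseteq> {i, x}" if "x \<in> T" for x
  proof
    assume "T \<subseteq> {i, x}"
    then have "(\<Sum>x\<in>T. q x) \<le> (\<Sum>x\<in>{i, x}. q x)" using bounds that assms(2)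
      by (intro sum_mono2) (auto intro: less_imp_le)
    also have "\<dots> \<le> 2 * b" using bounds[OF that] bounds[OF assms(2)] by (cases "i = x") auto
    finally show False using over by simp
  qed
  then obtain x y where distinct: "x \<in> T" "y \<in> T" "x \<noteq> i" "y \<noteq> i" "x \<noteq> y"
    using assms(2) by blast
  have "q x + q y = (\<Sum>x\<in>{x, y}. q x)" using distinct by simp
  also have "\<dots> \<le> (\<Sum>x\<in>T - {i}. q x)"
    using assms(1) distinct bounds by (intro sum_mono2) (auto intro: less_imp_le)
  finally show ?thesis using bounds[of x] bounds[of y] distinct by simp
qed

lemma exists_pair_sum_remove_ge:
  assumes finite: "finite T" and sizes: "\<And>i. i \<in> T \<Longrightarrow> 0 < q i \<and> q i \<le> 1 / 2"
    and over: "1 < (\<Sum>i\<in>T. q i)"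
  shows "\<exists>i\<in>T. 1 / 9 \<le> pair_sum q (T - {i})"
proof -
  have "T \<noteq> {}" using over by auto
  then obtain i where minimal: "i \<in> T" "\<And>x. x \<in> T \<Longrightarrow> q i \<le> q x"
    using finite by (metis arg_min_if_finite(1) arg_min_least)
  let ?L = "\<Sum>x\<in>T - {i}. q x"
  have "2 * q i \<le> ?L"
    using finite minimal sizes over by (intro sum_remove_ge_twice_min[where b = "1 / 2"]) auto
  moreover have "(\<Sum>x\<in>T. q x) = q i + ?L" using finite minimal(1) by (simp add: sum.remove)
  ultimately have rest_ge: "2 / 3 \<le> ?L" using over by simp
  have "(\<Sum>x\<in>T - {i}. (q x)\<^sup>2) \<le> (\<Sum>x\<in>T - {i}. q x * (1 / 2))"
    unfolding power2_eq_square
    using sizes by (intro sum_mono mult_left_mono) (auto intro: less_imp_le)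
  then have "(\<Sum>x\<in>T - {i}. (q x)\<^sup>2) \<le> ?L / 2" by (simp add: sum_divide_distrib)
  moreover have "2 / 3 * (1 / 6) \<le> ?L * (?L - 1 / 2)" using rest_ge by (intro mult_mono) auto
  ultimately have "1 / 9 \<le> pair_sum q (T - {i})"
    by (simp add: pair_sum_def power2_eq_square algebra_simps)
  with minimal(1) show ?thesis ..
qed

section \<open>A pessimistic estimator of the conflicts of an item\<close>

definition advance :: "('a \<Rightarrow> 'r \<Rightarrow> real) \<Rightarrow> 'a \<Rightarrow> ('r \<Rightarrow> real) \<Rightarrow> 'r \<Rightarrow> real" where
  "advance C a c r = c r + C a r"

definition big_part :: "real \<Rightarrow> real" where
  "big_part x = (if 1 / 2 < x then 1 else 0)"

definition small_part :: "real \<Rightarrow> real" where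
  "small_part x = (if 1 / 2 < x then 0 else x)"

lemma sum_big_part_le_1:
  assumes "finite A" "\<And>a. a \<in> A \<Longrightarrow> 0 \<le> u a" "(\<Sum>a\<in>A. u a) \<le> 1"
  shows "(\<Sum>a\<in>A. big_part (u a)) \<le> 1"
proof -
  define B where "B = {a \<in> A. 1 / 2 < u a}"
  have eq_card: "(\<Sum>a\<in>A. big_part (u a)) = real (card B)"
    using assms(1) by (simp add: big_part_def B_def sum.If_cases Int_def)
  show ?thesis
  proof (cases "B = {}")
    case False
    have "real (card B) * (1 / 2) = (\<Sum>a\<in>B. 1 / 2)" by simp
    also have "\<dots> < (\<Sum>a\<in>B. u a)"
      using assms(1) False by (intro sum_strict_mono) (auto simp: B_def)
    also have "\<dots> \<le> (\<Sum>a\<in>A. u a)" using assms(1,2) by (intro sum_mono2) (auto simp: B_def)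
    finally have "card B < 2" using assms(3) by simp
    then show ?thesis using eq_card by simp
  qed (use eq_card in simp)
qed

lemma sum_small_part_le:
  assumes "\<And>a. a \<in> A \<Longrightarrow> 0 \<le> u a"
  shows "(\<Sum>a\<in>A. small_part (u a)) \<le> (\<Sum>a\<in>A. u a)"
  using assms by (intro sum_mono) (simp add: small_part_def)

text \<open>Row \<open>j\<close> carries the big items of constraint \<open>j\<close>, row \<open>m + j\<close> the small ones. While row \<open>r\<close> has
  received load \<open>c r\<close>, it can still receive \<open>D - c r\<close>, a fraction \<open>p\<close> of which will be sampled.\<close>

locale conflict_risk =
  fixes m :: nat and C :: "'a \<Rightarrow> nat \<Rightarrow> real" and G :: "'a set" and p D :: real
  assumes finite_G: "finite G"
    and size_nonneg: "a \<in> G \<Longrightarrow> r < 2 * m \<Longrightarrow> 0 \<le> C a r"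
    and p_pos: "0 < p"
begin

definition touched :: "'a \<Rightarrow> nat set" where
  "touched a = {j. j < m \<and> 0 < C a j + C a (m + j)}"

definition expected_load :: "'a set \<Rightarrow> (nat \<Rightarrow> real) \<Rightarrow> nat \<Rightarrow> real" where
  "expected_load X c r = (\<Sum>i\<in>X. C i r) + p * (D - c r)"

text \<open>The factor \<open>9\<close> turns the threshold \<open>1 / 9\<close> of the pair sums into \<open>1\<close>.\<close>

definition row_risk :: "'a set \<Rightarrow> (nat \<Rightarrow> real) \<Rightarrow> nat \<Rightarrow> real" where
  "row_risk X c j = expected_load X c j
     + 9 * ((expected_load X c (m + j))\<^sup>2 - (\<Sum>i\<in>X. (C i (m + j))\<^sup>2))"

definition risk :: "'a set \<Rightarrow> (nat \<Rightarrow> real) \<Rightarrow> 'a \<Rightarrow> real" where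
  "risk X c a = (\<Sum>j\<in>touched a. row_risk X c j)"

definition survivors :: "'a set \<Rightarrow> (nat \<Rightarrow> real) \<Rightarrow> 'a set" where
  "survivors R c = {i \<in> R. risk (R - {i}) c i < 1}"

definition loads_bounded :: "(nat \<Rightarrow> real) \<Rightarrow> bool" where
  "loads_bounded c \<longleftrightarrow> (\<forall>r<2 * m. c r \<le> D)"

lemma finite_touched: "finite (touched a)"
  by (simp add: touched_def)

lemma finite_subset_G: "X \<subseteq> G \<Longrightarrow> finite X"
  using finite_G finite_subset by blast

lemma sum_size_nonneg: "X \<subseteq> G \<Longrightarrow> r < 2 * m \<Longrightarrow> 0 \<le> (\<Sum>i\<in>X. C i r)"
  using size_nonneg by (auto intro!: sum_nonneg)

lemma sum_size_le_expected_load: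
  "loads_bounded c \<Longrightarrow> r < 2 * m \<Longrightarrow> (\<Sum>i\<in>X. C i r) \<le> expected_load X c r"
  using p_pos by (simp add: loads_bounded_def expected_load_def)

lemma pair_sum_size_nonneg: "X \<subseteq> G \<Longrightarrow> j < m \<Longrightarrow> 0 \<le> pair_sum (\<lambda>i. C i (m + j)) X"
  using size_nonneg by (intro pair_sum_nonneg) auto

lemma sampled_conflicts_le_row_risk:
  assumes "X \<subseteq> G" "loads_bounded c" "j < m"
  shows "(\<Sum>i\<in>X. C i j) + 9 * pair_sum (\<lambda>i. C i (m + j)) X \<le> row_risk X c j"
proof -
  have "(\<Sum>i\<in>X. C i (m + j))\<^sup>2 \<le> (expected_load X c (m + j))\<^sup>2"
    using assms by (intro power_mono sum_size_le_expected_load sum_size_nonneg) auto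
  moreover have "(\<Sum>i\<in>X. C i j) \<le> expected_load X c j"
    using assms by (intro sum_size_le_expected_load) auto
  ultimately show ?thesis
    unfolding row_risk_def pair_sum_def by (intro add_mono mult_left_mono diff_right_mono) simp_all
qed

lemma row_risk_nonneg:
  assumes "X \<subseteq> G" "loads_bounded c" "j < m"
  shows "0 \<le> row_risk X c j"
  using sampled_conflicts_le_row_risk[OF assms] pair_sum_size_nonneg[OF assms(1,3)]
    sum_size_nonneg[of X j] assms by simp

lemma risk_nonneg: "X \<subseteq> G \<Longrightarrow> loads_bounded c \<Longrightarrow> 0 \<le> risk X c a"
  unfolding risk_def by (rule sum_nonneg) (auto simp: touched_def intro: row_risk_nonneg)

lemma row_risk_le_risk:
  assumes "X \<subseteq> G" "loads_bounded c" "j \<in> touched a"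
  shows "row_risk X c j \<le> risk X c a"
  unfolding risk_def using assms row_risk_nonneg finite_touched
  by (intro member_le_sum) (auto simp: touched_def)

lemma expected_load_insert:
  assumes "X \<subseteq> G" "a \<notin> X"
  shows "expected_load (insert a X) c r = expected_load X c r + C a r"
  using assms finite_subset_G[of X] by (simp add: expected_load_def)

lemma expected_load_advance: "expected_load X (advance C a c) r = expected_load X c r - p * C a r"
  by (simp add: expected_load_def advance_def algebra_simps)

text \<open>The first summand of \<^const>\<open>row_risk\<close> is a martingale, the second one loses the square of
  the load that is not sampled.\<close>

lemma row_risk_supermartingale:
  assumes "X \<subseteq> G" "a \<notin> X"
  shows "p * row_risk (insert a X) (advance C a c) j + (1 - p) * row_risk X (advance C a c) j
    \<le> row_risk X c j"
proof -
  let ?q = "C a (m + j)"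
  have "row_risk X c j
      - (p * row_risk (insert a X) (advance C a c) j + (1 - p) * row_risk X (advance C a c) j)
      = 9 * (p * ?q)\<^sup>2"
    using assms finite_subset_G[of X]
    by (simp add: row_risk_def expected_load_insert expected_load_advance)
      (simp add: power2_eq_square algebra_simps)
  moreover have "0 \<le> 9 * (p * ?q)\<^sup>2" by simp
  ultimately show ?thesis by linarith
qed

lemma risk_supermartingale:
  assumes "X \<subseteq> G" "a \<notin> X"
  shows "p * risk (insert a X) (advance C a c) i + (1 - p) * risk X (advance C a c) i \<le> risk X c i"
  unfolding risk_def sum_distrib_left sum.distrib[symmetric]
  by (rule sum_mono) (rule row_risk_supermartingale[OF assms])

lemma risk_advance_le:
  assumes "X \<subseteq> G" "a \<in> G" "loads_bounded (advance C a c)"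
  shows "risk X (advance C a c) i \<le> risk X c i"
  unfolding risk_def
proof (rule sum_mono)
  fix j assume "j \<in> touched i"
  then have rows: "j < 2 * m" "m + j < 2 * m" by (auto simp: touched_def)
  have load_le: "expected_load X (advance C a c) r \<le> expected_load X c r" if "r < 2 * m" for r
    using size_nonneg[OF assms(2) that] p_pos by (simp add: expected_load_advance)
  have "0 \<le> expected_load X (advance C a c) (m + j)"
    using sum_size_nonneg[OF assms(1) rows(2)] sum_size_le_expected_load[OF assms(3) rows(2)]
    by (rule order_trans)
  then have "(expected_load X (advance C a c) (m + j))\<^sup>2 \<le> (expected_load X c (m + j))\<^sup>2"
    using load_le[OF rows(2)] by (intro power_mono)
  then show "row_risk X (advance C a c) j \<le> row_risk X c j"
    unfolding row_risk_def using load_le[OF rows(1)] by simp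
qed

lemma risk_init_le:
  assumes "real (card (touched a)) \<le> k" "0 \<le> D"
  shows "risk {} (\<lambda>_. 0) a \<le> k * (p * D + 9 * (p * D)\<^sup>2)"
  unfolding risk_def row_risk_def expected_load_def using assms p_pos by (simp add: mult_right_mono)

lemma survivors_subset: "survivors R c \<subseteq> R"
  by (auto simp: survivors_def)

lemma survivors_cong:
  assumes "\<And>r. r < 2 * m \<Longrightarrow> c r = c' r"
  shows "survivors R c = survivors R c'"
proof -
  have "risk X c a = risk X c' a" for X a
    unfolding risk_def row_risk_def expected_load_def
    by (rule sum.cong) (auto simp: touched_def assms)
  then show ?thesis by (simp add: survivors_def)
qed

context
  fixes R c j and u :: "'a \<Rightarrow> real"
  assumes R_sub: "R \<subseteq> G" and bounded: "loads_bounded c" and j_lt: "j < m"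
    and parts: "\<And>a. a \<in> G \<Longrightarrow> C a j = big_part (u a) \<and> C a (m + j) = small_part (u a)"
    and u_bounds: "\<And>a. a \<in> G \<Longrightarrow> 0 \<le> u a \<and> u a \<le> 1"
begin

lemma survivor_conflicts_lt_1:
  assumes "i \<in> survivors R c" "0 < u i"
  shows "(\<Sum>x\<in>R - {i}. C x j) + 9 * pair_sum (\<lambda>x. C x (m + j)) (R - {i}) < 1"
proof -
  have "i \<in> G" using assms(1) R_sub by (auto simp: survivors_def)
  then have touched: "j \<in> touched i"
    using j_lt parts assms(2) by (simp add: touched_def big_part_def small_part_def)
  have "R - {i} \<subseteq> G" using R_sub by auto
  then have "(\<Sum>x\<in>R - {i}. C x j) + 9 * pair_sum (\<lambda>x. C x (m + j)) (R - {i}) \<le> risk (R - {i}) c i"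
    using sampled_conflicts_le_row_risk row_risk_le_risk bounded j_lt touched by (meson order_trans)
  with assms(1) show ?thesis by (simp add: survivors_def)
qed

lemma survivor_pair_sum_lt:
  assumes "i \<in> survivors R c" "0 < u i"
  shows "pair_sum (\<lambda>x. C x (m + j)) (R - {i}) < 1 / 9"
proof -
  have "0 \<le> (\<Sum>x\<in>R - {i}. C x j)" using R_sub j_lt by (intro sum_size_nonneg) auto
  then show ?thesis using survivor_conflicts_lt_1[OF assms] by simp
qed

lemma survivor_excludes_big:
  assumes survivor: "i \<in> survivors R c" "0 < u i" and other: "x \<in> R" "x \<noteq> i"
  shows "u x \<le> 1 / 2"
proof (rule ccontr)
  assume "\<not> ?thesis"
  then have "1 = C x j" using parts R_sub other(1) by (auto simp: big_part_def)
  also have "\<dots> \<le> (\<Sum>x\<in>R - {i}. C x j)"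
    using other R_sub j_lt finite_subset_G[OF R_sub] by (intro member_le_sum size_nonneg) auto
  also have "\<dots> < 1"
  proof -
    have "0 \<le> pair_sum (\<lambda>x. C x (m + j)) (R - {i})"
      using R_sub j_lt by (intro pair_sum_size_nonneg) auto
    then show ?thesis using survivor_conflicts_lt_1[OF survivor] by simp
  qed
  finally show False by simp
qed

theorem survivors_load_le_1: "(\<Sum>i\<in>survivors R c. u i) \<le> 1"
proof (rule ccontr)
  assume over: "\<not> ?thesis"
  define T where "T = {i \<in> survivors R c. 0 < u i}"
  have T_sub: "T \<subseteq> R" and finite: "finite T" "finite R"
    using finite_subset_G[OF R_sub] by (auto simp: T_def survivors_def)
  have "(\<Sum>i\<in>survivors R c. u i) = (\<Sum>i\<in>T. u i)"
    using finite(2) u_bounds R_sub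
    by (intro sum.mono_neutral_right) (force simp: T_def survivors_def order.order_iff_strict)+
  with over have overT: "1 < (\<Sum>i\<in>T. u i)" by simp
  have small: "u x \<le> 1 / 2" if x_in: "x \<in> T" for x
  proof -
    have "u x \<le> 1" using u_bounds R_sub T_sub x_in by blast
    then have "T \<noteq> {x}" using overT by auto
    then obtain i where "i \<in> T" "i \<noteq> x" using x_in by blast
    then show ?thesis using x_in T_sub by (intro survivor_excludes_big[of i x]) (auto simp: T_def)
  qed
  then have "\<And>x. x \<in> T \<Longrightarrow> 0 < u x \<and> u x \<le> 1 / 2" by (simp add: T_def)
  from exists_pair_sum_remove_ge[OF finite(1) this overT]
  obtain i where i_in: "i \<in> T" and "1 / 9 \<le> pair_sum u (T - {i})" by blast
  note this(2)
  also have "pair_sum u (T - {i}) = pair_sum (\<lambda>x. C x (m + j)) (T - {i})"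
  proof (rule pair_sum_cong)
    fix x assume "x \<in> T - {i}"
    then have "x \<in> G" "u x \<le> 1 / 2" using T_sub R_sub small by auto
    then show "u x = C x (m + j)" using parts by (simp add: small_part_def)
  qed
  also have "\<dots> \<le> pair_sum (\<lambda>x. C x (m + j)) (R - {i})"
    using finite(2) T_sub R_sub j_lt size_nonneg by (intro pair_sum_mono) auto
  also have "\<dots> < 1 / 9" using survivor_pair_sum_lt i_in by (simp add: T_def)
  finally show False by simp
qed

end

end

section \<open>Multiplicative weights\<close>

locale multiplicative_weights =
  fixes rows :: "'r set" and C :: "'a \<Rightarrow> 'r \<Rightarrow> real" and G :: "'a set" and D \<delta> :: real
  assumes finite_rows: "finite rows"
    and C_nonneg: "a \<in> G \<Longrightarrow> r \<in> rows \<Longrightarrow> 0 \<le> C a r"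
    and C_le_1: "a \<in> G \<Longrightarrow> r \<in> rows \<Longrightarrow> C a r \<le> 1"
    and C_pos: "a \<in> G \<Longrightarrow> \<exists>r\<in>rows. 0 < C a r"
    and D_ge_1: "1 \<le> D"
    and \<delta>_pos: "0 < \<delta>" and \<delta>_le_1: "\<delta> \<le> 1"
begin

definition reweight :: "'a \<Rightarrow> ('r \<Rightarrow> real) \<Rightarrow> 'r \<Rightarrow> real" where
  "reweight a w r = w r * (1 + \<delta> * C a r)"

definition price :: "('r \<Rightarrow> real) \<Rightarrow> 'a \<Rightarrow> real" where
  "price w a = (\<Sum>r\<in>rows. C a r * w r)"

definition clock :: "('r \<Rightarrow> real) \<Rightarrow> real" where
  "clock w = ln ((\<Sum>r\<in>rows. w r) / real (card rows)) / \<delta>"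

definition horizon :: real where
  "horizon = (D - 1) * (1 - \<delta>) - ln (real (card rows)) / \<delta>"

definition tracks :: "('r \<Rightarrow> real) \<Rightarrow> ('r \<Rightarrow> real) \<Rightarrow> bool" where
  "tracks c w \<longleftrightarrow> (\<forall>r\<in>rows. 0 \<le> c r \<and> c r \<le> D
     \<and> exp ((\<delta> - \<delta>\<^sup>2) * c r) \<le> w r \<and> w r \<le> exp (\<delta> * c r))"

lemma \<delta>_square_le: "0 \<le> \<delta> - \<delta>\<^sup>2"
  using \<delta>_pos \<delta>_le_1 by (simp add: power2_eq_square)

lemma tracks_init: "tracks (\<lambda>_. 0) (\<lambda>_. 1)"
  using D_ge_1 by (simp add: tracks_def)

lemma tracks_load_le: "tracks c w \<Longrightarrow> r \<in> rows \<Longrightarrow> c r \<le> D"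
  by (simp add: tracks_def)

lemma tracks_weight_ge_1:
  assumes "tracks c w" "r \<in> rows"
  shows "1 \<le> w r"
proof -
  have "1 \<le> exp ((\<delta> - \<delta>\<^sup>2) * c r)" using assms \<delta>_square_le by (simp add: tracks_def)
  also have "\<dots> \<le> w r" using assms by (simp add: tracks_def)
  finally show ?thesis .
qed

lemma tracks_advance:
  assumes tracks: "tracks c w" and a_in: "a \<in> G" and room: "\<And>r. r \<in> rows \<Longrightarrow> c r \<le> D - 1"
  shows "tracks (advance C a c) (reweight a w)"
  unfolding tracks_def
proof (intro ballI conjI)
  fix r assume r_in: "r \<in> rows"
  let ?x = "C a r"
  have coef_bounds: "0 \<le> ?x" "?x \<le> 1" using C_nonneg C_le_1 a_in r_in by auto
  have load_nonneg: "0 \<le> c r"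
    and weight_bounds: "exp ((\<delta> - \<delta>\<^sup>2) * c r) \<le> w r" "w r \<le> exp (\<delta> * c r)" "1 \<le> w r"
    using tracks r_in tracks_weight_ge_1[OF tracks r_in] by (auto simp: tracks_def)
  have increment: "0 \<le> \<delta> * ?x" "\<delta> * ?x \<le> 1"
    using coef_bounds \<delta>_pos \<delta>_le_1 by (auto simp: mult_le_one)
  show "0 \<le> advance C a c r" "advance C a c r \<le> D"
    using load_nonneg coef_bounds room[OF r_in] by (auto simp: advance_def)
  have "(\<delta> * ?x)\<^sup>2 \<le> \<delta>\<^sup>2 * ?x"
    unfolding power_mult_distrib
    using coef_bounds by (intro mult_left_mono) (auto simp: power2_eq_square mult_left_le)
  then have "(\<delta> - \<delta>\<^sup>2) * ?x \<le> ln (1 + \<delta> * ?x)"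
    using ln_one_plus_pos_lower_bound[OF increment] by (simp add: algebra_simps)
  then have "exp ((\<delta> - \<delta>\<^sup>2) * ?x) \<le> 1 + \<delta> * ?x"
    using increment by (metis add_pos_nonneg exp_le_cancel_iff exp_ln zero_less_one)
  then have "exp ((\<delta> - \<delta>\<^sup>2) * c r) * exp ((\<delta> - \<delta>\<^sup>2) * ?x) \<le> reweight a w r"
    unfolding reweight_def using weight_bounds by (intro mult_mono) auto
  then show "exp ((\<delta> - \<delta>\<^sup>2) * advance C a c r) \<le> reweight a w r"
    by (simp add: advance_def distrib_left exp_add)
  have "reweight a w r \<le> exp (\<delta> * c r) * exp (\<delta> * ?x)"
    unfolding reweight_def
    using weight_bounds increment by (intro mult_mono exp_ge_add_one_self) auto
  then show "reweight a w r \<le> exp (\<delta> * advance C a c r)"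
    by (simp add: advance_def distrib_left exp_add)
qed

lemma tracks_weight_pos: "tracks c w \<Longrightarrow> r \<in> rows \<Longrightarrow> 0 < w r"
  using tracks_weight_ge_1 by (fastforce intro: less_le_trans)

lemma card_rows_le_total_weight:
  assumes "tracks c w"
  shows "real (card rows) \<le> (\<Sum>r\<in>rows. w r)"
  using sum_bounded_below[of rows 1 w] tracks_weight_ge_1[OF assms] by simp

lemma total_weight_pos:
  assumes "tracks c w" "rows \<noteq> {}"
  shows "0 < (\<Sum>r\<in>rows. w r)"
proof -
  have "0 < real (card rows)" using assms(2) finite_rows by (simp add: card_gt_0_iff)
  then show ?thesis using card_rows_le_total_weight[OF assms(1)] by simp
qed

lemma price_pos:
  assumes "tracks c w" "a \<in> G"
  shows "0 < price w a"
proof -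
  obtain r where positive_row: "r \<in> rows" "0 < C a r" using C_pos[OF assms(2)] by blast
  then show ?thesis
    unfolding price_def
    using tracks_weight_pos[OF assms(1)] C_nonneg[OF assms(2)]
    by (intro sum_pos2[OF finite_rows positive_row(1)]) (auto simp: less_imp_le)
qed

lemma clock_nonneg:
  assumes "tracks c w"
  shows "0 \<le> clock w"
proof (cases "rows = {}")
  case False
  then have "0 < real (card rows)" using finite_rows by (simp add: card_gt_0_iff)
  then have "1 \<le> (\<Sum>r\<in>rows. w r) / real (card rows)"
    using card_rows_le_total_weight[OF assms] by simp
  then show ?thesis using \<delta>_pos by (simp add: clock_def)
next
  case True
  then show ?thesis unfolding clock_def by simp
qed

lemma clock_le:
  assumes "tracks c w"
  shows "clock w \<le> D"
proof (cases "rows = {}")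
  case True
  then show ?thesis unfolding clock_def using D_ge_1 by simp
next
  case False
  have card_pos: "0 < real (card rows)" using False finite_rows by (simp add: card_gt_0_iff)
  have "w r \<le> exp (\<delta> * D)" if "r \<in> rows" for r
  proof -
    have "w r \<le> exp (\<delta> * c r)" using assms that by (simp add: tracks_def)
    also have "\<dots> \<le> exp (\<delta> * D)" using tracks_load_le[OF assms that] \<delta>_pos by simp
    finally show ?thesis .
  qed
  then have "(\<Sum>r\<in>rows. w r) \<le> real (card rows) * exp (\<delta> * D)" by (rule sum_bounded_above)
  then have "(\<Sum>r\<in>rows. w r) / real (card rows) \<le> exp (\<delta> * D)"
    using card_pos by (simp add: pos_divide_le_eq mult.commute)
  then have "ln ((\<Sum>r\<in>rows. w r) / real (card rows)) \<le> \<delta> * D"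
    using card_pos total_weight_pos[OF assms False]
    by (metis divide_pos_pos exp_le_cancel_iff exp_ln)
  then show ?thesis using \<delta>_pos by (simp add: clock_def divide_le_eq mult.commute)
qed

lemma horizon_le: "horizon \<le> D"
proof -
  have "0 \<le> ln (real (card rows)) / \<delta>" using \<delta>_pos by (cases "card rows = 0") auto
  moreover have "(D - 1) * (1 - \<delta>) \<le> (D - 1) * 1" using D_ge_1 \<delta>_pos by (intro mult_left_mono) auto
  ultimately show ?thesis by (simp add: horizon_def)
qed

lemma horizon_le_clock:
  assumes "tracks c w" "r \<in> rows" "D - 1 < c r"
  shows "horizon \<le> clock w"
proof -
  have rows_nonempty: "rows \<noteq> {}" "0 < real (card rows)"
    using assms(2) finite_rows by (auto simp: card_gt_0_iff)
  have total_pos: "0 < (\<Sum>r\<in>rows. w r)" by (rule total_weight_pos[OF assms(1) rows_nonempty(1)])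
  have "exp ((\<delta> - \<delta>\<^sup>2) * (D - 1)) \<le> exp ((\<delta> - \<delta>\<^sup>2) * c r)"
    using assms(3) \<delta>_square_le by (simp add: mult_left_mono)
  also have "\<dots> \<le> w r" using assms by (simp add: tracks_def)
  also have "\<dots> \<le> (\<Sum>r\<in>rows. w r)"
    using assms(2) finite_rows tracks_weight_pos[OF assms(1)]
    by (intro member_le_sum) (auto intro: less_imp_le)
  finally have "(\<delta> - \<delta>\<^sup>2) * (D - 1) \<le> ln (\<Sum>r\<in>rows. w r)" using total_pos by (simp add: ln_ge_iff)
  then have "((\<delta> - \<delta>\<^sup>2) * (D - 1) - ln (real (card rows))) / \<delta> \<le> clock w"
    using \<delta>_pos total_pos rows_nonempty(2) by (simp add: clock_def ln_div divide_right_mono)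
  also have "((\<delta> - \<delta>\<^sup>2) * (D - 1) - ln (real (card rows))) / \<delta> = horizon"
    using \<delta>_pos by (simp add: horizon_def field_simps power2_eq_square)
  finally show ?thesis .
qed

lemma clock_init: "clock (\<lambda>_. 1) = 0"
  by (cases "card rows = 0") (auto simp: clock_def)

lemma
  assumes tracks: "tracks c w" and a_in: "a \<in> G"
  shows clock_le_clock_reweight: "clock w \<le> clock (reweight a w)"
    and clock_reweight_diff_le: "clock (reweight a w) - clock w \<le> price w a / (\<Sum>r\<in>rows. w r)"
proof -
  let ?W = "\<Sum>r\<in>rows. w r"
  have rows_nonempty: "rows \<noteq> {}" "0 < real (card rows)"
    using C_pos[OF a_in] finite_rows by (auto simp: card_gt_0_iff)
  have total_pos: "0 < ?W" by (rule total_weight_pos[OF tracks rows_nonempty(1)])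
  have increment_pos: "0 < \<delta> * (price w a / ?W)"
    using price_pos[OF tracks a_in] total_pos \<delta>_pos by simp
  have "(\<Sum>r\<in>rows. reweight a w r) = ?W + \<delta> * price w a"
    by (simp add: reweight_def price_def sum.distrib sum_distrib_left algebra_simps)
  also have "\<dots> = ?W * (1 + \<delta> * (price w a / ?W))" using total_pos by (simp add: distrib_left)
  finally have diff: "clock (reweight a w) - clock w = ln (1 + \<delta> * (price w a / ?W)) / \<delta>"
    using total_pos increment_pos rows_nonempty(2)
    by (simp add: clock_def ln_div ln_mult diff_divide_distrib add_divide_distrib)
  have "ln (1 + \<delta> * (price w a / ?W)) \<le> \<delta> * (price w a / ?W)"
    using increment_pos by (intro ln_add_one_self_le_self) simp
  then show "clock (reweight a w) - clock w \<le> price w a / ?W"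
    unfolding diff using \<delta>_pos by (simp add: divide_le_eq mult.commute)
  have "0 \<le> ln (1 + \<delta> * (price w a / ?W)) / \<delta>" using increment_pos \<delta>_pos by simp
  with diff show "clock w \<le> clock (reweight a w)" by simp
qed

lemma sum_price_le_total_weight:
  assumes tracks: "tracks c w" and packed: "\<And>r. r \<in> rows \<Longrightarrow> (\<Sum>e\<in>A. C e r) \<le> 1"
    and A_sub: "finite A" "A \<subseteq> G" and B_sub: "B \<subseteq> A"
  shows "(\<Sum>e\<in>B. price w e) \<le> (\<Sum>r\<in>rows. w r)"
proof -
  have "(\<Sum>e\<in>B. price w e) \<le> (\<Sum>e\<in>A. price w e)"
    using A_sub B_sub price_pos[OF tracks] by (intro sum_mono2) (auto intro: less_imp_le)
  also have "\<dots> = (\<Sum>r\<in>rows. w r * (\<Sum>e\<in>A. C e r))"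
    unfolding price_def by (subst sum.swap) (simp add: sum_distrib_left mult.commute)
  also have "\<dots> \<le> (\<Sum>r\<in>rows. w r * 1)"
    using packed tracks_weight_pos[OF tracks]
    by (intro sum_mono mult_left_mono) (auto intro: less_imp_le)
  finally show ?thesis by simp
qed

text \<open>Choosing the item of best ratio \<open>v / price\<close> earns value at least at the rate of
  the packed set \<open>A\<close> per unit of clock.\<close>

lemma clock_reweight_mult_sum_le:
  assumes tracks: "tracks c w" and packed: "\<And>r. r \<in> rows \<Longrightarrow> (\<Sum>e\<in>A. C e r) \<le> 1"
    and A_sub: "finite A" "A \<subseteq> G" and B_sub: "B \<subseteq> A" and a_in: "a \<in> G" and v_nonneg: "0 \<le> v a"
    and best: "\<And>e. e \<in> B \<Longrightarrow> v e / price w e \<le> v a / price w a"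
  shows "(\<Sum>e\<in>B. v e) * (clock (reweight a w) - clock w) \<le> v a"
proof -
  let ?W = "\<Sum>r\<in>rows. w r" and ?dt = "clock (reweight a w) - clock w" and ?\<rho> = "v a / price w a"
  have "rows \<noteq> {}" using C_pos[OF a_in] by auto
  then have total_pos: "0 < ?W" by (rule total_weight_pos[OF tracks])
  have elapsed_nonneg: "0 \<le> ?dt" using clock_le_clock_reweight[OF tracks a_in] by simp
  have "(\<Sum>e\<in>B. v e) \<le> (\<Sum>e\<in>B. ?\<rho> * price w e)"
  proof (rule sum_mono)
    fix e assume e_in: "e \<in> B"
    then have "0 < price w e" using A_sub(2) B_sub by (intro price_pos[OF tracks]) auto
    then show "v e \<le> ?\<rho> * price w e" using best[OF e_in] by (simp only: pos_divide_le_eq)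
  qed
  also have "\<dots> \<le> ?\<rho> * ?W"
    unfolding sum_distrib_left[symmetric] using price_pos[OF tracks a_in] v_nonneg
    by (intro mult_left_mono sum_price_le_total_weight[OF tracks packed A_sub B_sub]) auto
  finally have "(\<Sum>e\<in>B. v e) * ?dt \<le> ?\<rho> * ?W * ?dt" using elapsed_nonneg by (rule mult_right_mono)
  also have "\<dots> \<le> ?\<rho> * ?W * (price w a / ?W)"
    using v_nonneg total_pos price_pos[OF tracks a_in]
    by (intro mult_left_mono clock_reweight_diff_le[OF tracks a_in]) auto
  also have "\<dots> = v a" using total_pos price_pos[OF tracks a_in] by simp
  finally show ?thesis .
qed

end

section \<open>Sampling along multiplicative weights\<close>

locale sampled_packing = multiplicative_weights "{..<M}" C G D \<delta>
  for M :: nat and C :: "'a::linorder \<Rightarrow> nat \<Rightarrow> real" and G :: "'a set" and D \<delta> :: real +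
  fixes m :: nat and A :: "'a set" and f :: "'a set \<Rightarrow> real" and p :: real
  assumes m_rows: "2 * m \<le> M"
    and fin_G: "finite G"
    and A_sub: "A \<subseteq> G"
    and A_packed: "r < M \<Longrightarrow> (\<Sum>e\<in>A. C e r) \<le> 1"
    and f_mono: "monotone_set_fun G f"
    and f_submodular: "submodular G f"
    and p_bounds: "0 < p" "p \<le> 1"
begin

sublocale conflict_risk m C G p D
  using fin_G C_nonneg m_rows p_bounds by unfold_locales auto

definition gain :: "'a set \<Rightarrow> (nat \<Rightarrow> real) \<Rightarrow> 'a \<Rightarrow> real" where
  "gain R c a = (f (insert a R) - f R) * (1 - risk R c a)"

definition ratio :: "'a set \<Rightarrow> (nat \<Rightarrow> real) \<Rightarrow> (nat \<Rightarrow> real) \<Rightarrow> 'a \<Rightarrow> real" where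
  "ratio R c w a = gain R c a / price w a"

definition candidates :: "'a set \<Rightarrow> (nat \<Rightarrow> real) \<Rightarrow> 'a set" where
  "candidates R c = {a \<in> G. a \<notin> R \<and> risk R c a \<le> 1 - \<delta>}"

definition debt :: "'a set \<Rightarrow> (nat \<Rightarrow> real) \<Rightarrow> real" where
  "debt R c = (\<Sum>e\<in>A. chain_marginal f {} A e * risk R c e) + (f R - f {})"

text \<open>The ghost function \<open>g\<close> records the marginal value of each item at the moment it was sampled.\<close>

definition credits :: "'a set \<Rightarrow> ('a \<Rightarrow> real) \<Rightarrow> bool" where
  "credits R g \<longleftrightarrow> (\<forall>i\<in>R. 0 \<le> g i) \<and> (\<forall>T\<subseteq>R. (\<Sum>i\<in>T. g i) \<le> f T - f {})"

definition secured :: "'a set \<Rightarrow> (nat \<Rightarrow> real) \<Rightarrow> ('a \<Rightarrow> real) \<Rightarrow> real" where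
  "secured R c g = (\<Sum>i\<in>R. g i * (1 - risk (R - {i}) c i))"

definition consistent :: "'a set \<Rightarrow> (nat \<Rightarrow> real) \<Rightarrow> (nat \<Rightarrow> real) \<Rightarrow> ('a \<Rightarrow> real) \<Rightarrow> bool" where
  "consistent R c w g \<longleftrightarrow> R \<subseteq> G \<and> tracks c w \<and> credits R g"

definition inflation :: real where
  "inflation = 1 + p * D / \<delta>"

text \<open>Per unit of clock the algorithm earns \<open>(1 - \<delta>) * (f A - f {}) - debt\<close>, a fraction \<open>p\<close> of which
  is secured; \<open>inflation\<close> pays for the debt caused by sampling.\<close>

definition potential :: "'a set \<Rightarrow> (nat \<Rightarrow> real) \<Rightarrow> (nat \<Rightarrow> real) \<Rightarrow> ('a \<Rightarrow> real) \<Rightarrow> real" where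
  "potential R c w g = inflation * secured R c g
     + p * ((1 - \<delta>) * (f A - f {}) * (horizon - clock w) - debt R c * (D - clock w))"

definition stopped :: "'a set \<Rightarrow> (nat \<Rightarrow> real) \<Rightarrow> bool" where
  "stopped R c \<longleftrightarrow> (\<exists>r<M. D - 1 < c r) \<or> (\<forall>a\<in>candidates R c. gain R c a \<le> 0)"

lemma finite_A: "finite A"
  using A_sub by (rule finite_subset_G)

lemma f_mono_on: "X \<subseteq> Y \<Longrightarrow> Y \<subseteq> G \<Longrightarrow> f X \<le> f Y"
  using f_mono by (simp add: monotone_set_fun_def)

lemma marginal_antimono:
  "X \<subseteq> Y \<Longrightarrow> Y \<subseteq> G \<Longrightarrow> a \<in> G \<Longrightarrow> f (insert a Y) - f Y \<le> f (insert a X) - f X"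
  by (rule submodular_marginal_antimono[OF f_submodular f_mono])

lemma tracks_loads_bounded: "tracks c w \<Longrightarrow> loads_bounded c"
  using m_rows by (auto simp: tracks_def loads_bounded_def)

lemma value_nonneg: "0 \<le> f A - f {}"
  using f_mono_on[of "{}" A] A_sub by simp

lemma chain_nonneg: "R \<subseteq> G \<Longrightarrow> 0 \<le> chain_marginal f R A e"
  using f_mono A_sub by (intro chain_marginal_nonneg) auto

lemma gain_nonneg:
  assumes "R \<subseteq> G" "a \<in> candidates R c"
  shows "0 \<le> gain R c a"
proof -
  have "f R \<le> f (insert a R)" using assms by (intro f_mono_on) (auto simp: candidates_def)
  then show ?thesis using assms(2) \<delta>_pos by (auto simp: gain_def candidates_def)
qed

lemma marginal_le_gain:
  assumes "R \<subseteq> G" "a \<in> candidates R c"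
  shows "f (insert a R) - f R \<le> gain R c a / \<delta>"
proof -
  have "f R \<le> f (insert a R)" using assms by (intro f_mono_on) (auto simp: candidates_def)
  then have "(f (insert a R) - f R) * \<delta> \<le> gain R c a"
    unfolding gain_def using assms(2) by (intro mult_left_mono) (auto simp: candidates_def)
  then show ?thesis using \<delta>_pos by (simp add: le_divide_eq)
qed

lemma chain_marginal_discounted_le_gain:
  assumes R_sub: "R \<subseteq> G" and bounded: "loads_bounded c" and e_in: "e \<in> A"
  shows "chain_marginal f R A e - \<delta> * chain_marginal f {} A e - chain_marginal f {} A e * risk R c e
    \<le> (if e \<in> candidates R c then gain R c e else 0)"
proof -
  let ?h = "chain_marginal f {} A e" and ?h' = "chain_marginal f R A e"
  have union_sub: "R \<union> A \<subseteq> G" using R_sub A_sub by auto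
  have le_chain: "?h' \<le> ?h"
    by (rule chain_marginal_antimono[OF f_submodular f_mono union_sub e_in]) simp
  have le_marginal: "?h' \<le> f (insert e R) - f R"
    by (rule chain_marginal_le_marginal[OF f_submodular f_mono union_sub e_in])
  have terms_nonneg: "0 \<le> \<delta> * ?h" "0 \<le> ?h * risk R c e"
    using chain_nonneg[of "{}"] risk_nonneg[OF R_sub bounded] \<delta>_pos by auto
  consider (candidate) "e \<in> candidates R c" | (sampled) "e \<in> R" "e \<notin> candidates R c"
    | (risky) "1 \<le> \<delta> + risk R c e" "e \<notin> candidates R c"
    using e_in A_sub by (force simp: candidates_def)
  then show ?thesis
  proof cases
    case candidate
    then have "?h' * (1 - risk R c e) \<le> gain R c e"
      unfolding gain_def
      using \<delta>_pos by (intro mult_right_mono le_marginal) (auto simp: candidates_def)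
    moreover have "?h' * risk R c e \<le> ?h * risk R c e"
      by (intro mult_right_mono le_chain risk_nonneg R_sub bounded)
    ultimately show ?thesis using candidate terms_nonneg by (simp add: right_diff_distrib)
  next
    case sampled
    then have "?h' \<le> 0" using le_marginal by (simp add: insert_absorb)
    with sampled terms_nonneg show ?thesis by simp
  next
    case risky
    then have "?h * 1 \<le> ?h * (\<delta> + risk R c e)"
      using chain_nonneg[of "{}"] by (intro mult_left_mono) auto
    with risky le_chain show ?thesis by (simp add: algebra_simps)
  qed
qed

lemma sum_gain_candidates_ge:
  assumes R_sub: "R \<subseteq> G" and bounded: "loads_bounded c"
  shows "(1 - \<delta>) * (f A - f {}) - debt R c \<le> (\<Sum>e\<in>A \<inter> candidates R c. gain R c e)"
proof -
  let ?h = "chain_marginal f {} A" and ?h' = "chain_marginal f R A"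
  have "f A \<le> f (R \<union> A)" using R_sub A_sub by (intro f_mono_on) auto
  then have "(1 - \<delta>) * (f A - f {}) - debt R c
      \<le> (f (R \<union> A) - f R) - \<delta> * (f A - f {}) - (\<Sum>e\<in>A. ?h e * risk R c e)"
    by (simp add: debt_def algebra_simps)
  also have "\<dots> = (\<Sum>e\<in>A. ?h' e - \<delta> * ?h e - ?h e * risk R c e)"
    using sum_chain_marginal[OF finite_A, of f R] sum_chain_marginal[OF finite_A, of f "{}"]
    by (simp add: sum_subtractf sum_distrib_left[symmetric])
  also have "\<dots> \<le> (\<Sum>e\<in>A. if e \<in> candidates R c then gain R c e else 0)"
    by (rule sum_mono) (rule chain_marginal_discounted_le_gain[OF R_sub bounded])
  also have "\<dots> = (\<Sum>e\<in>A \<inter> candidates R c. gain R c e)"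
    using finite_A by (simp add: sum.inter_restrict)
  finally show ?thesis .
qed

lemma credits_insert:
  assumes credits: "credits R g" and R_sub: "R \<subseteq> G" and a_new: "a \<in> G" "a \<notin> R"
  shows "credits (insert a R) (g(a := f (insert a R) - f R))"
  unfolding credits_def
proof (intro conjI ballI allI impI)
  let ?g = "g(a := f (insert a R) - f R)"
  show "0 \<le> ?g i" if "i \<in> insert a R" for i
    using that credits f_mono_on[of R "insert a R"] R_sub a_new by (auto simp: credits_def)
  fix T assume T_sub: "T \<subseteq> insert a R"
  have rest_sub: "T - {a} \<subseteq> R" using T_sub by auto
  have "(\<Sum>i\<in>T - {a}. ?g i) = (\<Sum>i\<in>T - {a}. g i)" by (rule sum.cong) auto
  also have "\<dots> \<le> f (T - {a}) - f {}" using credits rest_sub by (simp add: credits_def)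
  finally have rest_credit: "(\<Sum>i\<in>T - {a}. ?g i) \<le> f (T - {a}) - f {}" .
  show "(\<Sum>i\<in>T. ?g i) \<le> f T - f {}"
  proof (cases "a \<in> T")
    case True
    have "finite T" using T_sub R_sub a_new by (intro finite_subset_G) auto
    moreover have "f (insert a R) - f R \<le> f (insert a (T - {a})) - f (T - {a})"
      using rest_sub R_sub a_new by (intro marginal_antimono) auto
    ultimately show ?thesis using rest_credit True by (simp add: sum.remove insert_absorb)
  next
    case False
    with rest_credit show ?thesis by simp
  qed
qed

lemma consistent_init: "consistent {} (\<lambda>_. 0) (\<lambda>_. 1) g"
  by (simp add: consistent_def credits_def tracks_init)

lemma consistent_advance:
  assumes "consistent R c w g" "a \<in> G" "\<And>r. r < M \<Longrightarrow> c r \<le> D - 1"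
  shows "consistent R (advance C a c) (reweight a w) g"
  using assms tracks_advance by (simp add: consistent_def)

lemma consistent_insert:
  assumes "consistent R c w g" "a \<in> G" "a \<notin> R"
  shows "consistent (insert a R) c w (g(a := f (insert a R) - f R))"
  using assms credits_insert by (simp add: consistent_def)

lemma secured_step:
  assumes R_sub: "R \<subseteq> G" and credits: "credits R g" and bounded: "loads_bounded (advance C a c)"
    and a_cand: "a \<in> candidates R c"
  shows "secured R c g + p * gain R c a
    \<le> p * secured (insert a R) (advance C a c) (g(a := f (insert a R) - f R))
      + (1 - p) * secured R (advance C a c) g"
proof -
  let ?c = "advance C a c" and ?v = "f (insert a R) - f R"
  have a_new: "a \<in> G" "a \<notin> R" using a_cand by (auto simp: candidates_def)
  define others where "others = (\<Sum>i\<in>R. g i * (1 - risk (insert a (R - {i})) ?c i))"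
  have "insert a R - {a} = R" using a_new(2) by auto
  moreover have "(\<Sum>i\<in>R. (g(a := ?v)) i * (1 - risk (insert a R - {i}) ?c i)) = others"
    unfolding others_def using a_new(2) by (intro sum.cong) (auto simp: insert_Diff_if)
  ultimately have "secured (insert a R) ?c (g(a := ?v)) = ?v * (1 - risk R ?c a) + others"
    unfolding secured_def using finite_subset_G[OF R_sub] a_new(2) by simp
  moreover have "gain R c a \<le> ?v * (1 - risk R ?c a)"
    unfolding gain_def
    using risk_advance_le[OF R_sub a_new(1) bounded, of a] f_mono_on[of R "insert a R"] R_sub a_new
    by (intro mult_left_mono) auto
  ultimately have sampled_ge: "gain R c a + others \<le> secured (insert a R) ?c (g(a := ?v))" by linarith
  have "secured R c g
      \<le> (\<Sum>i\<in>R. g i * (1 - (p * risk (insert a (R - {i})) ?c i + (1 - p) * risk (R - {i}) ?c i)))"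
    unfolding secured_def
  proof (intro sum_mono mult_left_mono)
    fix i assume i_in: "i \<in> R"
    show "0 \<le> g i" using credits i_in by (simp add: credits_def)
    show "1 - risk (R - {i}) c i
        \<le> 1 - (p * risk (insert a (R - {i})) ?c i + (1 - p) * risk (R - {i}) ?c i)"
      using R_sub a_new(2) by (intro diff_left_mono risk_supermartingale) auto
  qed
  also have "\<dots> = p * others + (1 - p) * secured R ?c g"
    unfolding others_def secured_def sum_distrib_left sum.distrib[symmetric]
    by (rule sum.cong) (auto simp: algebra_simps)
  finally show ?thesis using mult_left_mono[OF sampled_ge, of p] p_pos by (simp add: distrib_left)
qed

lemma debt_nonneg:
  assumes "R \<subseteq> G" "loads_bounded c"
  shows "0 \<le> debt R c"
proof -
  have "0 \<le> (\<Sum>e\<in>A. chain_marginal f {} A e * risk R c e)"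
    using chain_nonneg risk_nonneg[OF assms] by (intro sum_nonneg mult_nonneg_nonneg) auto
  moreover have "f {} \<le> f R" using assms by (intro f_mono_on) auto
  ultimately show ?thesis by (simp add: debt_def)
qed

lemma debt_step:
  assumes "R \<subseteq> G" "a \<notin> R"
  shows "p * debt (insert a R) (advance C a c) + (1 - p) * debt R (advance C a c)
    \<le> debt R c + p * (f (insert a R) - f R)"
proof -
  let ?h = "chain_marginal f {} A" and ?c = "advance C a c"
  have "p * (\<Sum>e\<in>A. ?h e * risk (insert a R) ?c e) + (1 - p) * (\<Sum>e\<in>A. ?h e * risk R ?c e)
      = (\<Sum>e\<in>A. ?h e * (p * risk (insert a R) ?c e + (1 - p) * risk R ?c e))"
    unfolding sum_distrib_left sum.distrib[symmetric] by (rule sum.cong) (auto simp: algebra_simps)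
  also have "\<dots> \<le> (\<Sum>e\<in>A. ?h e * risk R c e)"
    using risk_supermartingale[OF assms] chain_nonneg by (intro sum_mono mult_left_mono) auto
  finally show ?thesis by (simp add: debt_def algebra_simps)
qed

lemma debt_payment_step:
  assumes R_sub: "R \<subseteq> G" and a_cand: "a \<in> candidates R c" and t_bounds: "0 \<le> t" "t \<le> D"
  shows "(p * debt (insert a R) (advance C a c) + (1 - p) * debt R (advance C a c)) * t
    \<le> debt R c * t + p * D / \<delta> * gain R c a"
proof -
  let ?v = "f (insert a R) - f R"
  have "a \<notin> R" using a_cand by (simp add: candidates_def)
  then have "(p * debt (insert a R) (advance C a c) + (1 - p) * debt R (advance C a c)) * t
      \<le> (debt R c + p * ?v) * t"
    using R_sub t_bounds by (intro mult_right_mono debt_step)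
  moreover have "p * ?v * t \<le> p * (gain R c a / \<delta>) * D"
    using marginal_le_gain[OF R_sub a_cand] gain_nonneg[OF R_sub a_cand] t_bounds p_pos \<delta>_pos
    by (intro mult_mono mult_left_mono) auto
  ultimately show ?thesis by (simp add: algebra_simps)
qed

lemma greedy_rate:
  assumes R_sub: "R \<subseteq> G" and tracks: "tracks c w" and a_cand: "a \<in> candidates R c"
    and best: "\<And>b. b \<in> candidates R c \<Longrightarrow> ratio R c w b \<le> ratio R c w a"
  shows "((1 - \<delta>) * (f A - f {}) - debt R c) * (clock (reweight a w) - clock w) \<le> gain R c a"
proof -
  have a_in: "a \<in> G" using a_cand by (simp add: candidates_def)
  have "((1 - \<delta>) * (f A - f {}) - debt R c) * (clock (reweight a w) - clock w)
      \<le> (\<Sum>e\<in>A \<inter> candidates R c. gain R c e) * (clock (reweight a w) - clock w)"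
    using clock_le_clock_reweight[OF tracks a_in]
    by (intro mult_right_mono sum_gain_candidates_ge R_sub tracks_loads_bounded[OF tracks]) simp
  also have "\<dots> \<le> gain R c a"
    using A_packed best
    by (intro clock_reweight_mult_sum_le[OF tracks _ finite_A A_sub _ a_in] gain_nonneg R_sub a_cand)
      (auto simp: ratio_def)
  finally show ?thesis .
qed

theorem potential_step:
  assumes consistent: "consistent R c w g" and room: "\<And>r. r < M \<Longrightarrow> c r \<le> D - 1"
    and a_cand: "a \<in> candidates R c"
    and best: "\<And>b. b \<in> candidates R c \<Longrightarrow> ratio R c w b \<le> ratio R c w a"
  shows "potential R c w g
    \<le> p * potential (insert a R) (advance C a c) (reweight a w) (g(a := f (insert a R) - f R))
      + (1 - p) * potential R (advance C a c) (reweight a w) g"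
proof -
  let ?c = "advance C a c" and ?w = "reweight a w" and ?g = "g(a := f (insert a R) - f R)"
  have R_sub: "R \<subseteq> G" and tracks: "tracks c w" and credits: "credits R g" and a_in: "a \<in> G"
    using consistent a_cand by (auto simp: consistent_def candidates_def)
  have tracks': "tracks ?c ?w" using tracks_advance[OF tracks a_in] room by simp
  define F z t t' where "F = (1 - \<delta>) * (f A - f {})" and "z = gain R c a"
    and "t = clock w" and "t' = clock ?w"
  define X X\<^sub>0 X\<^sub>1 where "X = secured R c g" and "X\<^sub>0 = secured R ?c g"
    and "X\<^sub>1 = secured (insert a R) ?c ?g"
  define d d\<^sub>0 d\<^sub>1 where "d = debt R c" and "d\<^sub>0 = debt R ?c" and "d\<^sub>1 = debt (insert a R) ?c"
  have inflation_props: "inflation = 1 + p * D / \<delta>" "0 \<le> inflation"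
    using p_pos D_ge_1 \<delta>_pos by (auto simp: inflation_def)
  have "X + p * z \<le> p * X\<^sub>1 + (1 - p) * X\<^sub>0"
    unfolding X_def X\<^sub>0_def X\<^sub>1_def z_def
    by (rule secured_step[OF R_sub credits tracks_loads_bounded[OF tracks'] a_cand])
  then have "inflation * (X + p * z) \<le> inflation * (p * X\<^sub>1 + (1 - p) * X\<^sub>0)"
    using inflation_props(2) by (rule mult_left_mono)
  moreover have "(p * d\<^sub>1 + (1 - p) * d\<^sub>0) * (D - t') \<le> d * (D - t') + (inflation - 1) * z"
    using debt_payment_step[OF R_sub a_cand, of "D - t'"] clock_le[OF tracks'] clock_nonneg[OF tracks']
    by (simp add: t'_def d_def d\<^sub>0_def d\<^sub>1_def z_def inflation_props(1))
  then have "p * (F * (horizon - t') - d * (D - t') - (inflation - 1) * z)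
      \<le> p * (F * (horizon - t') - (p * d\<^sub>1 + (1 - p) * d\<^sub>0) * (D - t'))"
    using p_pos by (intro mult_left_mono) auto
  moreover have "(F - d) * (t' - t) \<le> z"
    unfolding F_def d_def t_def t'_def z_def by (rule greedy_rate[OF R_sub tracks a_cand best])
  then have "p * ((F - d) * (t' - t)) \<le> p * z" using p_pos by (intro mult_left_mono) auto
  ultimately show ?thesis
    unfolding potential_def F_def[symmetric] t_def[symmetric] t'_def[symmetric]
      X_def[symmetric] X\<^sub>0_def[symmetric] X\<^sub>1_def[symmetric]
      d_def[symmetric] d\<^sub>0_def[symmetric] d\<^sub>1_def[symmetric]
    by (simp add: algebra_simps)
qed

lemma secured_le_value_survivors:
  assumes R_sub: "R \<subseteq> G" and bounded: "loads_bounded c" and credits: "credits R g"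
  shows "secured R c g \<le> f (survivors R c) - f {}"
proof -
  have "secured R c g \<le> (\<Sum>i\<in>R. if i \<in> survivors R c then g i else 0)"
    unfolding secured_def
  proof (rule sum_mono)
    fix i assume i_in: "i \<in> R"
    have credit_nonneg: "0 \<le> g i" using credits i_in by (simp add: credits_def)
    have "0 \<le> risk (R - {i}) c i" using R_sub bounded by (intro risk_nonneg) auto
    then have "g i * (1 - risk (R - {i}) c i) \<le> g i" using credit_nonneg by (simp add: mult_left_le)
    moreover have "g i * (1 - risk (R - {i}) c i) \<le> 0" if "i \<notin> survivors R c"
      using that i_in credit_nonneg by (auto simp: survivors_def mult_nonneg_nonpos)
    ultimately show "g i * (1 - risk (R - {i}) c i) \<le> (if i \<in> survivors R c then g i else 0)"
      by simp
  qed
  also have "\<dots> = (\<Sum>i\<in>survivors R c. g i)"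
    using finite_subset_G[OF R_sub] survivors_subset by (simp add: sum.If_cases Int_absorb1)
  also have "\<dots> \<le> f (survivors R c) - f {}"
    using credits survivors_subset by (simp add: credits_def)
  finally show ?thesis .
qed

theorem potential_stopped:
  assumes consistent: "consistent R c w g" and stopped: "stopped R c"
  shows "potential R c w g \<le> inflation * (f (survivors R c) - f {})"
proof -
  have R_sub: "R \<subseteq> G" and tracks: "tracks c w" and credits: "credits R g"
    using consistent by (auto simp: consistent_def)
  note bounded = tracks_loads_bounded[OF tracks]
  let ?F = "(1 - \<delta>) * (f A - f {})"
  have left_nonneg: "0 \<le> D - clock w" using clock_le[OF tracks] by simp
  have discounted_nonneg: "0 \<le> ?F" using value_nonneg \<delta>_le_1 by simp
  have "?F * (horizon - clock w) \<le> debt R c * (D - clock w)"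
    using stopped unfolding stopped_def
  proof
    assume "\<exists>r<M. D - 1 < c r"
    then have "horizon \<le> clock w" using horizon_le_clock[OF tracks] by auto
    then have "?F * (horizon - clock w) \<le> 0"
      using discounted_nonneg by (simp add: mult_nonneg_nonpos)
    also have "0 \<le> debt R c * (D - clock w)" using debt_nonneg[OF R_sub bounded] left_nonneg by simp
    finally show ?thesis .
  next
    assume "\<forall>a\<in>candidates R c. gain R c a \<le> 0"
    then have "(\<Sum>e\<in>A \<inter> candidates R c. gain R c e) \<le> 0" by (intro sum_nonpos) auto
    then have "?F \<le> debt R c" using sum_gain_candidates_ge[OF R_sub bounded] by linarith
    moreover have "horizon - clock w \<le> D - clock w" using horizon_le by simp
    ultimately show ?thesis
      using discounted_nonneg left_nonneg mult_left_mono[of "horizon - clock w" "D - clock w" ?F]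
        mult_right_mono[of ?F "debt R c" "D - clock w"] by linarith
  qed
  then have "potential R c w g \<le> inflation * secured R c g"
    unfolding potential_def using p_pos by (simp add: mult_nonneg_nonpos)
  also have "\<dots> \<le> inflation * (f (survivors R c) - f {})"
    using p_pos D_ge_1 \<delta>_pos
    by (intro mult_left_mono secured_le_value_survivors R_sub bounded credits) (simp add: inflation_def)
  finally show ?thesis .
qed

theorem potential_init_ge:
  assumes card: "\<And>a. a \<in> G \<Longrightarrow> real (card (touched a)) \<le> k"
  shows "p * (f A - f {}) * ((1 - \<delta>) * horizon - D * (k * (p * D + 9 * (p * D)\<^sup>2)))
    \<le> potential {} (\<lambda>_. 0) (\<lambda>_. 1) g"
proof -
  let ?q = "k * (p * D + 9 * (p * D)\<^sup>2)"
  have "debt {} (\<lambda>_. 0) \<le> (\<Sum>e\<in>A. chain_marginal f {} A e * ?q)"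
    unfolding debt_def using card A_sub chain_nonneg D_ge_1
    by (auto intro!: sum_mono mult_left_mono risk_init_le)
  also have "\<dots> = (f A - f {}) * ?q"
    using sum_chain_marginal[OF finite_A, of f "{}"] by (simp add: sum_distrib_right[symmetric])
  finally have "debt {} (\<lambda>_. 0) * D \<le> (f A - f {}) * ?q * D"
    using D_ge_1 by (intro mult_right_mono) auto
  then have "p * ((f A - f {}) * ((1 - \<delta>) * horizon - D * ?q))
      \<le> p * ((1 - \<delta>) * (f A - f {}) * horizon - debt {} (\<lambda>_. 0) * D)"
    using p_pos by (intro mult_left_mono) (auto simp: algebra_simps)
  then show ?thesis by (simp add: potential_def secured_def clock_init algebra_simps)
qed

end

section \<open>Running time and expected outcome of randomized programs\<close>

notation Seq (infixr ";;" 55)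
notation RAdd (infixl "\<oplus>" 65)
notation RSub (infixl "\<ominus>" 65)
notation RMul (infixl "\<otimes>" 70)
notation RDiv (infixl "\<oslash>" 70)

primrec prun :: "nat \<Rightarrow> (nat set \<Rightarrow> real) \<Rightarrow> nat \<Rightarrow> com \<Rightarrow> state \<Rightarrow> (com \<times> state) pmf" where
  "prun n f 0 C s = return_pmf (C, s)"
| "prun n f (Suc t) C s = bind_pmf (step n f C s) (\<lambda>x. prun n f t (fst x) (snd x))"

lemma run_eq_prun: "run P n m S c f t = prun n f t P (init_state n m S c)"
proof -
  have "((\<lambda>D. bind_pmf D (\<lambda>(C, s). step n f C s)) ^^ t) D
      = bind_pmf D (\<lambda>x. prun n f t (fst x) (snd x))" for D
  proof (induction t arbitrary: D)
    case 0
    show ?case by (simp add: bind_return_pmf')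
  next
    case (Suc t)
    show ?case
      unfolding funpow_Suc_right o_def Suc by (simp add: bind_assoc_pmf case_prod_unfold)
  qed
  then show ?thesis by (simp add: run_def bind_return_pmf)
qed

lemma prun_Skip: "prun n f t Skip s = return_pmf (Skip, s)"
  by (induction t) (simp_all add: bind_return_pmf)

lemma prun_add: "prun n f (t + t') C s = bind_pmf (prun n f t C s) (\<lambda>x. prun n f t' (fst x) (snd x))"
  by (induction t arbitrary: C s) (simp_all add: bind_return_pmf bind_assoc_pmf)

lemma finite_set_pmf_step: "finite (set_pmf (step n f C s))"
  by (induction C arbitrary: s) auto

lemma finite_set_pmf_prun: "finite (set_pmf (prun n f t C s))"
  by (induction t arbitrary: C s) (auto simp: finite_set_pmf_step)

definition halted :: "(com \<times> state) pmf \<Rightarrow> bool" where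
  "halted D \<longleftrightarrow> (\<forall>x\<in>set_pmf D. fst x = Skip)"

lemma prun_halted:
  assumes "halted (prun n f t C s)" "t \<le> t'"
  shows "prun n f t' C s = prun n f t C s"
proof -
  obtain d where extra: "t' = t + d" using assms(2) le_Suc_ex by blast
  have "bind_pmf (prun n f t C s) (\<lambda>x. prun n f d (fst x) (snd x)) = bind_pmf (prun n f t C s) return_pmf"
  proof (rule bind_pmf_cong)
    fix x assume "x \<in> set_pmf (prun n f t C s)"
    then have "fst x = Skip" using assms(1) by (simp add: halted_def)
    then show "prun n f d (fst x) (snd x) = return_pmf x" by (simp add: prun_Skip prod_eq_iff)
  qed simp
  then show ?thesis by (simp add: extra prun_add bind_return_pmf')
qed

lemma prun_Seq:
  assumes "halted (prun n f t C s)"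
    and "\<And>x. x \<in> set_pmf (prun n f t C s) \<Longrightarrow> halted (prun n f t' C' (snd x))"
  shows "prun n f (Suc (t + t')) (Seq C C') s
    = bind_pmf (prun n f t C s) (\<lambda>x. prun n f t' C' (snd x))"
  using assms
proof (induction t arbitrary: C s)
  case 0
  then show ?case by (simp add: halted_def bind_return_pmf)
next
  case (Suc t)
  show ?case
  proof (cases "C = Skip")
    case True
    then have "halted (prun n f t' C' s)"
      using Suc.prems(2) by (simp add: prun_Skip bind_return_pmf)
    then have "prun n f (Suc t + t') C' s = prun n f t' C' s" by (rule prun_halted) simp
    with True show ?thesis by (simp add: prun_Skip bind_return_pmf)
  next
    case False
    then have "prun n f (Suc (Suc t + t')) (Seq C C') s
        = bind_pmf (step n f C s) (\<lambda>x. prun n f (Suc (t + t')) (Seq (fst x) C') (snd x))"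
      by (simp add: bind_map_pmf case_prod_unfold)
    also have "\<dots> = bind_pmf (step n f C s)
        (\<lambda>x. bind_pmf (prun n f t (fst x) (snd x)) (\<lambda>y. prun n f t' C' (snd y)))"
    proof (rule bind_pmf_cong)
      fix x assume "x \<in> set_pmf (step n f C s)"
      then have support_sub: "set_pmf (prun n f t (fst x) (snd x))
          \<subseteq> set_pmf (prun n f (Suc t) C s)" by auto
      show "prun n f (Suc (t + t')) (Seq (fst x) C') (snd x)
          = bind_pmf (prun n f t (fst x) (snd x)) (\<lambda>y. prun n f t' C' (snd y))"
      proof (rule Suc.IH)
        show "halted (prun n f t (fst x) (snd x))"
          using Suc.prems(1) support_sub unfolding halted_def by blast
        show "halted (prun n f t' C' (snd y))" if "y \<in> set_pmf (prun n f t (fst x) (snd x))" for y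
          using that support_sub by (intro Suc.prems(2)) blast
      qed
    qed simp
    finally show ?thesis by (simp add: bind_assoc_pmf)
  qed
qed

definition guarantees ::
  "nat \<Rightarrow> (nat set \<Rightarrow> real) \<Rightarrow> com \<Rightarrow> state \<Rightarrow> nat \<Rightarrow> (state \<Rightarrow> bool) \<Rightarrow> (state \<Rightarrow> real) \<Rightarrow> real \<Rightarrow> bool" where
  "guarantees n f C s t Q X r \<longleftrightarrow> halted (prun n f t C s)
     \<and> (\<forall>x\<in>set_pmf (prun n f t C s). Q (snd x))
     \<and> r \<le> measure_pmf.expectation (prun n f t C s) (\<lambda>x. X (snd x))"

abbreviation runs_to :: "nat \<Rightarrow> (nat set \<Rightarrow> real) \<Rightarrow> com \<Rightarrow> state \<Rightarrow> nat \<Rightarrow> (state \<Rightarrow> bool) \<Rightarrow> bool" where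
  "runs_to n f C s t Q \<equiv> guarantees n f C s t Q (\<lambda>_. 0) 0"

lemma guarantees_mono:
  assumes "guarantees n f C s t Q X r" "t \<le> t'" "r' \<le> r" "\<And>s'. Q s' \<Longrightarrow> Q' s'"
  shows "guarantees n f C s t' Q' X r'"
  using assms prun_halted[of n f t C s t'] by (auto simp: guarantees_def)

lemma guarantees_time_mono: "guarantees n f C s t Q X r \<Longrightarrow> t \<le> t' \<Longrightarrow> guarantees n f C s t' Q X r"
  by (rule guarantees_mono) auto

lemma guarantees_conseq:
  "guarantees n f C s t Q X r \<Longrightarrow> (\<And>s'. Q s' \<Longrightarrow> Q' s') \<Longrightarrow> guarantees n f C s t Q' X r"
  by (rule guarantees_mono[OF _ order_refl order_refl])

lemma guarantees_return:
  assumes "prun n f t C s = return_pmf (Skip, s')" "Q s'" "r \<le> X s'"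
  shows "guarantees n f C s t Q X r"
  using assms by (simp add: guarantees_def halted_def)

lemma guarantees_Skip: "Q s \<Longrightarrow> r \<le> X s \<Longrightarrow> guarantees n f Skip s t Q X r"
  by (rule guarantees_return) (simp_all add: prun_Skip)

lemma guarantees_runs_to:
  assumes "runs_to n f C s t Q" "\<And>s'. Q s' \<Longrightarrow> r \<le> X s'"
  shows "guarantees n f C s t Q X r"
proof -
  let ?D = "prun n f t C s"
  have "measure_pmf.expectation ?D (\<lambda>_. r) \<le> measure_pmf.expectation ?D (\<lambda>x. X (snd x))"
    using assms by (intro integral_mono_AE integrable_measure_pmf_finite finite_set_pmf_prun)
      (auto simp: AE_measure_pmf_iff guarantees_def)
  then show ?thesis using assms(1) by (simp add: guarantees_def)
qed

lemma guarantees_affine: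
  assumes "guarantees n f C s t Q (\<lambda>s'. a * (X s' - b)) r" "0 < a"
  shows "guarantees n f C s t Q X (r / a + b)"
proof -
  let ?D = "prun n f t C s"
  have "integrable (measure_pmf ?D) (\<lambda>x. X (snd x))"
    by (rule integrable_measure_pmf_finite[OF finite_set_pmf_prun])
  then have "measure_pmf.expectation ?D (\<lambda>x. a * (X (snd x) - b))
      = a * (measure_pmf.expectation ?D (\<lambda>x. X (snd x)) - b)"
    by (simp add: Bochner_Integration.integral_diff)
  then have "r / a \<le> measure_pmf.expectation ?D (\<lambda>x. X (snd x)) - b"
    using assms by (simp add: guarantees_def divide_le_eq mult.commute)
  then show ?thesis using assms(1) by (simp add: guarantees_def)
qed

lemma guarantees_out_dist:
  assumes "guarantees n f P (init_state n m S c) t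
    (\<lambda>s. Q (row_set n 1 0 s)) (\<lambda>s. X (row_set n 1 0 s)) r"
  shows "halts_within P n m S c f t"
    and "T \<in> set_pmf (out_dist P n m S c f t) \<Longrightarrow> Q T"
    and "r \<le> measure_pmf.expectation (out_dist P n m S c f t) X"
  using assms
  by (auto simp: guarantees_def halted_def halts_within_def out_dist_def run_eq_prun case_prod_unfold)

lemma guarantees_Cond:
  assumes "bval b s \<Longrightarrow> guarantees n f C s t Q X r" "\<not> bval b s \<Longrightarrow> guarantees n f C' s t Q X r"
  shows "guarantees n f (Cond b C C') s (Suc t) Q X r"
  using assms by (cases "bval b s") (simp_all add: guarantees_def bind_return_pmf)

lemma guarantees_While:
  assumes "bval b s \<Longrightarrow> guarantees n f (Seq C (While b C)) s t Q X r"
    and "\<not> bval b s \<Longrightarrow> Q s \<and> r \<le> X s"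
  shows "guarantees n f (While b C) s (Suc t) Q X r"
proof (cases "bval b s")
  case True
  with assms(1) show ?thesis by (simp add: guarantees_def bind_return_pmf)
next
  case False
  with assms(2) show ?thesis
    by (intro guarantees_return[where s' = s]) (auto simp: prun_Skip bind_return_pmf)
qed

lemma expectation_bind_ge:
  fixes X :: "'b \<Rightarrow> real"
  assumes "finite (set_pmf D)" "\<And>x. x \<in> set_pmf D \<Longrightarrow> finite (set_pmf (E x))"
    "\<And>x. x \<in> set_pmf D \<Longrightarrow> Y x \<le> measure_pmf.expectation (E x) X"
  shows "measure_pmf.expectation D Y \<le> measure_pmf.expectation (bind_pmf D E) X"
proof -
  have "measure_pmf.expectation D Y \<le> measure_pmf.expectation D (\<lambda>x. measure_pmf.expectation (E x) X)"
    using assms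
    by (intro integral_mono_AE integrable_measure_pmf_finite) (auto simp: AE_measure_pmf_iff)
  also have "\<dots> = measure_pmf.expectation (bind_pmf D E) X"
    using assms(1,2) pmf_expectation_bind[of "set_pmf D" E D X]
    by (simp add: integral_measure_pmf[where A = "set_pmf D"])
  finally show ?thesis .
qed

lemma guarantees_Seq:
  assumes first: "guarantees n f C s t P Y r"
    and second: "\<And>s'. P s' \<Longrightarrow> guarantees n f C' s' t' Q X (Y s')"
  shows "guarantees n f (Seq C C') s (Suc (t + t')) Q X r"
proof -
  let ?D = "prun n f t C s" and ?E = "\<lambda>x. prun n f t' C' (snd x)"
  have continue: "guarantees n f C' (snd x) t' Q X (Y (snd x))" if "x \<in> set_pmf ?D" for x
    using first that by (intro second) (simp add: guarantees_def)
  have run: "prun n f (Suc (t + t')) (Seq C C') s = bind_pmf ?D ?E"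
    using first continue by (intro prun_Seq) (auto simp: guarantees_def)
  have "r \<le> measure_pmf.expectation ?D (\<lambda>x. Y (snd x))" using first by (simp add: guarantees_def)
  also have "\<dots> \<le> measure_pmf.expectation (bind_pmf ?D ?E) (\<lambda>x. X (snd x))"
    using continue by (intro expectation_bind_ge finite_set_pmf_prun) (auto simp: guarantees_def)
  finally show ?thesis using continue unfolding guarantees_def run by (auto simp: halted_def)
qed

lemma guarantees_Seq_runs_to:
  assumes "runs_to n f C s t P" "\<And>s'. P s' \<Longrightarrow> guarantees n f C' s' t' Q X r"
  shows "guarantees n f (Seq C C') s (Suc (t + t')) Q X r"
  by (rule guarantees_Seq[where Y = "\<lambda>_. r"],
    rule guarantees_runs_to[OF assms(1)]) (simp_all add: assms(2))

lemma guarantees_Flip: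
  assumes "\<And>b. b \<in> {0, 1} \<Longrightarrow> Q ((fst s)((a, nval x s, nval y s) := b), snd s)"
    and "2 * r \<le> X ((fst s)((a, nval x s, nval y s) := 0), snd s)
      + X ((fst s)((a, nval x s, nval y s) := 1), snd s)"
  shows "guarantees n f (Flip a x y) s 1 Q X r"
  using assms by (auto simp: guarantees_def halted_def bind_return_pmf' field_simps)

subsection \<open>Straight-line programs\<close>

primrec straight_line :: "com \<Rightarrow> bool" where
  "straight_line Skip \<longleftrightarrow> True"
| "straight_line (NSet a x y v) \<longleftrightarrow> True"
| "straight_line (RSet a x y v) \<longleftrightarrow> True"
| "straight_line (Flip a x y) \<longleftrightarrow> False"
| "straight_line (Query a x b y z) \<longleftrightarrow> True"
| "straight_line (Seq C C') \<longleftrightarrow> straight_line C \<and> straight_line C'"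
| "straight_line (Cond b C C') \<longleftrightarrow> straight_line C \<and> straight_line C'"
| "straight_line (While b C) \<longleftrightarrow> False"

primrec straight_line_time :: "com \<Rightarrow> nat" where
  "straight_line_time Skip = 0"
| "straight_line_time (NSet a x y v) = 1"
| "straight_line_time (RSet a x y v) = 1"
| "straight_line_time (Flip a x y) = 0"
| "straight_line_time (Query a x b y z) = 1"
| "straight_line_time (Seq C C') = Suc (straight_line_time C + straight_line_time C')"
| "straight_line_time (Cond b C C') = Suc (max (straight_line_time C) (straight_line_time C'))"
| "straight_line_time (While b C) = 0"

primrec final_state :: "nat \<Rightarrow> (nat set \<Rightarrow> real) \<Rightarrow> com \<Rightarrow> state \<Rightarrow> state" where
  "final_state n f Skip s = s"
| "final_state n f (NSet a x y v) s = ((fst s)((a, nval x s, nval y s) := nval v s), snd s)"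
| "final_state n f (RSet a x y v) s = (fst s, (snd s)((a, nval x s, nval y s) := rval v s))"
| "final_state n f (Flip a x y) s = s"
| "final_state n f (Query a x b y z) s =
     (fst s, (snd s)((b, nval y s, nval z s) := f (row_set n a (nval x s) s)))"
| "final_state n f (Seq C C') s = final_state n f C' (final_state n f C s)"
| "final_state n f (Cond b C C') s = (if bval b s then final_state n f C s else final_state n f C' s)"
| "final_state n f (While b C) s = s"

lemma prun_straight_line:
  "straight_line C \<Longrightarrow> prun n f (straight_line_time C) C s = return_pmf (Skip, final_state n f C s)"
proof (induction C arbitrary: s)
  case (Seq C C')
  then show ?case
    using prun_Seq[of n f "straight_line_time C" C s "straight_line_time C'" C']
    by (simp add: halted_def bind_return_pmf)
next
  case (Cond b C C')
  have "prun n f t B s = return_pmf (Skip, final_state n f B s)"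
    if "prun n f (straight_line_time B) B s = return_pmf (Skip, final_state n f B s)"
      "straight_line_time B \<le> t" for B t
    using that prun_halted[of n f "straight_line_time B" B s t] by (simp add: halted_def)
  with Cond show ?case by (simp add: bind_return_pmf)
qed (simp_all add: bind_return_pmf)

lemma runs_to_straight_line:
  assumes "straight_line C" "Q (final_state n f C s)" "straight_line_time C \<le> t"
  shows "runs_to n f C s t Q"
  using guarantees_return[OF prun_straight_line[OF assms(1)], where Q = Q and X = "\<lambda>_. 0" and r = 0]
  by (rule guarantees_time_mono) (use assms in auto)

lemma guarantees_Seq_straight_line:
  assumes "straight_line C" "final_state n f C s = s'" "guarantees n f C' s' t Q X r"
  shows "guarantees n f (Seq C C') s (Suc (straight_line_time C + t)) Q X r"
  using assms by (intro guarantees_Seq_runs_to[where P = "\<lambda>u. u = s'"] runs_to_straight_line) auto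

subsection \<open>Frames\<close>

primrec nat_writes :: "com \<Rightarrow> nat set" where
  "nat_writes Skip = {}"
| "nat_writes (NSet a x y v) = {a}"
| "nat_writes (RSet a x y v) = {}"
| "nat_writes (Flip a x y) = {a}"
| "nat_writes (Query a x b y z) = {}"
| "nat_writes (Seq C C') = nat_writes C \<union> nat_writes C'"
| "nat_writes (Cond b C C') = nat_writes C \<union> nat_writes C'"
| "nat_writes (While b C) = nat_writes C"

primrec real_writes :: "com \<Rightarrow> nat set" where
  "real_writes Skip = {}"
| "real_writes (NSet a x y v) = {}"
| "real_writes (RSet a x y v) = {a}"
| "real_writes (Flip a x y) = {}"
| "real_writes (Query a x b y z) = {b}"
| "real_writes (Seq C C') = real_writes C \<union> real_writes C'"
| "real_writes (Cond b C C') = real_writes C \<union> real_writes C'"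
| "real_writes (While b C) = real_writes C"

definition same_except :: "nat set \<Rightarrow> nat set \<Rightarrow> state \<Rightarrow> state \<Rightarrow> bool" where
  "same_except X Y s s' \<longleftrightarrow> (\<forall>a i j. a \<notin> X \<longrightarrow> fst s' (a, i, j) = fst s (a, i, j))
     \<and> (\<forall>a i j. a \<notin> Y \<longrightarrow> snd s' (a, i, j) = snd s (a, i, j))"

abbreviation preserves :: "com \<Rightarrow> state \<Rightarrow> state \<Rightarrow> bool" where
  "preserves C \<equiv> same_except (nat_writes C) (real_writes C)"

lemma same_except_refl: "same_except X Y s s"
  by (simp add: same_except_def)

lemma same_except_trans: "same_except X Y s s' \<Longrightarrow> same_except X Y s' s'' \<Longrightarrow> same_except X Y s s''"
  by (simp add: same_except_def)

lemma same_except_mono: "same_except X Y s s' \<Longrightarrow> X \<subseteq> X' \<Longrightarrow> Y \<subseteq> Y' \<Longrightarrow> same_except X' Y' s s'"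
  unfolding same_except_def by (meson subsetD)

lemma same_exceptD:
  "same_except X Y s s' \<Longrightarrow> a \<notin> X \<Longrightarrow> fst s' (a, i, j) = fst s (a, i, j)"
  "same_except X Y s s' \<Longrightarrow> a \<notin> Y \<Longrightarrow> snd s' (a, i, j) = snd s (a, i, j)"
  by (simp_all add: same_except_def)

lemma step_preserves:
  assumes "x \<in> set_pmf (step n f C s)"
  shows "nat_writes (fst x) \<subseteq> nat_writes C \<and> real_writes (fst x) \<subseteq> real_writes C \<and> preserves C s (snd x)"
  using assms
proof (induction C arbitrary: s x)
  case (Seq C C')
  show ?case
  proof (cases "C = Skip")
    case True
    with Seq.prems show ?thesis by (simp add: same_except_refl)
  next
    case False
    then obtain y where first_step: "y \<in> set_pmf (step n f C s)" "x = (Seq (fst y) C', snd y)"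
      using Seq.prems by (auto simp: case_prod_unfold)
    from Seq.IH(1)[OF first_step(1)] show ?thesis
      by (auto simp: first_step(2) intro: same_except_mono)
  qed
qed (auto simp: same_except_def)

lemma prun_preserves:
  assumes "x \<in> set_pmf (prun n f t C s)"
  shows "preserves C s (snd x)"
  using assms
proof (induction t arbitrary: C s)
  case 0
  then show ?case by (simp add: same_except_refl)
next
  case (Suc t)
  then obtain y where first_step: "y \<in> set_pmf (step n f C s)" "x \<in> set_pmf (prun n f t (fst y) (snd y))"
    by auto
  have "preserves C (snd y) (snd x)"
    using Suc.IH[OF first_step(2)] step_preserves[OF first_step(1)]
    by (auto intro: same_except_mono)
  with step_preserves[OF first_step(1)] show ?case by (blast intro: same_except_trans)
qed

lemma guarantees_frame:
  "guarantees n f C s t Q X r \<Longrightarrow> guarantees n f C s t (\<lambda>s'. preserves C s s' \<and> Q s') X r"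
  by (simp add: guarantees_def prun_preserves)

subsection \<open>Scalar variables and counting loops\<close>

text \<open>The scalar \<open>x\<close> is cell \<open>(0, 0)\<close> of the array \<open>x\<close>.\<close>

abbreviation nat_of :: "state \<Rightarrow> nat \<Rightarrow> nat" where "nat_of s x \<equiv> fst s (x, 0, 0)"
abbreviation real_of :: "state \<Rightarrow> nat \<Rightarrow> real" where "real_of s x \<equiv> snd s (x, 0, 0)"
abbreviation nvar :: "nat \<Rightarrow> nexp" where "nvar x \<equiv> NGet x (NConst 0) (NConst 0)"
abbreviation rvar :: "nat \<Rightarrow> rexp" where "rvar x \<equiv> RGet x (NConst 0) (NConst 0)"
abbreviation nassign :: "nat \<Rightarrow> nexp \<Rightarrow> com" where "nassign x e \<equiv> NSet x (NConst 0) (NConst 0) e"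
abbreviation rassign :: "nat \<Rightarrow> rexp \<Rightarrow> com" where "rassign x e \<equiv> RSet x (NConst 0) (NConst 0) e"

definition set_nat :: "nat \<Rightarrow> nat \<Rightarrow> state \<Rightarrow> state" where
  "set_nat x v s = ((fst s)((x, 0, 0) := v), snd s)"

lemma fst_set_nat [simp]: "fst (set_nat x v s) = (fst s)((x, 0, 0) := v)"
  and snd_set_nat [simp]: "snd (set_nat x v s) = snd s"
  by (simp_all add: set_nat_def)

definition for_loop :: "nat \<Rightarrow> nexp \<Rightarrow> com \<Rightarrow> com" where
  "for_loop x e B = Seq (nassign x (NConst 0))
     (While (NLess (nvar x) e) (Seq B (nassign x (NAdd (nvar x) (NConst 1)))))"

lemma writes_for_loop [simp]:
  "nat_writes (for_loop x e B) = insert x (nat_writes B)"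
  "real_writes (for_loop x e B) = real_writes B"
  by (auto simp: for_loop_def)

lemma runs_to_for_loop:
  fixes x e B s
  defines "P \<equiv> preserves (for_loop x e B) s"
  assumes init: "I 0 (set_nat x 0 s)"
    and x_unwritten: "x \<notin> nat_writes B"
    and bound: "\<And>s'. P s' \<Longrightarrow> nval e s' = N"
    and body: "\<And>i s'. i < N \<Longrightarrow> P s' \<Longrightarrow> nat_of s' x = i \<Longrightarrow> I i s' \<Longrightarrow>
      runs_to n f B s' t (\<lambda>s''. I (Suc i) (set_nat x (Suc i) s''))"
  shows "runs_to n f (for_loop x e B) s (N * (t + 4) + 4) (\<lambda>s'. P s' \<and> I N s')"
proof -
  let ?W = "While (NLess (nvar x) e) (Seq B (nassign x (NAdd (nvar x) (NConst 1))))"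
  have loop: "runs_to n f ?W s' (d * (t + 4) + 1) (\<lambda>s'. P s' \<and> I N s')"
    if "P s'" "I i s'" "nat_of s' x = i" "i + d = N" for d i s'
    using that
  proof (induction d arbitrary: i s')
    case 0
    then show ?case by (auto intro!: guarantees_While simp: bound)
  next
    case (Suc d)
    have "runs_to n f (Seq (Seq B (nassign x (NAdd (nvar x) (NConst 1)))) ?W) s'
        (Suc (Suc (t + 1) + (d * (t + 4) + 1))) (\<lambda>s'. P s' \<and> I N s')"
    proof (intro guarantees_Seq_runs_to)
      show "runs_to n f B s' t (\<lambda>s''. preserves B s' s'' \<and> I (Suc i) (set_nat x (Suc i) s''))"
        using Suc.prems by (intro guarantees_frame body) auto
      fix s'' assume "preserves B s' s'' \<and> I (Suc i) (set_nat x (Suc i) s'')"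
      then have frame: "preserves B s' s''"
        and inv_next: "I (Suc i) (set_nat x (Suc i) s'')" by simp_all
      have "nat_of s'' x = i" using same_exceptD(1)[OF frame x_unwritten] Suc.prems(3) by simp
      then have "final_state n f (nassign x (NAdd (nvar x) (NConst 1))) s'' = set_nat x (Suc i) s''"
        by (simp add: set_nat_def)
      moreover have "preserves (for_loop x e B) s' (set_nat x (Suc i) s'')"
        using frame by (auto simp: same_except_def)
      then have "P (set_nat x (Suc i) s'')"
        using Suc.prems(1) unfolding P_def by (rule same_except_trans[rotated])
      ultimately show "runs_to n f (nassign x (NAdd (nvar x) (NConst 1))) s'' 1
          (\<lambda>u. P u \<and> I (Suc i) u \<and> nat_of u x = Suc i)"
        using inv_next by (intro runs_to_straight_line) auto
    next
      fix u assume "P u \<and> I (Suc i) u \<and> nat_of u x = Suc i"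
      then show "runs_to n f ?W u (d * (t + 4) + 1) (\<lambda>s'. P s' \<and> I N s')"
        using Suc.prems(4) by (intro Suc.IH[where i = "Suc i"]) auto
    qed
    then have "runs_to n f ?W s' (Suc (Suc (Suc (t + 1) + (d * (t + 4) + 1)))) (\<lambda>s'. P s' \<and> I N s')"
      using Suc.prems by (intro guarantees_While) (auto simp: bound)
    then show ?case by (rule guarantees_time_mono) simp
  qed
  have "runs_to n f ?W (set_nat x 0 s) (N * (t + 4) + 1) (\<lambda>s'. P s' \<and> I N s')"
    using init by (intro loop[where i = 0]) (auto simp: P_def same_except_def)
  from guarantees_Seq_straight_line[OF _ _ this, of "nassign x (NConst 0)"]
  show ?thesis unfolding for_loop_def set_nat_def by (rule guarantees_time_mono) simp_all
qed

lemma runs_to_sum_loop: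
  assumes writes: "nat_writes B = {}" "real_writes B \<subseteq> {y}"
    and bound: "\<And>s'. same_except {x} {y} s s' \<Longrightarrow> nval e s' = N"
    and body: "\<And>i s'. i < N \<Longrightarrow> same_except {x} {y} s s' \<Longrightarrow> nat_of s' x = i \<Longrightarrow>
      runs_to n f B s' t (\<lambda>s''. real_of s'' y = real_of s' y + h i)"
  shows "runs_to n f (Seq (rassign y (ROfNat (NConst 0))) (for_loop x e B)) s (N * (t + 4) + 6)
    (\<lambda>s'. real_of s' y = (\<Sum>i<N. h i))"
proof -
  define s\<^sub>0 where "s\<^sub>0 = (fst s, (snd s)((y, 0, 0) := 0))"
  have frame: "same_except {x} {y} s s'" if "preserves (for_loop x e B) s\<^sub>0 s'" for s'
    using that writes by (auto simp: same_except_def s\<^sub>0_def subset_singleton_iff)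
  have "runs_to n f (for_loop x e B) s\<^sub>0 (N * (t + 4) + 4)
    (\<lambda>s'. preserves (for_loop x e B) s\<^sub>0 s' \<and> real_of s' y = (\<Sum>i<N. h i))"
  proof (rule runs_to_for_loop)
    fix i s' assume "i < N" "preserves (for_loop x e B) s\<^sub>0 s'" "nat_of s' x = i"
      and partial_sum: "real_of s' y = (\<Sum>i<i. h i)"
    then have "runs_to n f B s' t (\<lambda>s''. real_of s'' y = real_of s' y + h i)"
      by (intro body frame)
    then show "runs_to n f B s' t (\<lambda>s''. real_of (set_nat x (Suc i) s'') y = (\<Sum>i<Suc i. h i))"
      by (rule guarantees_conseq) (simp add: partial_sum)
  qed (use writes bound frame in \<open>auto simp: s\<^sub>0_def\<close>)
  from guarantees_Seq_straight_line[OF _ _ this, of "rassign y (ROfNat (NConst 0))"]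
  show ?thesis by (rule guarantees_mono) (simp_all add: s\<^sub>0_def)
qed

definition double_loop :: "nat \<Rightarrow> rexp \<Rightarrow> com" where
  "double_loop x e = While (RLess (ROfNat (nvar x)) e) (nassign x (NAdd (nvar x) (nvar x)))"

lemma runs_to_double_loop:
  assumes "nat_of s x = 2 ^ i" "(2 :: nat) ^ i \<le> 2 * B" "B \<le> 2 ^ (i + d)"
    and "\<And>s'. same_except {x} {} s s' \<Longrightarrow> rval e s' = real B"
  shows "runs_to n f (double_loop x e) s (d * 3 + 1)
    (\<lambda>s'. \<exists>l. nat_of s' x = 2 ^ l \<and> B \<le> 2 ^ l \<and> 2 ^ l \<le> 2 * B)"
  using assms
proof (induction d arbitrary: s i)
  case (0 s i)
  have "rval e s = real B" by (rule 0(4)[OF same_except_refl])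
  moreover have "real B \<le> 2 ^ i" using 0(3) by (simp flip: of_nat_le_iff)
  ultimately show ?case
    unfolding double_loop_def using 0(1-3) by (auto intro!: guarantees_While)
next
  case (Suc d s i)
  let ?Q = "\<lambda>s'. \<exists>l. nat_of s' x = 2 ^ l \<and> B \<le> 2 ^ l \<and> 2 ^ l \<le> 2 * B"
  have test: "rval e s = real B" by (rule Suc.prems(4)[OF same_except_refl])
  have "runs_to n f (double_loop x e) s (Suc (Suc (1 + (d * 3 + 1)))) ?Q"
    unfolding double_loop_def
  proof (rule guarantees_While)
    let ?s = "set_nat x (2 ^ Suc i) s"
    assume "bval (RLess (ROfNat (nvar x)) e) s"
    then have "real (2 ^ i) < real B" using Suc.prems(1) test by simp
    then have "2 ^ i < B" by (simp only: of_nat_less_iff)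
    moreover have "rval e s' = real B" if "same_except {x} {} ?s s'" for s'
      using that by (intro Suc.prems(4)) (auto simp: same_except_def)
    ultimately have "runs_to n f (double_loop x e) ?s (d * 3 + 1) ?Q"
      using Suc.prems(3) by (intro Suc.IH[where i = "Suc i"]) auto
    from guarantees_Seq_straight_line[OF _ _ this, of "nassign x (NAdd (nvar x) (nvar x))"]
    show "runs_to n f (nassign x (NAdd (nvar x) (nvar x)) ;;
        While (RLess (ROfNat (nvar x)) e) (nassign x (NAdd (nvar x) (nvar x)))) s
        (Suc (1 + (d * 3 + 1))) ?Q"
      unfolding double_loop_def
      by (rule guarantees_time_mono) (simp_all add: Suc.prems(1) set_nat_def mult_2)
  next
    assume "\<not> bval (RLess (ROfNat (nvar x)) e) s"
    then have "real B \<le> real (2 ^ i)" using Suc.prems(1) test by simp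
    then have "B \<le> 2 ^ i" by (simp only: of_nat_le_iff)
    then show "?Q s \<and> (0 :: real) \<le> 0" using Suc.prems(1,2) by auto
  qed
  then show ?case by (rule guarantees_time_mono) simp
qed

section \<open>The program\<close>

text \<open>Array \<open>0\<close> of naturals holds \<open>n\<close> and \<open>m\<close>; like \<open>SIZE\<close>, \<open>CAPACITY\<close> and \<open>OUTPUT\<close>, it is
  prescribed by \<^const>\<open>init_state\<close> and \<^const>\<open>out_dist\<close>.\<close>

abbreviation (input) OUTPUT :: nat where "OUTPUT \<equiv> 1"
abbreviation (input) SAMPLED :: nat where "SAMPLED \<equiv> 2"
abbreviation (input) FITTING :: nat where "FITTING \<equiv> 3"
abbreviation (input) ITEM :: nat where "ITEM \<equiv> 4"
abbreviation (input) ROW :: nat where "ROW \<equiv> 5"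
abbreviation (input) CHOICE :: nat where "CHOICE \<equiv> 6"
abbreviation (input) HALT :: nat where "HALT \<equiv> 7"
abbreviation (input) SCALE :: nat where "SCALE \<equiv> 8"
abbreviation (input) FLIPPED :: nat where "FLIPPED \<equiv> 9"
abbreviation (input) HEADS :: nat where "HEADS \<equiv> 10"
abbreviation (input) COIN :: nat where "COIN \<equiv> 11"
abbreviation (input) SPARSITY :: nat where "SPARSITY \<equiv> 12"
abbreviation (input) DEGREE :: nat where "DEGREE \<equiv> 13"

abbreviation (input) SIZE :: nat where "SIZE \<equiv> 0"
abbreviation (input) CAPACITY :: nat where "CAPACITY \<equiv> 1"
abbreviation (input) COEF :: nat where "COEF \<equiv> 2"
abbreviation (input) WEIGHT :: nat where "WEIGHT \<equiv> 3"
abbreviation (input) LOAD :: nat where "LOAD \<equiv> 4"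
abbreviation (input) TOTAL :: nat where "TOTAL \<equiv> 5"
abbreviation (input) SQUARES :: nat where "SQUARES \<equiv> 6"
abbreviation (input) RISK :: nat where "RISK \<equiv> 7"
abbreviation (input) VALUE :: nat where "VALUE \<equiv> 8"
abbreviation (input) NEW_VALUE :: nat where "NEW_VALUE \<equiv> 9"
abbreviation (input) PRICE :: nat where "PRICE \<equiv> 10"
abbreviation (input) BEST :: nat where "BEST \<equiv> 11"
abbreviation (input) RATIO :: nat where "RATIO \<equiv> 12"
abbreviation (input) BUDGET :: nat where "BUDGET \<equiv> 13"
abbreviation (input) PROB :: nat where "PROB \<equiv> 14"

abbreviation zero :: nexp where "zero \<equiv> NConst 0"
abbreviation one :: nexp where "one \<equiv> NConst 1"
abbreviation rnum :: "nat \<Rightarrow> rexp" where "rnum v \<equiv> ROfNat (NConst v)"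
abbreviation item_count :: nexp where "item_count \<equiv> NGet 0 zero zero"
abbreviation constraint_count :: nexp where "constraint_count \<equiv> NGet 0 zero one"
abbreviation row_count :: nexp where
  "row_count \<equiv> NAdd (NAdd constraint_count constraint_count) item_count"
abbreviation small_row :: nexp where "small_row \<equiv> NAdd constraint_count (nvar ROW)"
abbreviation coef_exp :: "nexp \<Rightarrow> rexp" where "coef_exp r \<equiv> RGet COEF (nvar ITEM) r"
abbreviation is_sampled :: rexp where "is_sampled \<equiv> ROfNat (NGet SAMPLED zero (nvar ITEM))"

text \<open>\<open>TOTAL\<close> and \<open>SQUARES\<close> sum over all sampled items, so the share of the current item, whose
  risk is due to the others, is subtracted.\<close>

definition expected_load_exp :: "nexp \<Rightarrow> rexp" where
  "expected_load_exp r = RGet TOTAL zero r \<ominus> is_sampled \<otimes> coef_exp r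
     \<oplus> rvar PROB \<otimes> (rvar BUDGET \<ominus> RGet LOAD zero r)"

definition squares_exp :: "nexp \<Rightarrow> rexp" where
  "squares_exp r = RGet SQUARES zero r \<ominus> is_sampled \<otimes> (coef_exp r \<otimes> coef_exp r)"

definition row_risk_exp :: rexp where
  "row_risk_exp = expected_load_exp (nvar ROW)
     \<oplus> rnum 9 \<otimes> (expected_load_exp small_row \<otimes> expected_load_exp small_row \<ominus> squares_exp small_row)"

definition risk_step_prog :: com where
  "risk_step_prog = Cond (RLess (rnum 0) (coef_exp (nvar ROW) \<oplus> coef_exp small_row))
     (rassign RISK (rvar RISK \<oplus> row_risk_exp)) Skip"

definition risk_prog :: com where
  "risk_prog = (rassign RISK (rnum 0) ;; for_loop ROW constraint_count risk_step_prog)"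

definition price_step_prog :: com where
  "price_step_prog = rassign PRICE (rvar PRICE \<oplus> coef_exp (nvar ROW) \<otimes> RGet WEIGHT zero (nvar ROW))"

definition price_prog :: com where
  "price_prog = (rassign PRICE (rnum 0) ;; for_loop ROW row_count price_step_prog)"

definition query_prog :: com where
  "query_prog = (Query SAMPLED zero VALUE zero zero ;; NSet SAMPLED zero (nvar ITEM) one ;;
     Query SAMPLED zero NEW_VALUE zero zero ;; NSet SAMPLED zero (nvar ITEM) zero)"

definition compare_prog :: com where
  "compare_prog =
     (rassign RATIO ((rvar NEW_VALUE \<ominus> rvar VALUE) \<otimes> (rnum 1 \<ominus> rvar RISK) \<oslash> rvar PRICE) ;;
      Cond (RLess (rvar BEST) (rvar RATIO))
        (rassign BEST (rvar RATIO) ;; nassign CHOICE (nvar ITEM)) Skip)"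

definition evaluate_prog :: com where
  "evaluate_prog = (query_prog ;; price_prog ;; compare_prog)"

definition candidate_test :: bexp where
  "candidate_test = BAnd (NLess zero (NGet FITTING zero (nvar ITEM)))
     (BAnd (NLess (NGet SAMPLED zero (nvar ITEM)) one)
       (BNot (RLess (rnum 1 \<ominus> rnum 1 \<oslash> rnum 100) (rvar RISK))))"

definition select_step_prog :: com where
  "select_step_prog = (risk_prog ;; Cond candidate_test evaluate_prog Skip)"

definition select_prog :: com where
  "select_prog = (rassign BEST (rnum 0) ;; for_loop ITEM item_count select_step_prog)"

definition flip_step_prog :: com where
  "flip_step_prog = (Flip COIN zero zero ;; Cond (NLess (nvar COIN) one) (nassign HEADS zero) Skip ;;
     nassign FLIPPED (NAdd (nvar FLIPPED) (nvar FLIPPED)))"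

definition flip_loop :: com where
  "flip_loop = While (NLess (nvar FLIPPED) (nvar SCALE)) flip_step_prog"

definition flip_prog :: com where
  "flip_prog = (nassign FLIPPED one ;; nassign HEADS one ;; flip_loop)"

abbreviation chosen_coef :: rexp where "chosen_coef \<equiv> RGet COEF (nvar CHOICE) (nvar ROW)"

abbreviation radd_row :: "nat \<Rightarrow> rexp \<Rightarrow> com" where
  "radd_row a e \<equiv> RSet a zero (nvar ROW) (RGet a zero (nvar ROW) \<oplus> e)"

definition update_row_prog :: com where
  "update_row_prog =
     (radd_row LOAD chosen_coef ;;
      RSet WEIGHT zero (nvar ROW)
        (RGet WEIGHT zero (nvar ROW) \<otimes> (rnum 1 \<oplus> rnum 1 \<oslash> rnum 100 \<otimes> chosen_coef)) ;;
      radd_row TOTAL (ROfNat (nvar HEADS) \<otimes> chosen_coef) ;;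
      radd_row SQUARES (ROfNat (nvar HEADS) \<otimes> (chosen_coef \<otimes> chosen_coef)) ;;
      Cond (RLess (rvar BUDGET \<ominus> rnum 1) (RGet LOAD zero (nvar ROW))) (nassign HALT one) Skip)"

definition update_prog :: com where
  "update_prog = (for_loop ROW row_count update_row_prog ;; NSet SAMPLED zero (nvar CHOICE) (nvar HEADS))"

definition round_prog :: com where
  "round_prog = (select_prog ;;
     Cond (RLess (rnum 0) (rvar BEST)) (flip_prog ;; update_prog) (nassign HALT one))"

definition main_loop :: com where
  "main_loop = While (NLess (nvar HALT) one) round_prog"

definition output_step_prog :: com where
  "output_step_prog = (risk_prog ;;
     Cond (BAnd (NLess zero (NGet SAMPLED zero (nvar ITEM))) (RLess (rvar RISK) (rnum 1)))
       (NSet OUTPUT zero (nvar ITEM) one) (NSet OUTPUT zero (nvar ITEM) zero))"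

definition output_prog :: com where
  "output_prog = for_loop ITEM item_count output_step_prog"

lemma writes_risk_prog [simp]: "nat_writes risk_prog = {ROW}" "real_writes risk_prog = {RISK}"
  and writes_price_prog [simp]: "nat_writes price_prog = {ROW}" "real_writes price_prog = {PRICE}"
  by (simp_all add: risk_prog_def risk_step_prog_def price_prog_def price_step_prog_def)

lemma writes_evaluate_prog [simp]:
  "nat_writes evaluate_prog = {SAMPLED, ROW, CHOICE}"
  "real_writes evaluate_prog = {VALUE, NEW_VALUE, PRICE, RATIO, BEST}"
  by (auto simp: evaluate_prog_def query_prog_def compare_prog_def)

lemma writes_select_step_prog [simp]:
  "nat_writes select_step_prog = {SAMPLED, ROW, CHOICE}"
  "real_writes select_step_prog = {RISK, VALUE, NEW_VALUE, PRICE, RATIO, BEST}"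
  by (auto simp: select_step_prog_def)

lemma writes_select_prog [simp]:
  "nat_writes select_prog = {ITEM, SAMPLED, ROW, CHOICE}"
  "real_writes select_prog = {RISK, VALUE, NEW_VALUE, PRICE, RATIO, BEST}"
  by (auto simp: select_prog_def)

lemma writes_flip_prog [simp]: "nat_writes flip_prog = {FLIPPED, HEADS, COIN}"
  "real_writes flip_prog = {}"
  by (auto simp: flip_prog_def flip_loop_def flip_step_prog_def)

lemma writes_update_row_prog [simp]:
  "nat_writes update_row_prog = {HALT}" "real_writes update_row_prog = {WEIGHT, LOAD, TOTAL, SQUARES}"
  by (auto simp: update_row_prog_def)

lemma writes_output_step_prog [simp]:
  "nat_writes output_step_prog = {OUTPUT, ROW}" "real_writes output_step_prog = {RISK}"
  by (auto simp: output_step_prog_def)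

section \<open>Flipping a coin of bias \<open>1 / 2 ^ L\<close>\<close>

lemma flip_step_prog_spec:
  fixes v :: "nat \<Rightarrow> real"
  assumes "nat_of s FLIPPED = k" "nat_of s HEADS = h" "h \<in> {0, 1}" "2 * r \<le> v 0 + v h"
  shows "guarantees n f flip_step_prog s 6
    (\<lambda>s'. nat_of s' FLIPPED = 2 * k \<and> nat_of s' HEADS \<in> {0, 1}) (\<lambda>s'. v (nat_of s' HEADS)) r"
proof -
  let ?C = "Cond (NLess (nvar COIN) one) (nassign HEADS zero) Skip ;;
    nassign FLIPPED (NAdd (nvar FLIPPED) (nvar FLIPPED))"
  let ?Y = "\<lambda>s'. v (if nat_of s' COIN = 0 then 0 else h)"
  have "guarantees n f (Flip COIN zero zero) s 1
      (\<lambda>s'. nat_of s' FLIPPED = k \<and> nat_of s' HEADS = h) ?Y r"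
    using assms by (intro guarantees_Flip) auto
  then have "guarantees n f (Flip COIN zero zero ;; ?C) s (Suc (1 + 4))
      (\<lambda>s'. nat_of s' FLIPPED = 2 * k \<and> nat_of s' HEADS \<in> {0, 1}) (\<lambda>s'. v (nat_of s' HEADS)) r"
  proof (rule guarantees_Seq)
    fix s' assume after_flip: "nat_of s' FLIPPED = k \<and> nat_of s' HEADS = h"
    have "runs_to n f ?C s' 4
        (\<lambda>s''. nat_of s'' FLIPPED = 2 * k \<and> nat_of s'' HEADS = (if nat_of s' COIN = 0 then 0 else h))"
      using after_flip by (intro runs_to_straight_line) auto
    then have "guarantees n f ?C s' 4
        (\<lambda>s''. nat_of s'' FLIPPED = 2 * k \<and> nat_of s'' HEADS = (if nat_of s' COIN = 0 then 0 else h))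
        (\<lambda>s'. v (nat_of s' HEADS)) (?Y s')" by (rule guarantees_runs_to) simp
    then show "guarantees n f ?C s' 4 (\<lambda>s'. nat_of s' FLIPPED = 2 * k \<and> nat_of s' HEADS \<in> {0, 1})
        (\<lambda>s'. v (nat_of s' HEADS)) (?Y s')"
      by (rule guarantees_conseq) (use assms(3) in simp)
  qed
  then show ?thesis by (simp add: flip_step_prog_def)
qed

lemma flip_loop_spec:
  assumes "nat_of s FLIPPED = 2 ^ i" "nat_of s SCALE = 2 ^ (i + l)" "nat_of s HEADS = h" "h \<in> {0, 1}"
  shows "guarantees n f flip_loop s (l * 8 + 1) (\<lambda>s'. nat_of s' HEADS \<in> {0, 1})
    (\<lambda>s'. if nat_of s' HEADS = 1 then Y else Z) (real h / 2 ^ l * Y + (1 - real h / 2 ^ l) * Z)"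
  using assms
proof (induction l arbitrary: s i h)
  case 0
  then show ?case unfolding flip_loop_def by (simp, intro guarantees_While) auto
next
  case (Suc l)
  define v where "v x = real x / 2 ^ l * Y + (1 - real x / 2 ^ l) * Z" for x :: nat
  let ?X = "\<lambda>s'. if nat_of s' HEADS = 1 then Y else Z" and ?Q = "\<lambda>s'. nat_of s' HEADS \<in> {0, 1}"
  let ?r = "real h / 2 ^ Suc l * Y + (1 - real h / 2 ^ Suc l) * Z"
  have "2 * ?r \<le> v 0 + v h" by (simp add: v_def field_simps)
  then have "guarantees n f flip_step_prog s 6
      (\<lambda>s'. nat_of s' FLIPPED = 2 * 2 ^ i \<and> nat_of s' HEADS \<in> {0, 1}) (\<lambda>s'. v (nat_of s' HEADS)) ?r"
    by (rule flip_step_prog_spec[OF Suc.prems(1,3,4)])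
  then have "guarantees n f (flip_step_prog ;; flip_loop) s (Suc (6 + (l * 8 + 1))) ?Q ?X ?r"
  proof (rule guarantees_Seq[OF guarantees_frame])
    fix s' assume after_step: "preserves flip_step_prog s s'
      \<and> nat_of s' FLIPPED = 2 * 2 ^ i \<and> nat_of s' HEADS \<in> {0, 1}"
    then have "nat_of s' SCALE = 2 ^ (Suc i + l)"
      using Suc.prems(2) by (auto simp: same_except_def flip_step_prog_def)
    with after_step show "guarantees n f flip_loop s' (l * 8 + 1) ?Q ?X (v (nat_of s' HEADS))"
      unfolding v_def by (intro Suc.IH[where i = "Suc i"]) auto
  qed
  moreover have "2 ^ i < (2 :: nat) ^ (i + Suc l)" by (rule power_strict_increasing) auto
  ultimately have "guarantees n f flip_loop s (Suc (Suc (6 + (l * 8 + 1)))) ?Q ?X ?r"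
    unfolding flip_loop_def using Suc.prems(1,2) by (intro guarantees_While) auto
  then show ?case by (rule guarantees_time_mono) simp
qed

lemma flip_prog_spec:
  assumes "nat_of s SCALE = 2 ^ L"
  shows "guarantees n f flip_prog s (L * 8 + 5) (\<lambda>s'. nat_of s' HEADS \<in> {0, 1})
    (\<lambda>s'. if nat_of s' HEADS = 1 then Y else Z) (1 / 2 ^ L * Y + (1 - 1 / 2 ^ L) * Z)"
proof -
  let ?s = "set_nat HEADS 1 (set_nat FLIPPED 1 s)"
  have "guarantees n f flip_loop ?s (L * 8 + 1) (\<lambda>s'. nat_of s' HEADS \<in> {0, 1})
      (\<lambda>s'. if nat_of s' HEADS = 1 then Y else Z) (real 1 / 2 ^ L * Y + (1 - real 1 / 2 ^ L) * Z)"
    using assms by (intro flip_loop_spec[where i = 0]) simp_all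
  then have "guarantees n f (nassign HEADS one ;; flip_loop) (set_nat FLIPPED 1 s)
      (Suc (straight_line_time (nassign HEADS one) + (L * 8 + 1))) (\<lambda>s'. nat_of s' HEADS \<in> {0, 1})
      (\<lambda>s'. if nat_of s' HEADS = 1 then Y else Z) (real 1 / 2 ^ L * Y + (1 - real 1 / 2 ^ L) * Z)"
    by (rule guarantees_Seq_straight_line[rotated 2]) (simp_all add: set_nat_def)
  from guarantees_Seq_straight_line[OF _ _ this, of "nassign FLIPPED one"]
  show ?thesis unfolding flip_prog_def by (rule guarantees_mono) (simp_all add: set_nat_def)
qed

section \<open>Correctness of the main loop\<close>

definition round_time :: "nat \<Rightarrow> nat \<Rightarrow> nat \<Rightarrow> nat" where
  "round_time n m L = n * (m * 6 + (2 * m + n) * 5 + 33) + L * 8 + (2 * m + n) * 14 + 20"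

definition loop_time :: "nat \<Rightarrow> nat \<Rightarrow> nat \<Rightarrow> nat" where
  "loop_time n m L = (n * 2 ^ L + 1) * (round_time n m L + 2) + n * (m * 6 + 13) + 6"

locale packing_program = sampled_packing "2 * m + n" C G D "1 / 100" m A f p
  for n m :: nat and C :: "nat \<Rightarrow> nat \<Rightarrow> real" and G :: "nat set" and D :: real
    and A :: "nat set" and f :: "nat set \<Rightarrow> real" and p :: real +
  fixes L :: nat
  assumes G_items: "G \<subseteq> {..<n}"
    and C_own: "a \<in> G \<Longrightarrow> C a (2 * m + a) = 1"
    and p_eq: "p = 1 / 2 ^ L"
begin

abbreviation M :: nat where "M \<equiv> 2 * m + n"

definition rep :: "nat set \<Rightarrow> (nat \<Rightarrow> real) \<Rightarrow> (nat \<Rightarrow> real) \<Rightarrow> state \<Rightarrow> bool" where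
  "rep R c w s \<longleftrightarrow> R \<subseteq> G \<and> fst s (0, 0, 0) = n \<and> fst s (0, 0, 1) = m
     \<and> nat_of s SCALE = 2 ^ L \<and> real_of s BUDGET = D \<and> real_of s PROB = p
     \<and> (\<forall>a<n. fst s (SAMPLED, 0, a) = of_bool (a \<in> R) \<and> fst s (FITTING, 0, a) = of_bool (a \<in> G)
         \<and> (\<forall>r<M. snd s (COEF, a, r) = C a r))
     \<and> (\<forall>r<M. snd s (WEIGHT, 0, r) = w r \<and> snd s (LOAD, 0, r) = c r
         \<and> snd s (TOTAL, 0, r) = (\<Sum>i\<in>R. C i r) \<and> snd s (SQUARES, 0, r) = (\<Sum>i\<in>R. (C i r)\<^sup>2))"

lemma repD:
  assumes "rep R c w s"
  shows "R \<subseteq> G" "finite R" "fst s (0, 0, 0) = n" "fst s (0, 0, Suc 0) = m" "nat_of s SCALE = 2 ^ L"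
    "real_of s BUDGET = D" "real_of s PROB = p"
    "a < n \<Longrightarrow> fst s (SAMPLED, 0, a) = of_bool (a \<in> R)"
    "a < n \<Longrightarrow> fst s (FITTING, 0, a) = of_bool (a \<in> G)"
    "a < n \<Longrightarrow> r < M \<Longrightarrow> snd s (COEF, a, r) = C a r"
    "r < M \<Longrightarrow> snd s (WEIGHT, 0, r) = w r" "r < M \<Longrightarrow> snd s (LOAD, 0, r) = c r"
    "r < M \<Longrightarrow> snd s (TOTAL, 0, r) = (\<Sum>i\<in>R. C i r)" "r < M \<Longrightarrow> snd s (SQUARES, 0, r) = (\<Sum>i\<in>R. (C i r)\<^sup>2)"
  using assms finite_subset_G unfolding rep_def by auto

lemma rep_frame:
  assumes "rep R c w s" "same_except X Y s s'" "X \<inter> {0, SAMPLED, FITTING, SCALE} = {}"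
    "Y \<inter> {COEF, WEIGHT, LOAD, TOTAL, SQUARES, BUDGET, PROB} = {}"
  shows "rep R c w s'"
proof -
  have "x \<notin> X" if "x \<in> {0, SAMPLED, FITTING, SCALE}" for x using that assms(3) by blast
  moreover have "y \<notin> Y" if "y \<in> {COEF, WEIGHT, LOAD, TOTAL, SQUARES, BUDGET, PROB}" for y
    using that assms(4) by blast
  ultimately show ?thesis using assms(1) same_exceptD[OF assms(2)] unfolding rep_def by simp
qed

lemma rep_set_nat:
  "x \<notin> {0, SAMPLED, FITTING, SCALE} \<Longrightarrow> rep R c w s \<Longrightarrow> rep R c w (set_nat x v s)"
  by (simp add: rep_def)

lemma row_set_rep:
  assumes "rep R c w s"
  shows "row_set n SAMPLED 0 s = R"
  using repD(1)[OF assms] G_items by (auto simp: row_set_def repD(8)[OF assms] split: if_splits)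

lemma rval_expected_load_exp:
  assumes "rep R c w s" "nat_of s ITEM < n" "nval r s < M"
  shows "rval (expected_load_exp r) s = expected_load (R - {nat_of s ITEM}) c (nval r s)"
  using assms repD[OF assms(1)] by (simp add: expected_load_exp_def expected_load_def sum_diff1)

lemma rval_squares_exp:
  assumes "rep R c w s" "nat_of s ITEM < n" "nval r s < M"
  shows "rval (squares_exp r) s = (\<Sum>i\<in>R - {nat_of s ITEM}. (C i (nval r s))\<^sup>2)"
  using assms repD[OF assms(1)] by (simp add: squares_exp_def sum_diff1 power2_eq_square)

lemma risk_prog_spec:
  assumes rep: "rep R c w s" and item: "nat_of s ITEM = a" "a < n"
  shows "runs_to n f risk_prog s (m * 6 + 6) (\<lambda>s'. real_of s' RISK = risk (R - {a}) c a)"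
proof -
  let ?h = "\<lambda>j. if j \<in> touched a then row_risk (R - {a}) c j else 0"
  have "runs_to n f risk_prog s (m * (2 + 4) + 6) (\<lambda>s'. real_of s' RISK = (\<Sum>j<m. ?h j))"
    unfolding risk_prog_def
  proof (rule runs_to_sum_loop)
    fix s' assume frame: "same_except {ROW} {RISK} s s'"
    have rep': "rep R c w s'" by (rule rep_frame[OF rep frame]) auto
    show "nval constraint_count s' = m" using repD[OF rep'] by simp
    fix j assume row: "j < m" "nat_of s' ROW = j"
    have item': "nat_of s' ITEM = a" using same_exceptD(1)[OF frame] item by simp
    have "rval row_risk_exp s' = row_risk (R - {a}) c j"
      using rep' row item item' repD[OF rep']
      by (simp add: row_risk_exp_def row_risk_def rval_expected_load_exp rval_squares_exp
          power2_eq_square)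
    then show "runs_to n f risk_step_prog s' 2 (\<lambda>s''. real_of s'' RISK = real_of s' RISK + ?h j)"
      using row item item' repD[OF rep']
      by (intro runs_to_straight_line) (auto simp: risk_step_prog_def touched_def)
  qed (auto simp: risk_step_prog_def)
  moreover have "(\<Sum>j<m. ?h j) = risk (R - {a}) c a"
    unfolding risk_def touched_def by (simp add: sum.If_cases lessThan_def Collect_conj_eq)
  ultimately show ?thesis by simp
qed

lemma price_prog_spec:
  assumes rep: "rep R c w s" and item: "nat_of s ITEM = a" "a < n"
  shows "runs_to n f price_prog s (M * 5 + 6) (\<lambda>s'. real_of s' PRICE = price w a)"
proof -
  have "runs_to n f price_prog s (M * (1 + 4) + 6) (\<lambda>s'. real_of s' PRICE = (\<Sum>r<M. C a r * w r))"
    unfolding price_prog_def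
  proof (rule runs_to_sum_loop)
    fix s' assume frame: "same_except {ROW} {PRICE} s s'"
    have rep': "rep R c w s'" by (rule rep_frame[OF rep frame]) auto
    show "nval row_count s' = M" using repD[OF rep'] by simp
    fix r assume "r < M" "nat_of s' ROW = r"
    then show "runs_to n f price_step_prog s' 1
        (\<lambda>s''. real_of s'' PRICE = real_of s' PRICE + C a r * w r)"
      using same_exceptD(1)[OF frame] item repD[OF rep']
      by (intro runs_to_straight_line) (simp_all add: price_step_prog_def)
  qed (auto simp: price_step_prog_def)
  then show ?thesis by (simp add: price_def)
qed

lemma query_prog_spec:
  assumes rep: "rep R c w s" and item: "nat_of s ITEM = a" "a < n" "a \<notin> R"
  shows "runs_to n f query_prog s 7
    (\<lambda>s'. rep R c w s' \<and> real_of s' VALUE = f R \<and> real_of s' NEW_VALUE = f (insert a R))"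
proof -
  have value_query: "row_set n SAMPLED 0 (fst s, y) = R" for y
    using row_set_rep[OF rep] by (simp add: row_set_def)
  then have new_value_query:
    "row_set n SAMPLED 0 ((fst s)((SAMPLED, 0, a) := Suc 0), y) = insert a R" for y
    using item(2) by (auto simp: row_set_def)
  have "fst s (SAMPLED, 0, a) = 0" using repD(8)[OF rep item(2)] item(3) by simp
  then have restore: "(fst s)((SAMPLED, 0, a) := 0) = fst s" by (simp add: fun_upd_idem)
  have "final_state n f query_prog s
      = (fst s, (snd s)((VALUE, 0, 0) := f R, (NEW_VALUE, 0, 0) := f (insert a R)))"
    using value_query new_value_query restore row_set_rep[OF rep] item(1)
    by (simp add: query_prog_def)
  moreover have "rep R c w (fst s, (snd s)((VALUE, 0, 0) := x, (NEW_VALUE, 0, 0) := y))" for x y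
    using rep by (simp add: rep_def)
  ultimately show ?thesis by (intro runs_to_straight_line) (simp_all add: query_prog_def)
qed

definition keeps_better :: "real \<Rightarrow> nat \<Rightarrow> state \<Rightarrow> state \<Rightarrow> bool" where
  "keeps_better \<rho> a s s' \<longleftrightarrow> (if real_of s BEST < \<rho> then real_of s' BEST = \<rho> \<and> nat_of s' CHOICE = a
     else real_of s' BEST = real_of s BEST \<and> nat_of s' CHOICE = nat_of s CHOICE)"

lemma evaluate_prog_spec:
  assumes rep: "rep R c w s" and item: "nat_of s ITEM = a" "a < n" "a \<notin> R"
    and risk: "real_of s RISK = risk R c a"
  shows "runs_to n f evaluate_prog s (M * 5 + 21)
    (\<lambda>s'. rep R c w s' \<and> keeps_better (ratio R c w a) a s s')"
proof -
  have "runs_to n f evaluate_prog s (Suc (7 + Suc (M * 5 + 6 + 6)))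
      (\<lambda>s'. rep R c w s' \<and> keeps_better (ratio R c w a) a s s')"
    unfolding evaluate_prog_def
  proof (rule guarantees_Seq_runs_to[OF guarantees_frame[OF query_prog_spec[OF rep item]]])
    fix s\<^sub>1 assume "preserves query_prog s s\<^sub>1 \<and> rep R c w s\<^sub>1
      \<and> real_of s\<^sub>1 VALUE = f R \<and> real_of s\<^sub>1 NEW_VALUE = f (insert a R)"
    then have after_query: "preserves query_prog s s\<^sub>1" "rep R c w s\<^sub>1"
      "real_of s\<^sub>1 VALUE = f R" "real_of s\<^sub>1 NEW_VALUE = f (insert a R)" by simp_all
    have unchanged: "nat_of s\<^sub>1 ITEM = a" "real_of s\<^sub>1 RISK = risk R c a"
      "real_of s\<^sub>1 BEST = real_of s BEST" "nat_of s\<^sub>1 CHOICE = nat_of s CHOICE"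
      using same_exceptD[OF after_query(1)] item(1) risk by (simp_all add: query_prog_def)
    show "runs_to n f (price_prog ;; compare_prog) s\<^sub>1 (Suc (M * 5 + 6 + 6))
        (\<lambda>s'. rep R c w s' \<and> keeps_better (ratio R c w a) a s s')"
    proof (rule guarantees_Seq_runs_to[OF guarantees_frame[OF
            price_prog_spec[OF after_query(2) unchanged(1) item(2)]]])
      fix s\<^sub>2 assume "preserves price_prog s\<^sub>1 s\<^sub>2 \<and> real_of s\<^sub>2 PRICE = price w a"
      then have frame: "same_except {ROW} {PRICE} s\<^sub>1 s\<^sub>2"
        and price: "real_of s\<^sub>2 PRICE = price w a"
        by simp_all
      have "rep R c w s\<^sub>2" by (rule rep_frame[OF after_query(2) frame]) auto
      then show "runs_to n f compare_prog s\<^sub>2 6 (\<lambda>s'. rep R c w s' \<and> keeps_better (ratio R c w a) a s s')"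
        using same_exceptD[OF frame] unchanged after_query(3,4) price
        by (intro runs_to_straight_line)
          (simp_all add: compare_prog_def keeps_better_def ratio_def gain_def rep_def)
    qed
  qed
  then show ?thesis by (rule guarantees_time_mono) simp
qed

definition holds_best :: "nat set \<Rightarrow> nat set \<Rightarrow> (nat \<Rightarrow> real) \<Rightarrow> (nat \<Rightarrow> real) \<Rightarrow> state \<Rightarrow> bool" where
  "holds_best B R c w s \<longleftrightarrow> 0 \<le> real_of s BEST \<and> (\<forall>b\<in>B. ratio R c w b \<le> real_of s BEST)
     \<and> (0 < real_of s BEST \<longrightarrow> nat_of s CHOICE \<in> B \<and> ratio R c w (nat_of s CHOICE) = real_of s BEST)"

lemma holds_best_insert:
  "holds_best B R c w s \<Longrightarrow> keeps_better (ratio R c w a) a s s' \<Longrightarrow> holds_best (insert a B) R c w s'"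
  by (auto simp: holds_best_def keeps_better_def split: if_splits)

lemma bval_candidate_test:
  assumes "rep R c w s" "nat_of s ITEM = a" "a < n" "real_of s RISK = risk (R - {a}) c a"
  shows "bval candidate_test s \<longleftrightarrow> a \<in> candidates R c"
  using assms repD(8,9)[OF assms(1)] by (auto simp: candidate_test_def candidates_def not_less)

lemma select_step_prog_spec:
  assumes rep: "rep R c w s" and item: "nat_of s ITEM = a" "a < n"
    and best: "holds_best (candidates R c \<inter> {..<a}) R c w s"
  shows "runs_to n f select_step_prog s (m * 6 + M * 5 + 29)
    (\<lambda>s'. rep R c w s' \<and> holds_best (candidates R c \<inter> {..<Suc a}) R c w s')"
proof -
  let ?Q = "\<lambda>s'. rep R c w s' \<and> holds_best (candidates R c \<inter> {..<Suc a}) R c w s'"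
  have "runs_to n f select_step_prog s (Suc (m * 6 + 6 + Suc (M * 5 + 21))) ?Q"
    unfolding select_step_prog_def
  proof (rule guarantees_Seq_runs_to[OF guarantees_frame[OF risk_prog_spec[OF rep item]]])
    fix s' assume "preserves risk_prog s s' \<and> real_of s' RISK = risk (R - {a}) c a"
    then have frame: "same_except {ROW} {RISK} s s'"
      and risk: "real_of s' RISK = risk (R - {a}) c a"
      by simp_all
    have rep': "rep R c w s'" by (rule rep_frame[OF rep frame]) auto
    have item': "nat_of s' ITEM = a" using same_exceptD[OF frame] item by simp
    have best': "holds_best (candidates R c \<inter> {..<a}) R c w s'"
      using same_exceptD[OF frame] best by (simp add: holds_best_def)
    show "runs_to n f (Cond candidate_test evaluate_prog Skip) s' (Suc (M * 5 + 21)) ?Q"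
    proof (rule guarantees_Cond)
      assume "bval candidate_test s'"
      then have candidate: "a \<in> candidates R c"
        using bval_candidate_test[OF rep' item' item(2) risk] by simp
      then have unsampled: "a \<notin> R" by (simp add: candidates_def)
      have "candidates R c \<inter> {..<Suc a} = insert a (candidates R c \<inter> {..<a})"
        using candidate by (auto simp: less_Suc_eq)
      with best' have "holds_best (candidates R c \<inter> {..<Suc a}) R c w s''"
        if "keeps_better (ratio R c w a) a s' s''" for s''
        using holds_best_insert that by simp
      then show "runs_to n f evaluate_prog s' (M * 5 + 21) ?Q"
        using risk unsampled
        by (intro guarantees_conseq[OF evaluate_prog_spec[OF rep' item' item(2) unsampled]]) auto
    next
      assume "\<not> bval candidate_test s'"
      then have "a \<notin> candidates R c" using bval_candidate_test[OF rep' item' item(2) risk] by simp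
      then have "candidates R c \<inter> {..<Suc a} = candidates R c \<inter> {..<a}" by (auto simp: less_Suc_eq)
      then show "runs_to n f Skip s' (M * 5 + 21) ?Q"
        using rep' best' by (intro guarantees_Skip) auto
    qed
  qed
  then show ?thesis by (rule guarantees_time_mono) simp
qed

lemma select_prog_spec:
  assumes rep: "rep R c w s"
  shows "runs_to n f select_prog s (n * (m * 6 + M * 5 + 33) + 6)
    (\<lambda>s'. rep R c w s' \<and> holds_best (candidates R c) R c w s')"
proof -
  let ?I = "\<lambda>a s'. rep R c w s' \<and> holds_best (candidates R c \<inter> {..<a}) R c w s'"
  define s\<^sub>0 where "s\<^sub>0 = (fst s, (snd s)((BEST, 0, 0) := 0))"
  have "runs_to n f (for_loop ITEM item_count select_step_prog) s\<^sub>0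
      (n * (m * 6 + M * 5 + 29 + 4) + 4)
      (\<lambda>s'. preserves (for_loop ITEM item_count select_step_prog) s\<^sub>0 s' \<and> ?I n s')"
  proof (rule runs_to_for_loop[where I = ?I])
    show "?I 0 (set_nat ITEM 0 s\<^sub>0)"
      using rep by (simp add: s\<^sub>0_def rep_def holds_best_def)
    show "nval item_count s' = n" if "preserves (for_loop ITEM item_count select_step_prog) s\<^sub>0 s'" for s'
      using same_exceptD(1)[OF that] repD[OF rep] by (simp add: s\<^sub>0_def)
    fix a s' assume "a < n" "nat_of s' ITEM = a" "?I a s'"
    then have "runs_to n f select_step_prog s' (m * 6 + M * 5 + 29) (?I (Suc a))"
      by (intro select_step_prog_spec) simp_all
    then show "runs_to n f select_step_prog s' (m * 6 + M * 5 + 29)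
        (\<lambda>s''. ?I (Suc a) (set_nat ITEM (Suc a) s''))"
      by (rule guarantees_conseq) (simp add: holds_best_def rep_set_nat)
  qed simp
  from guarantees_Seq_straight_line[OF _ _ this, of "rassign BEST (rnum 0)"]
  have "runs_to n f select_prog s (n * (m * 6 + M * 5 + 33) + 6) (?I n)"
    unfolding select_prog_def by (rule guarantees_mono) (simp_all add: s\<^sub>0_def)
  moreover have "candidates R c \<inter> {..<n} = candidates R c"
    using G_items by (auto simp: candidates_def)
  ultimately show ?thesis by simp
qed

definition rows_updated :: "nat \<Rightarrow> nat \<Rightarrow> nat \<Rightarrow> nat set \<Rightarrow> (nat \<Rightarrow> real) \<Rightarrow> (nat \<Rightarrow> real) \<Rightarrow> state \<Rightarrow> bool" where
  "rows_updated k b h R c w s \<longleftrightarrow> nat_of s HALT = of_bool (\<exists>r<k. D - 1 < advance C b c r) \<and>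
     (\<forall>r<M. snd s (LOAD, 0, r) = (if r < k then advance C b c r else c r)
       \<and> snd s (WEIGHT, 0, r) = (if r < k then reweight b w r else w r)
       \<and> snd s (TOTAL, 0, r) = (\<Sum>i\<in>R. C i r) + (if r < k then real h * C b r else 0)
       \<and> snd s (SQUARES, 0, r) = (\<Sum>i\<in>R. (C i r)\<^sup>2) + (if r < k then real h * (C b r)\<^sup>2 else 0))"

lemma update_row_prog_spec:
  assumes "rows_updated k b h R c w s" "k < M" "nat_of s ROW = k" "nat_of s CHOICE = b"
    "nat_of s HEADS = h" "snd s (COEF, b, k) = C b k" "real_of s BUDGET = D"
  shows "runs_to n f update_row_prog s 10 (\<lambda>s'. rows_updated (Suc k) b h R c w (set_nat ROW (Suc k) s'))"
proof (rule runs_to_straight_line)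
  show "rows_updated (Suc k) b h R c w (set_nat ROW (Suc k) (final_state n f update_row_prog s))"
    using assms unfolding rows_updated_def update_row_prog_def
    by (auto simp: less_Suc_eq advance_def reweight_def power2_eq_square)
qed (simp_all add: update_row_prog_def)

lemma update_prog_spec:
  assumes rep: "rep R c w s" and chosen: "nat_of s CHOICE = b" "b \<in> G" "b \<notin> R"
    and coin: "nat_of s HEADS = h" "h \<in> {0, 1}" and halt: "nat_of s HALT = 0"
  shows "runs_to n f update_prog s (M * 14 + 6) (\<lambda>s'. nat_of s' HEADS = h
    \<and> nat_of s' HALT = of_bool (\<exists>r<M. D - 1 < advance C b c r)
    \<and> rep (if h = 1 then insert b R else R) (advance C b c) (reweight b w) s')"
proof -
  let ?L = "for_loop ROW row_count update_row_prog"
  have b_lt: "b < n" using chosen G_items by auto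
  have loop: "runs_to n f ?L s (M * (10 + 4) + 4) (\<lambda>s'. preserves ?L s s' \<and> rows_updated M b h R c w s')"
  proof (rule runs_to_for_loop)
    show "rows_updated 0 b h R c w (set_nat ROW 0 s)"
      using repD[OF rep] halt by (simp add: rows_updated_def)
    fix s' assume frame: "preserves ?L s s'"
    show "nval row_count s' = M" using same_exceptD(1)[OF frame] repD[OF rep] by simp
    fix k assume "k < M" "nat_of s' ROW = k" "rows_updated k b h R c w s'"
    then show "runs_to n f update_row_prog s' 10
        (\<lambda>s''. rows_updated (Suc k) b h R c w (set_nat ROW (Suc k) s''))"
      using same_exceptD[OF frame] repD[OF rep] chosen coin b_lt
      by (intro update_row_prog_spec) auto
  qed simp
  have "runs_to n f update_prog s (Suc (M * (10 + 4) + 4 + 1)) (\<lambda>s'. nat_of s' HEADS = h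
    \<and> nat_of s' HALT = of_bool (\<exists>r<M. D - 1 < advance C b c r)
    \<and> rep (if h = 1 then insert b R else R) (advance C b c) (reweight b w) s')"
    unfolding update_prog_def
  proof (rule guarantees_Seq_runs_to[OF loop], rule runs_to_straight_line)
    fix s' assume after_loop: "preserves ?L s s' \<and> rows_updated M b h R c w s'"
    then have "same_except {ROW, HALT} {WEIGHT, LOAD, TOTAL, SQUARES} s s'" by simp
    note unchanged = same_exceptD[OF this]
    have "rep (if h = 1 then insert b R else R) (advance C b c) (reweight b w)
        ((fst s')((SAMPLED, 0, b) := h), snd s')"
      using after_loop coin(2) chosen(2,3) repD[OF rep]
      unfolding rep_def rows_updated_def by (auto simp: unchanged)
    then show "nat_of (final_state n f (NSet SAMPLED zero (nvar CHOICE) (nvar HEADS)) s') HEADS = h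
      \<and> nat_of (final_state n f (NSet SAMPLED zero (nvar CHOICE) (nvar HEADS)) s') HALT
        = of_bool (\<exists>r<M. D - 1 < advance C b c r)
      \<and> rep (if h = 1 then insert b R else R) (advance C b c) (reweight b w)
        (final_state n f (NSet SAMPLED zero (nvar CHOICE) (nvar HEADS)) s')"
      using after_loop chosen(1) coin(1) by (simp add: unchanged rows_updated_def)
  qed simp_all
  then show ?thesis by (rule guarantees_time_mono) simp
qed

definition remaining :: "(nat \<Rightarrow> real) \<Rightarrow> real" where
  "remaining c = real n * D - (\<Sum>a<n. c (2 * m + a))"

definition loop_inv :: "nat set \<Rightarrow> (nat \<Rightarrow> real) \<Rightarrow> (nat \<Rightarrow> real) \<Rightarrow> (nat \<Rightarrow> real) \<Rightarrow> state \<Rightarrow> bool" where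
  "loop_inv R c w g s \<longleftrightarrow> rep R c w s \<and> consistent R c w g
     \<and> (nat_of s HALT = 0 \<and> (\<forall>r<M. c r \<le> D - 1) \<or> nat_of s HALT = 1 \<and> stopped R c)"

definition promises :: "real \<Rightarrow> real \<Rightarrow> state \<Rightarrow> bool" where
  "promises \<rho> v s \<longleftrightarrow> (\<exists>R c w g. loop_inv R c w g s \<and> (nat_of s HALT = 1 \<or> remaining c \<le> \<rho>)
     \<and> v \<le> potential R c w g)"

text \<open>The potential after a round depends on the memory only through the chosen item, if there is
  one, and the outcome of the coin.\<close>

definition round_value ::
  "nat set \<Rightarrow> (nat \<Rightarrow> real) \<Rightarrow> (nat \<Rightarrow> real) \<Rightarrow> (nat \<Rightarrow> real) \<Rightarrow> state \<Rightarrow> real" where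
  "round_value R c w g s =
     (let b = nat_of s CHOICE; c' = advance C b c; w' = reweight b w in
      if real_of s BEST \<le> 0 then potential R c w g
      else if nat_of s HEADS = 1 then potential (insert b R) c' w' (g(b := f (insert b R) - f R))
      else potential R c' w' g)"

lemma remaining_nonneg:
  assumes "tracks c w"
  shows "0 \<le> remaining c"
proof -
  have "(\<Sum>a<n. c (2 * m + a)) \<le> (\<Sum>a<n. D)"
    using assms by (intro sum_mono tracks_load_le) auto
  then show ?thesis by (simp add: remaining_def)
qed

lemma remaining_advance_le:
  assumes "a \<in> G"
  shows "remaining (advance C a c) \<le> remaining c - 1"
proof -
  have "C a (2 * m + a) \<le> (\<Sum>b<n. C a (2 * m + b))"
    using assms G_items C_nonneg by (intro member_le_sum) auto
  then show ?thesis using C_own[OF assms] by (simp add: remaining_def advance_def sum.distrib)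
qed

lemma loop_inv_if_flag:
  assumes "rep R c w s" "consistent R c w g" "nat_of s HALT = of_bool (\<exists>r<M. D - 1 < c r)"
  shows "loop_inv R c w g s"
proof (cases "\<exists>r<M. D - 1 < c r")
  case True
  then show ?thesis using assms by (simp add: loop_inv_def stopped_def)
next
  case False
  then have "\<forall>r<M. c r \<le> D - 1" by (meson not_less)
  then show ?thesis using assms False by (simp add: loop_inv_def)
qed

lemma update_prog_promises:
  assumes rep: "rep R c w s" and consistent: "consistent R c w g" and room: "\<forall>r<M. c r \<le> D - 1"
    and chosen: "nat_of s CHOICE = b" "b \<in> candidates R c" and best: "0 < real_of s BEST"
    and coin: "nat_of s HEADS \<in> {0, 1}" and halt: "nat_of s HALT = 0"
  shows "guarantees n f update_prog s (M * 14 + 6)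
    (\<lambda>s'. promises (remaining c - 1) (round_value R c w g s') s') (round_value R c w g)
      (round_value R c w g s)"
proof -
  let ?c = "advance C b c" and ?w = "reweight b w" and ?h = "nat_of s HEADS"
  let ?R = "if ?h = 1 then insert b R else R"
  let ?g = "if ?h = 1 then g(b := f (insert b R) - f R) else g"
  have b_new: "b \<in> G" "b \<notin> R" using chosen(2) by (auto simp: candidates_def)
  have "consistent R ?c ?w g" using room by (intro consistent_advance consistent b_new) simp
  then have consistent': "consistent ?R ?c ?w ?g" using consistent_insert b_new by simp
  let ?Q = "\<lambda>s'. nat_of s' HEADS = ?h \<and> nat_of s' HALT = of_bool (\<exists>r<M. D - 1 < ?c r) \<and> rep ?R ?c ?w s'"
  have update: "runs_to n f update_prog s (M * 14 + 6) (\<lambda>s'. preserves update_prog s s' \<and> ?Q s')"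
    by (rule guarantees_frame[OF update_prog_spec[OF rep chosen(1) b_new refl coin halt]])
  have result: "round_value R c w g s' = potential ?R ?c ?w ?g"
    if "preserves update_prog s s' \<and> ?Q s'" for s'
  proof -
    have "nat_of s' CHOICE = b" "real_of s' BEST = real_of s BEST" "nat_of s' HEADS = ?h"
      using that chosen(1) by (auto simp: same_except_def update_prog_def)
    then show ?thesis using best by (simp add: round_value_def)
  qed
  have "round_value R c w g s = potential ?R ?c ?w ?g"
    using chosen(1) best by (simp add: round_value_def)
  then have "guarantees n f update_prog s (M * 14 + 6) (\<lambda>s'. preserves update_prog s s' \<and> ?Q s')
      (round_value R c w g) (round_value R c w g s)"
    using result by (intro guarantees_runs_to[OF update]) simp
  then show ?thesis
  proof (rule guarantees_conseq)
    fix s' assume after_update: "preserves update_prog s s' \<and> ?Q s'"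
    then have "loop_inv ?R ?c ?w ?g s'" by (intro loop_inv_if_flag consistent') auto
    then show "promises (remaining c - 1) (round_value R c w g s') s'"
      unfolding promises_def result[OF after_update]
      using remaining_advance_le[OF b_new(1)] by blast
  qed
qed

lemma sample_prog_promises:
  assumes rep: "rep R c w s" and consistent: "consistent R c w g" and room: "\<forall>r<M. c r \<le> D - 1"
    and best: "holds_best (candidates R c) R c w s" "0 < real_of s BEST"
    and halt: "nat_of s HALT = 0"
  shows "guarantees n f (flip_prog ;; update_prog) s (L * 8 + M * 14 + 12)
    (\<lambda>s'. promises (remaining c - 1) (round_value R c w g s') s') (round_value R c w g)
      (potential R c w g)"
proof -
  define b where "b = nat_of s CHOICE"
  let ?c = "advance C b c" and ?w = "reweight b w"
  let ?Y = "potential (insert b R) ?c ?w (g(b := f (insert b R) - f R))" and ?Z = "potential R ?c ?w g"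
  have b_best: "b \<in> candidates R c" "\<And>a. a \<in> candidates R c \<Longrightarrow> ratio R c w a \<le> ratio R c w b"
    using best by (auto simp: holds_best_def b_def)
  have "guarantees n f flip_prog s (L * 8 + 5) (\<lambda>s'. nat_of s' HEADS \<in> {0, 1})
      (\<lambda>s'. if nat_of s' HEADS = 1 then ?Y else ?Z) (p * ?Y + (1 - p) * ?Z)"
    unfolding p_eq by (rule flip_prog_spec[OF repD(5)[OF rep]])
  then have "guarantees n f (flip_prog ;; update_prog) s (Suc (L * 8 + 5 + (M * 14 + 6)))
      (\<lambda>s'. promises (remaining c - 1) (round_value R c w g s') s') (round_value R c w g)
      (p * ?Y + (1 - p) * ?Z)"
  proof (rule guarantees_Seq[OF guarantees_frame])
    fix s' assume after_flip: "preserves flip_prog s s' \<and> nat_of s' HEADS \<in> {0, 1}"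
    then have frame: "same_except {FLIPPED, HEADS, COIN} {} s s'" by simp
    have rep': "rep R c w s'" by (rule rep_frame[OF rep frame]) auto
    have unchanged: "nat_of s' CHOICE = b" "real_of s' BEST = real_of s BEST" "nat_of s' HALT = 0"
      using same_exceptD[OF frame] halt by (simp_all add: b_def)
    have "round_value R c w g s' = (if nat_of s' HEADS = 1 then ?Y else ?Z)"
      using unchanged best(2) by (simp add: round_value_def)
    then show "guarantees n f update_prog s' (M * 14 + 6)
        (\<lambda>s'. promises (remaining c - 1) (round_value R c w g s') s') (round_value R c w g)
        (if nat_of s' HEADS = 1 then ?Y else ?Z)"
      using update_prog_promises[OF rep' consistent room unchanged(1) b_best(1) _ _ unchanged(3)]
        unchanged(2) best(2) after_flip by simp
  qed
  then show ?thesis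
    by (rule guarantees_mono) (use potential_step[OF consistent _ b_best] room in auto)
qed

lemma halt_prog_promises:
  assumes rep: "rep R c w s" and consistent: "consistent R c w g"
    and best: "holds_best (candidates R c) R c w s" "real_of s BEST \<le> 0"
  shows "guarantees n f (nassign HALT one) s 1
    (\<lambda>s'. promises (remaining c - 1) (round_value R c w g s') s') (round_value R c w g)
      (potential R c w g)"
proof -
  have "gain R c a \<le> 0" if a_cand: "a \<in> candidates R c" for a
  proof -
    have "0 < price w a"
      using consistent a_cand by (intro price_pos) (auto simp: consistent_def candidates_def)
    moreover have "ratio R c w a \<le> 0" using a_cand best by (auto simp: holds_best_def)
    ultimately show ?thesis by (simp add: ratio_def divide_le_0_iff)
  qed
  then have "loop_inv R c w g (set_nat HALT 1 s)"
    using rep consistent by (simp add: loop_inv_def stopped_def rep_set_nat)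
  then have "promises (remaining c - 1) (potential R c w g) (set_nat HALT 1 s)"
    by (auto simp: promises_def)
  moreover have "round_value R c w g (set_nat HALT 1 s) = potential R c w g"
    using best(2) by (simp add: round_value_def)
  ultimately show ?thesis
    by (intro guarantees_return[where s' = "set_nat HALT 1 s"])
      (simp_all add: set_nat_def bind_return_pmf)
qed

lemma round_prog_spec:
  assumes inv: "loop_inv R c w g s" and halt: "nat_of s HALT = 0"
  shows "guarantees n f round_prog s (round_time n m L)
    (\<lambda>s'. promises (remaining c - 1) (round_value R c w g s') s') (round_value R c w g)
      (potential R c w g)"
proof -
  let ?Q = "\<lambda>s'. promises (remaining c - 1) (round_value R c w g s') s'"
  have rep: "rep R c w s" and consistent: "consistent R c w g" and room: "\<forall>r<M. c r \<le> D - 1"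
    using inv halt by (auto simp: loop_inv_def)
  have "guarantees n f round_prog s
      (Suc (n * (m * 6 + M * 5 + 33) + 6 + Suc (L * 8 + M * 14 + 12))) ?Q (round_value R c w g)
        (potential R c w g)"
    unfolding round_prog_def
  proof (rule guarantees_Seq_runs_to[OF guarantees_frame[OF select_prog_spec[OF rep]]],
      rule guarantees_Cond)
    fix s' assume after_select: "preserves select_prog s s' \<and> rep R c w s'
        \<and> holds_best (candidates R c) R c w s'"
    then have halt': "nat_of s' HALT = 0" using halt by (auto simp: same_except_def)
    show "guarantees n f (flip_prog ;; update_prog) s' (L * 8 + M * 14 + 12) ?Q
        (round_value R c w g) (potential R c w g)" if "bval (RLess (rnum 0) (rvar BEST)) s'"
      using after_select consistent room halt' that by (intro sample_prog_promises) auto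
    show "guarantees n f (nassign HALT one) s' (L * 8 + M * 14 + 12) ?Q
        (round_value R c w g) (potential R c w g)" if "\<not> bval (RLess (rnum 0) (rvar BEST)) s'"
      using after_select consistent that by (intro guarantees_time_mono[OF halt_prog_promises]) auto
  qed
  then show ?thesis by (rule guarantees_time_mono) (simp add: round_time_def)
qed

definition recorded_value :: "state \<Rightarrow> real" where
  "recorded_value s = inflation * (f (survivors (row_set n SAMPLED 0 s) (\<lambda>r. snd s (LOAD, 0, r))) - f {})"

definition reached :: "state \<Rightarrow> bool" where
  "reached s \<longleftrightarrow> (\<exists>R c w g. rep R c w s \<and> consistent R c w g)"

lemma recorded_value_rep:
  assumes "rep R c w s"
  shows "recorded_value s = inflation * (f (survivors R c) - f {})"
  using row_set_rep[OF assms] survivors_cong[of "\<lambda>r. snd s (LOAD, 0, r)" c R] repD(12)[OF assms]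
  by (simp add: recorded_value_def)

lemma main_loop_halted:
  assumes inv: "loop_inv R c w g s" and halt: "nat_of s HALT = 1"
  shows "guarantees n f main_loop s (Suc t) reached recorded_value (potential R c w g)"
proof -
  have rep: "rep R c w s" and consistent: "consistent R c w g" and stop: "stopped R c"
    using inv halt by (auto simp: loop_inv_def)
  have "potential R c w g \<le> recorded_value s"
    unfolding recorded_value_rep[OF rep] by (rule potential_stopped[OF consistent stop])
  moreover have "reached s" using rep consistent by (auto simp: reached_def)
  ultimately show ?thesis
    unfolding main_loop_def using halt by (intro guarantees_While) auto
qed

lemma main_loop_spec:
  assumes "loop_inv R c w g s" "nat_of s HALT = 1 \<or> remaining c < real N"
  shows "guarantees n f main_loop s (N * (round_time n m L + 2) + 1) reached recorded_value
      (potential R c w g)"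
  using assms
proof (induction N arbitrary: R c w g s)
  case 0
  have "tracks c w" using 0(1) by (simp add: loop_inv_def consistent_def)
  then have "nat_of s HALT = 1" using remaining_nonneg[of c w] 0(2) by auto
  then show ?case using main_loop_halted[OF 0(1)] by simp
next
  case (Suc N)
  show ?case
  proof (cases "nat_of s HALT = 1")
    case True
    then show ?thesis using main_loop_halted[OF Suc.prems(1)] by simp
  next
    case False
    then have halt: "nat_of s HALT = 0" using Suc.prems(1) by (auto simp: loop_inv_def)
    have "guarantees n f (round_prog ;; main_loop) s
        (Suc (round_time n m L + (N * (round_time n m L + 2) + 1))) reached recorded_value
          (potential R c w g)"
    proof (rule guarantees_Seq[OF round_prog_spec[OF Suc.prems(1) halt]])
      fix s' assume "promises (remaining c - 1) (round_value R c w g s') s'"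
      then obtain R' c' w' g' where inv: "loop_inv R' c' w' g' s'"
        and left: "nat_of s' HALT = 1 \<or> remaining c' \<le> remaining c - 1"
        and value_le: "round_value R c w g s' \<le> potential R' c' w' g'"
        by (auto simp: promises_def)
      have "nat_of s' HALT = 1 \<or> remaining c' < real N" using left Suc.prems(2) False by auto
      from Suc.IH[OF inv this]
      show "guarantees n f main_loop s' (N * (round_time n m L + 2) + 1) reached recorded_value
          (round_value R c w g s')"
        by (rule guarantees_mono) (use value_le in auto)
    qed
    then have "guarantees n f main_loop s
        (Suc (Suc (round_time n m L + (N * (round_time n m L + 2) + 1))))
        reached recorded_value (potential R c w g)"
      unfolding main_loop_def using halt by (intro guarantees_While) auto
    then show ?thesis by (rule guarantees_time_mono) simp
  qed
qed

lemma output_step_prog_spec: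
  assumes rep: "rep R c w s" and item: "nat_of s ITEM = a" "a < n"
  shows "runs_to n f output_step_prog s (m * 6 + 9)
    (\<lambda>s'. rep R c w s' \<and> (\<forall>b. fst s' (OUTPUT, 0, b) =
      (if b = a then of_bool (a \<in> survivors R c) else fst s (OUTPUT, 0, b))))"
proof -
  let ?test = "BAnd (NLess zero (NGet SAMPLED zero (nvar ITEM))) (RLess (rvar RISK) (rnum 1))"
  let ?write = "Cond ?test (NSet OUTPUT zero (nvar ITEM) one) (NSet OUTPUT zero (nvar ITEM) zero)"
  have "runs_to n f output_step_prog s (Suc (m * 6 + 6 + 2))
    (\<lambda>s'. rep R c w s' \<and> (\<forall>b. fst s' (OUTPUT, 0, b) =
      (if b = a then of_bool (a \<in> survivors R c) else fst s (OUTPUT, 0, b))))"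
    unfolding output_step_prog_def
  proof (rule guarantees_Seq_runs_to[OF guarantees_frame[OF risk_prog_spec[OF rep item]]],
      rule runs_to_straight_line)
    fix s' assume "preserves risk_prog s s' \<and> real_of s' RISK = risk (R - {a}) c a"
    then have frame: "same_except {ROW} {RISK} s s'"
      and risk: "real_of s' RISK = risk (R - {a}) c a"
      by simp_all
    have rep': "rep R c w s'" by (rule rep_frame[OF rep frame]) auto
    have item': "nat_of s' ITEM = a" using same_exceptD[OF frame] item by simp
    have "bval ?test s' \<longleftrightarrow> a \<in> survivors R c"
      using repD(8)[OF rep' item(2)] risk item' by (auto simp: survivors_def)
    then have "final_state n f ?write s'
        = ((fst s')((OUTPUT, 0, a) := of_bool (a \<in> survivors R c)), snd s')"
      using item' by simp
    moreover have "rep R c w ((fst s')((OUTPUT, 0, a) := x), snd s')" for x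
      using rep' by (simp add: rep_def)
    ultimately show "(\<lambda>s'. rep R c w s' \<and> (\<forall>b. fst s' (OUTPUT, 0, b) =
        (if b = a then of_bool (a \<in> survivors R c) else fst s (OUTPUT, 0, b))))
      (final_state n f ?write s')"
      using same_exceptD[OF frame] by simp
  qed simp_all
  then show ?thesis by (rule guarantees_time_mono) simp
qed

lemma output_prog_spec:
  assumes rep: "rep R c w s"
  shows "runs_to n f output_prog s (n * (m * 6 + 13) + 4) (\<lambda>s'. row_set n OUTPUT 0 s' = survivors R c)"
proof -
  let ?I = "\<lambda>a s'. rep R c w s' \<and> (\<forall>b<a. fst s' (OUTPUT, 0, b) = of_bool (b \<in> survivors R c))"
  have "runs_to n f output_prog s (n * (m * 6 + 9 + 4) + 4) (\<lambda>s'. preserves output_prog s s' \<and> ?I n s')"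
    unfolding output_prog_def
  proof (rule runs_to_for_loop[where I = ?I])
    show "?I 0 (set_nat ITEM 0 s)" using rep by (simp add: rep_set_nat)
    show "nval item_count s' = n" if "preserves (for_loop ITEM item_count output_step_prog) s s'" for s'
      using same_exceptD(1)[OF that] repD[OF rep] by simp
    fix a s' assume iteration: "a < n" "nat_of s' ITEM = a" "?I a s'"
    then have "rep R c w s'" by simp
    from output_step_prog_spec[OF this iteration(2,1)]
    show "runs_to n f output_step_prog s' (m * 6 + 9) (\<lambda>s''. ?I (Suc a) (set_nat ITEM (Suc a) s''))"
      by (rule guarantees_conseq) (use iteration in \<open>auto simp: less_Suc_eq intro: rep_set_nat\<close>)
  qed simp
  then show ?thesis
  proof (rule guarantees_mono)
    have "survivors R c \<subseteq> {..<n}" using survivors_subset repD(1)[OF rep] G_items by blast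
    then show "row_set n OUTPUT 0 s' = survivors R c" if "preserves output_prog s s' \<and> ?I n s'" for s'
      using that by (auto simp: row_set_def split: if_splits)
  qed simp_all
qed

theorem main_loop_output_spec:
  assumes rep: "rep {} (\<lambda>_. 0) (\<lambda>_. 1) s" and halt: "nat_of s HALT = 0" and D_le: "D \<le> 2 ^ L"
  shows "guarantees n f (main_loop ;; output_prog) s (loop_time n m L)
    (\<lambda>s'. \<exists>R c. R \<subseteq> G \<and> loads_bounded c \<and> row_set n OUTPUT 0 s' = survivors R c)
    (\<lambda>s'. inflation * (f (row_set n OUTPUT 0 s') - f {})) (potential {} (\<lambda>_. 0) (\<lambda>_. 1) g)"
proof -
  have "loop_inv {} (\<lambda>_. 0) (\<lambda>_. 1) g s"
    using rep halt D_ge_1 consistent_init by (simp add: loop_inv_def)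
  moreover have "remaining (\<lambda>_. 0) < real (n * 2 ^ L + 1)"
    using mult_left_mono[OF D_le, of "real n"] by (simp add: remaining_def)
  ultimately have "guarantees n f main_loop s ((n * 2 ^ L + 1) * (round_time n m L + 2) + 1) reached
      recorded_value (potential {} (\<lambda>_. 0) (\<lambda>_. 1) g)"
    by (intro main_loop_spec) simp_all
  then have "guarantees n f (main_loop ;; output_prog) s
    (Suc ((n * 2 ^ L + 1) * (round_time n m L + 2) + 1 + (n * (m * 6 + 13) + 4)))
    (\<lambda>s'. \<exists>R c. R \<subseteq> G \<and> loads_bounded c \<and> row_set n OUTPUT 0 s' = survivors R c)
    (\<lambda>s'. inflation * (f (row_set n OUTPUT 0 s') - f {})) (potential {} (\<lambda>_. 0) (\<lambda>_. 1) g)"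
  proof (rule guarantees_Seq)
    fix s' assume "reached s'"
    then obtain R c w g where rep': "rep R c w s'" and consistent: "consistent R c w g"
      by (auto simp: reached_def)
    have "R \<subseteq> G" "loads_bounded c"
      using consistent tracks_loads_bounded by (auto simp: consistent_def)
    moreover have "guarantees n f output_prog s' (n * (m * 6 + 13) + 4)
        (\<lambda>s''. row_set n OUTPUT 0 s'' = survivors R c)
        (\<lambda>s''. inflation * (f (row_set n OUTPUT 0 s'') - f {})) (recorded_value s')"
      by (rule guarantees_runs_to[OF output_prog_spec[OF rep']]) (simp add: recorded_value_rep[OF rep'])
    ultimately show "guarantees n f output_prog s' (n * (m * 6 + 13) + 4)
        (\<lambda>s'. \<exists>R c. R \<subseteq> G \<and> loads_bounded c \<and> row_set n OUTPUT 0 s' = survivors R c)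
        (\<lambda>s'. inflation * (f (row_set n OUTPUT 0 s') - f {})) (recorded_value s')"
      by (blast intro: guarantees_conseq)
  qed
  then show ?thesis by (rule guarantees_time_mono) (simp add: loop_time_def)
qed

end

section \<open>Numerical estimates\<close>

lemma initial_potential_bound:
  fixes K D p F :: real and M :: nat
  assumes K_ge: "10000 \<le> K" and D_ge: "100000 * (real M + 1) \<le> D" and pD_eq: "p * D = 1 / (2 * K)"
    and F_nonneg: "0 \<le> F" and p_pos: "0 < p"
  shows "F * (239 / 1000) / K
    \<le> p * F * ((1 - 1 / 100) * ((D - 1) * (1 - 1 / 100) - ln (real M) / (1 / 100))
      - D * (K * (p * D + 9 * (p * D)\<^sup>2)))"
proof -
  have D_large: "100000 \<le> D" using D_ge by (rule order_trans[rotated]) simp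
  have "ln (real M) \<le> real M" by (cases "M = 0") (auto intro: less_imp_le ln_less_self)
  then have "ln (real M) \<le> D / 100000" using D_ge by simp
  then have "D * (979 / 1000) \<le> (1 - 1 / 100) * ((D - 1) * (1 - 1 / 100) - ln (real M) / (1 / 100))"
    using D_large by (simp add: field_simps)
  moreover have "K * (p * D + 9 * (p * D)\<^sup>2) \<le> 501 / 1000"
  proof -
    have "K * (p * D + 9 * (p * D)\<^sup>2) = 1 / 2 + 9 / (4 * K)"
      unfolding pD_eq using K_ge by (simp add: field_simps power2_eq_square)
    also have "\<dots> \<le> 501 / 1000" using K_ge by (simp add: field_simps)
    finally show ?thesis .
  qed
  then have "D * (K * (p * D + 9 * (p * D)\<^sup>2)) \<le> D * (501 / 1000)"
    using D_large by (intro mult_left_mono) auto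
  ultimately have "D * (478 / 1000)
      \<le> (1 - 1 / 100) * ((D - 1) * (1 - 1 / 100) - ln (real M) / (1 / 100))
        - D * (K * (p * D + 9 * (p * D)\<^sup>2))" by linarith
  then have "p * F * (D * (478 / 1000))
      \<le> p * F * ((1 - 1 / 100) * ((D - 1) * (1 - 1 / 100) - ln (real M) / (1 / 100))
        - D * (K * (p * D + 9 * (p * D)\<^sup>2)))"
    using p_pos F_nonneg by (intro mult_left_mono mult_nonneg_nonneg) simp_all
  moreover have "p * F * (D * (478 / 1000)) = F * (478 / 1000) * (p * D)" by simp
  ultimately show ?thesis unfolding pD_eq by simp
qed

lemma discounted_value_ge:
  fixes K F b \<Phi> :: real
  assumes K_ge: "10000 \<le> K" and F_nonneg: "0 \<le> F"
    and b_nonneg: "0 \<le> b" and \<Phi>_ge: "F * (239 / 1000) / K \<le> \<Phi>"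
  shows "(F + b) / (17 / 4 * K) \<le> \<Phi> / (1 + 1 / (2 * K) / (1 / 100)) + b"
proof -
  define a where "a = 1 + 1 / (2 * K) / (1 / 100)"
  have a_bounds: "1 \<le> a" "a \<le> 201 / 200" using K_ge by (auto simp: a_def field_simps)
  have "F / (17 / 4 * K) * a \<le> F / (17 / 4 * K) * (201 / 200)"
    using a_bounds F_nonneg K_ge by (intro mult_left_mono) auto
  also have "\<dots> \<le> F * (239 / 1000) / K" using F_nonneg K_ge by (simp add: field_simps)
  also note \<Phi>_ge
  finally have "F / (17 / 4 * K) \<le> \<Phi> / a" using a_bounds by (simp add: pos_le_divide_eq)
  moreover have "b / (17 / 4 * K) \<le> b / 1" using K_ge b_nonneg by (intro divide_left_mono) auto
  ultimately show ?thesis by (simp add: add_divide_distrib a_def)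
qed

definition time_poly :: "nat poly" where
  "time_poly = smult (10 ^ 21) ([:1, 1:] ^ 5)"

lemma loop_time_le:
  assumes size: "1 \<le> y" "n \<le> y" "m \<le> y" "2 * m + n + 1 \<le> 2 * y"
    and scale: "2 ^ L \<le> 8 * 10 ^ 9 * y\<^sup>2"
  shows "loop_time n m L \<le> 6 * 10 ^ 20 * y ^ 5"
proof -
  have squares: "y \<le> y\<^sup>2" "1 \<le> y\<^sup>2" and "1 \<le> y ^ 3" using size(1) by (auto simp: power2_eq_square)
  have "y\<^sup>2 \<le> y ^ 5" using size(1) by (intro power_increasing) auto
  have L_le: "L \<le> 8 * 10 ^ 9 * y\<^sup>2" using less_imp_le[OF less_exp] scale by (rule order_trans)
  have rows: "2 * m + n \<le> 2 * y\<^sup>2" using size(4) squares by linarith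
  have "n * (m * 6 + (2 * m + n) * 5 + 33) \<le> y * (y * 6 + 2 * y * 5 + y * 33)"
    using size by (intro mult_le_mono add_le_mono) auto
  then have select: "n * (m * 6 + (2 * m + n) * 5 + 33) \<le> 49 * y\<^sup>2" by (simp add: power2_eq_square)
  have "round_time n m L + 2 \<le> 49 * y\<^sup>2 + 8 * 10 ^ 9 * y\<^sup>2 * 8 + 2 * y\<^sup>2 * 14 + 20 * y\<^sup>2 + 2 * y\<^sup>2"
    unfolding round_time_def using squares
    by (intro add_le_mono mult_le_mono1 select L_le rows) simp_all
  then have round: "round_time n m L + 2 \<le> 65 * 10 ^ 9 * y\<^sup>2" by simp
  have "n * 2 ^ L \<le> y * (8 * 10 ^ 9 * y\<^sup>2)" using size(2) scale by (rule mult_le_mono)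
  also have "\<dots> = 8 * 10 ^ 9 * y ^ 3" by (simp add: power2_eq_square power3_eq_cube)
  finally have "n * 2 ^ L + 1 \<le> 9 * 10 ^ 9 * y ^ 3" using \<open>1 \<le> y ^ 3\<close> by simp
  then have "(n * 2 ^ L + 1) * (round_time n m L + 2) \<le> 9 * 10 ^ 9 * y ^ 3 * (65 * 10 ^ 9 * y\<^sup>2)"
    using round by (rule mult_le_mono)
  also have "\<dots> = 585 * 10 ^ 18 * y ^ 5" by (simp flip: power_add)
  finally have rounds: "(n * 2 ^ L + 1) * (round_time n m L + 2) \<le> 585 * 10 ^ 18 * y ^ 5" .
  have "n * (m * 6 + 13) \<le> y * (y * 6 + y * 13)" using size by (intro mult_le_mono add_le_mono) auto
  then have "n * (m * 6 + 13) \<le> 19 * y\<^sup>2" by (simp add: power2_eq_square)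
  then have "n * (m * 6 + 13) + 6 \<le> 25 * y\<^sup>2" using squares(2) by linarith
  then have "loop_time n m L \<le> 585 * 10 ^ 18 * y ^ 5 + 25 * y ^ 5"
    unfolding loop_time_def using rounds \<open>y\<^sup>2 \<le> y ^ 5\<close> by simp
  then show ?thesis by simp
qed

section \<open>Initialization\<close>

definition setup_entry_prog :: com where
  "setup_entry_prog =
     (Cond (RLess (rnum 0) (RGet SIZE (nvar ITEM) (nvar ROW)))
        (nassign DEGREE (NAdd (nvar DEGREE) one)) Skip ;;
      Cond (RLess (RGet CAPACITY zero (nvar ROW)) (RGet SIZE (nvar ITEM) (nvar ROW)))
        (NSet FITTING zero (nvar ITEM) zero) Skip ;;
      Cond (RLess (rnum 1 \<oslash> rnum 2) (RGet SIZE (nvar ITEM) (nvar ROW) \<oslash> RGet CAPACITY zero (nvar ROW)))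
        (RSet COEF (nvar ITEM) (nvar ROW) (rnum 1) ;; RSet COEF (nvar ITEM) small_row (rnum 0))
        (RSet COEF (nvar ITEM) (nvar ROW) (rnum 0) ;; RSet COEF (nvar ITEM) small_row
          (RGet SIZE (nvar ITEM) (nvar ROW) \<oslash> RGet CAPACITY zero (nvar ROW))))"

definition setup_item_prog :: com where
  "setup_item_prog =
     (NSet FITTING zero (nvar ITEM) one ;; nassign DEGREE zero ;;
      for_loop ROW constraint_count setup_entry_prog ;;
      RSet COEF (nvar ITEM) (NAdd (NAdd constraint_count constraint_count) (nvar ITEM)) (rnum 1) ;;
      Cond (NLess (nvar SPARSITY) (nvar DEGREE)) (nassign SPARSITY (nvar DEGREE)) Skip)"

text \<open>\<open>SCALE\<close> is a power of two, so that a coin of bias \<open>1 / SCALE\<close> can be flipped exactly. The factor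
  \<open>200000\<close> makes the logarithm of the number of rows negligible compared with \<open>BUDGET\<close>.\<close>

definition scale_prog :: com where
  "scale_prog =
     (nassign SCALE one ;;
      double_loop SCALE (rnum 200000 \<otimes> (ROfNat (nvar SPARSITY) \<otimes> ROfNat (NAdd row_count one))) ;;
      rassign BUDGET (ROfNat (nvar SCALE) \<oslash> (rnum 2 \<otimes> ROfNat (nvar SPARSITY))) ;;
      rassign PROB (rnum 1 \<oslash> ROfNat (nvar SCALE)))"

definition weights_prog :: com where
  "weights_prog = for_loop ROW row_count (RSet WEIGHT zero (nvar ROW) (rnum 1))"

text \<open>The start value \<open>10000\<close> makes every bound that is asymptotic in the sparsity applicable; the
  \<open>o(k)\<close> term of the approximation ratio pays for it.\<close>

definition setup_prog :: com where
  "setup_prog = (nassign SPARSITY (NConst 10000) ;; for_loop ITEM item_count setup_item_prog ;;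
     weights_prog ;; scale_prog)"

definition packing_algorithm :: com where
  "packing_algorithm = (setup_prog ;; main_loop ;; output_prog)"

lemma writes_setup_entry_prog [simp]:
  "nat_writes setup_entry_prog = {DEGREE, FITTING}" "real_writes setup_entry_prog = {COEF}"
  by (auto simp: setup_entry_prog_def)

lemma writes_setup_item_prog [simp]:
  "nat_writes setup_item_prog = {FITTING, DEGREE, ROW, SPARSITY}" "real_writes setup_item_prog = {COEF}"
  by (auto simp: setup_item_prog_def)

lemma writes_weights_prog [simp]: "nat_writes weights_prog = {ROW}" "real_writes weights_prog = {WEIGHT}"
  by (auto simp: weights_prog_def)

lemma writes_scale_prog [simp]: "nat_writes scale_prog = {SCALE}"
  "real_writes scale_prog = {BUDGET, PROB}"
  by (auto simp: scale_prog_def double_loop_def)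

lemma writes_setup_prog [simp]:
  "nat_writes setup_prog = {FITTING, DEGREE, ROW, ITEM, SPARSITY, SCALE}"
  "real_writes setup_prog = {COEF, WEIGHT, BUDGET, PROB}"
  by (auto simp: setup_prog_def)

lemma card_less_Suc_filter: "card {l. l < Suc j \<and> P l} = card {l. l < j \<and> P l} + of_bool (P j)"
proof -
  have "{l. l < Suc j \<and> P l} = (if P j then insert j {l. l < j \<and> P l} else {l. l < j \<and> P l})"
    by (auto simp: less_Suc_eq)
  then show ?thesis by simp
qed

locale packing_instance =
  fixes n m k :: nat and S :: "nat \<Rightarrow> nat \<Rightarrow> real" and c :: "nat \<Rightarrow> real" and f :: "nat set \<Rightarrow> real"
  assumes data: "nonneg_data n m S c"
    and sparse: "column_sparse k n m S"
    and f_nonneg: "nonneg_set_fun {..<n} f"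
    and f_mono: "monotone_set_fun {..<n} f"
    and f_submodular: "submodular {..<n} f"
begin

definition usage :: "nat \<Rightarrow> nat \<Rightarrow> real" where
  "usage a j = S a j / c j"

definition coef :: "nat \<Rightarrow> nat \<Rightarrow> real" where
  "coef a r = (if r < m then big_part (usage a r)
     else if r < 2 * m then small_part (usage a (r - m))
     else of_bool (r = 2 * m + a))"

definition fitting :: "nat set" where
  "fitting = {a. a < n \<and> (\<forall>j<m. S a j \<le> c j)}"

definition item_degree :: "nat \<Rightarrow> nat" where
  "item_degree a = card {j. j < m \<and> 0 < S a j}"

definition scale_bound :: "nat \<Rightarrow> nat" where
  "scale_bound K = 200000 * K * (2 * m + n + 1)"

definition valid_sparsity :: "nat \<Rightarrow> bool" where
  "valid_sparsity K \<longleftrightarrow> 10000 \<le> K \<and> K \<le> max 10000 k \<and> K \<le> 10000 + m"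

definition valid_scale :: "nat \<Rightarrow> nat \<Rightarrow> bool" where
  "valid_scale K L \<longleftrightarrow> scale_bound K \<le> 2 ^ L \<and> 2 ^ L \<le> 2 * scale_bound K"

definition budget :: "nat \<Rightarrow> nat \<Rightarrow> real" where
  "budget K L = 2 ^ L / (2 * real K)"

definition holds_input :: "state \<Rightarrow> bool" where
  "holds_input s \<longleftrightarrow> fst s (0, 0, 0) = n \<and> fst s (0, 0, 1) = m
     \<and> (\<forall>a<n. \<forall>j<m. snd s (SIZE, a, j) = S a j) \<and> (\<forall>j<m. snd s (CAPACITY, 0, j) = c j)"

lemma holds_input_frame:
  assumes "holds_input s" "same_except X Y s s'" "0 \<notin> X" "SIZE \<notin> Y" "CAPACITY \<notin> Y"
  shows "holds_input s'"
  using assms same_exceptD[OF assms(2)] by (simp add: holds_input_def)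

lemma holds_input_init: "holds_input (init_state n m S c)"
  by (auto simp: holds_input_def init_state_def)

lemma item_degree_le: "item_degree a \<le> m"
  using card_mono[of "{..<m}" "{j. j < m \<and> 0 < S a j}"] by (auto simp: item_degree_def)

lemma item_degree_le_sparsity: "a < n \<Longrightarrow> item_degree a \<le> k"
  using sparse by (simp add: column_sparse_def item_degree_def)

definition item_scanned :: "nat \<Rightarrow> nat \<Rightarrow> state \<Rightarrow> state \<Rightarrow> bool" where
  "item_scanned a j s s' \<longleftrightarrow>
     (\<forall>b. fst s' (FITTING, 0, b) = (if b = a then of_bool (\<forall>l<j. S a l \<le> c l) else fst s (FITTING, 0, b)))
   \<and> (\<forall>b r. snd s' (COEF, b, r)
       = (if b = a \<and> (r < j \<or> m \<le> r \<and> r < m + j) then coef a r else snd s (COEF, b, r)))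
   \<and> nat_of s' DEGREE = card {l. l < j \<and> 0 < S a l}"

lemma setup_entry_prog_spec:
  assumes input: "holds_input s'" and item: "nat_of s' ITEM = a" "a < n"
    and row: "nat_of s' ROW = j" "j < m"
    and scanned: "item_scanned a j s s'"
  shows "runs_to n f setup_entry_prog s' 10 (\<lambda>s''. item_scanned a (Suc j) s (set_nat ROW (Suc j) s''))"
proof (rule runs_to_straight_line)
  let ?s = "final_state n f setup_entry_prog s'"
  have cells: "snd s' (SIZE, a, j) = S a j" "snd s' (CAPACITY, 0, j) = c j" "fst s' (0, 0, Suc 0) = m"
    using input item row by (auto simp: holds_input_def)
  have "snd ?s = (snd s')((COEF, a, j) := big_part (usage a j),
      (COEF, a, m + j) := small_part (usage a j))"
    using item row cells by (simp add: setup_entry_prog_def big_part_def small_part_def usage_def)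
  moreover have "big_part (usage a j) = coef a j" "small_part (usage a j) = coef a (m + j)"
    using row by (simp_all add: coef_def)
  ultimately have "snd ?s (COEF, b, r)
      = (if b = a \<and> (r < Suc j \<or> m \<le> r \<and> r < m + Suc j) then coef a r else snd s (COEF, b, r))" for b r
    using scanned by (auto simp: item_scanned_def less_Suc_eq)
  moreover have "nat_of ?s DEGREE = nat_of s' DEGREE + of_bool (0 < S a j)"
    using item row cells by (simp add: setup_entry_prog_def)
  moreover have "fst ?s (FITTING, 0, b)
      = (if b = a then of_bool (\<forall>l<Suc j. S a l \<le> c l) else fst s (FITTING, 0, b))" for b
    using item row cells scanned
    by (simp add: setup_entry_prog_def item_scanned_def All_less_Suc not_less)
  ultimately show "item_scanned a (Suc j) s (set_nat ROW (Suc j) ?s)"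
    using scanned unfolding item_scanned_def card_less_Suc_filter by simp
qed (simp_all add: setup_entry_prog_def)

definition item_ready :: "nat \<Rightarrow> state \<Rightarrow> state \<Rightarrow> bool" where
  "item_ready a s s' \<longleftrightarrow>
     (\<forall>b. fst s' (FITTING, 0, b) = (if b = a then of_bool (a \<in> fitting) else fst s (FITTING, 0, b)))
   \<and> (\<forall>b r. snd s' (COEF, b, r) = (if b = a then coef a r else snd s (COEF, b, r)))
   \<and> nat_of s' SPARSITY = max (nat_of s SPARSITY) (item_degree a)"

lemma setup_item_prog_spec:
  assumes input: "holds_input s" and item: "nat_of s ITEM = a" "a < n"
    and blank: "\<And>r. snd s (COEF, a, r) = 0"
  shows "runs_to n f setup_item_prog s (m * 14 + 13) (item_ready a s)"
proof -
  let ?L = "for_loop ROW constraint_count setup_entry_prog"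
  let ?rest =
    "RSet COEF (nvar ITEM) (NAdd (NAdd constraint_count constraint_count) (nvar ITEM)) (rnum 1) ;;
      Cond (NLess (nvar SPARSITY) (nvar DEGREE)) (nassign SPARSITY (nvar DEGREE)) Skip"
  define s\<^sub>0 where "s\<^sub>0 = ((fst s)((FITTING, 0, a) := 1, (DEGREE, 0, 0) := 0), snd s)"
  have input\<^sub>0: "holds_input s\<^sub>0" using input by (simp add: holds_input_def s\<^sub>0_def)
  have "runs_to n f ?L s\<^sub>0 (m * (10 + 4) + 4) (\<lambda>s'. preserves ?L s\<^sub>0 s' \<and> item_scanned a m s s')"
  proof (rule runs_to_for_loop[where I = "\<lambda>j. item_scanned a j s"])
    show "item_scanned a 0 s (set_nat ROW 0 s\<^sub>0)" by (simp add: item_scanned_def s\<^sub>0_def)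
    fix s' assume frame: "preserves ?L s\<^sub>0 s'"
    have input': "holds_input s'" by (rule holds_input_frame[OF input\<^sub>0 frame]) auto
    then show "nval constraint_count s' = m" by (simp add: holds_input_def)
    have "nat_of s' ITEM = a" using same_exceptD(1)[OF frame] item(1) by (simp add: s\<^sub>0_def)
    then show "runs_to n f setup_entry_prog s' 10
        (\<lambda>s''. item_scanned a (Suc j) s (set_nat ROW (Suc j) s''))"
      if "j < m" "nat_of s' ROW = j" "item_scanned a j s s'" for j
      using input' item(2) that by (intro setup_entry_prog_spec)
  qed simp
  moreover have "runs_to n f ?rest s' 4 (item_ready a s)"
    if "preserves ?L s\<^sub>0 s' \<and> item_scanned a m s s'" for s'
  proof (rule runs_to_straight_line)
    have "same_except {ROW, DEGREE, FITTING} {COEF} s\<^sub>0 s'" using that by simp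
    then have "fst s' (0, 0, Suc 0) = m" "nat_of s' ITEM = a" "nat_of s' SPARSITY = nat_of s SPARSITY"
      using input item(1) by (simp_all add: same_except_def s\<^sub>0_def holds_input_def)
    then show "item_ready a s (final_state n f ?rest s')"
      using that item(2) blank
      by (auto simp: item_ready_def item_scanned_def item_degree_def fitting_def coef_def mult_2)
  qed simp_all
  ultimately have "runs_to n f (?L ;; ?rest) s\<^sub>0 (Suc (m * (10 + 4) + 4 + 4)) (item_ready a s)"
    by (rule guarantees_Seq_runs_to)
  then have "runs_to n f (nassign DEGREE zero ;; ?L ;; ?rest) ((fst s)((FITTING, 0, a) := 1), snd s)
      (Suc (straight_line_time (nassign DEGREE zero) + Suc (m * (10 + 4) + 4 + 4))) (item_ready a s)"
    by (rule guarantees_Seq_straight_line[rotated 2]) (simp_all add: s\<^sub>0_def)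
  from guarantees_Seq_straight_line[OF _ _ this, of "NSet FITTING zero (nvar ITEM) one" s]
  show ?thesis
    unfolding setup_item_prog_def by (rule guarantees_time_mono) (simp_all add: item(1))
qed

definition items_ready :: "nat \<Rightarrow> state \<Rightarrow> bool" where
  "items_ready i s \<longleftrightarrow> (\<forall>a<i. fst s (FITTING, 0, a) = of_bool (a \<in> fitting))
   \<and> (\<forall>a r. snd s (COEF, a, r) = (if a < i then coef a r else 0))
   \<and> valid_sparsity (nat_of s SPARSITY) \<and> (\<forall>a<i. item_degree a \<le> nat_of s SPARSITY)"

lemma items_ready_Suc:
  assumes "items_ready a s" "item_ready a s s'" "a < n"
  shows "items_ready (Suc a) s'"
  using assms item_degree_le[of a] item_degree_le_sparsity[OF assms(3)]
  by (auto simp: items_ready_def item_ready_def valid_sparsity_def less_Suc_eq)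

lemma setup_items_spec:
  assumes input: "holds_input s" and init: "items_ready 0 s"
  shows "runs_to n f (for_loop ITEM item_count setup_item_prog) s (n * (m * 14 + 17) + 4) (items_ready n)"
proof -
  let ?L = "for_loop ITEM item_count setup_item_prog"
  have "runs_to n f ?L s (n * (m * 14 + 13 + 4) + 4) (\<lambda>s'. preserves ?L s s' \<and> items_ready n s')"
  proof (rule runs_to_for_loop[where I = items_ready])
    show "items_ready 0 (set_nat ITEM 0 s)" using init by (simp add: items_ready_def)
    fix s' assume frame: "preserves ?L s s'"
    have input': "holds_input s'" by (rule holds_input_frame[OF input frame]) auto
    then show "nval item_count s' = n" by (simp add: holds_input_def)
    fix a assume iteration: "a < n" "nat_of s' ITEM = a" "items_ready a s'"
    then have "runs_to n f setup_item_prog s' (m * 14 + 13) (item_ready a s')"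
      using input' by (intro setup_item_prog_spec) (simp_all add: items_ready_def)
    then show "runs_to n f setup_item_prog s' (m * 14 + 13)
        (\<lambda>s''. items_ready (Suc a) (set_nat ITEM (Suc a) s''))"
    proof (rule guarantees_conseq)
      fix s'' assume "item_ready a s' s''"
      from items_ready_Suc[OF iteration(3) this iteration(1)]
      show "items_ready (Suc a) (set_nat ITEM (Suc a) s'')"
        by (simp add: items_ready_def)
    qed
  qed simp
  then show ?thesis by (rule guarantees_mono) simp_all
qed

lemma weights_prog_spec:
  assumes "holds_input s"
  shows "runs_to n f weights_prog s ((2 * m + n) * 5 + 4) (\<lambda>s'. \<forall>r<2 * m + n. snd s' (WEIGHT, 0, r) = 1)"
proof -
  have "runs_to n f weights_prog s ((2 * m + n) * (1 + 4) + 4)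
      (\<lambda>s'. preserves weights_prog s s' \<and> (\<forall>r<2 * m + n. snd s' (WEIGHT, 0, r) = 1))"
    unfolding weights_prog_def
  proof (rule runs_to_for_loop[where I = "\<lambda>j s'. \<forall>r<j. snd s' (WEIGHT, 0, r) = 1"])
    fix s' assume frame: "preserves (for_loop ROW row_count (RSet WEIGHT zero (nvar ROW) (rnum 1))) s s'"
    have "holds_input s'" by (rule holds_input_frame[OF assms frame]) auto
    then show "nval row_count s' = 2 * m + n" by (simp add: holds_input_def)
    show "runs_to n f (RSet WEIGHT zero (nvar ROW) (rnum 1)) s' 1
        (\<lambda>s''. \<forall>r<Suc j. snd (set_nat ROW (Suc j) s'') (WEIGHT, 0, r) = 1)"
      if "nat_of s' ROW = j" "\<forall>r<j. snd s' (WEIGHT, 0, r) = 1" for j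
      using that by (intro runs_to_straight_line) (auto simp: less_Suc_eq)
  qed simp_all
  then show ?thesis by (rule guarantees_mono) simp_all
qed

lemma scale_prog_spec:
  assumes input: "holds_input s" and sparsity: "nat_of s SPARSITY = K" "valid_sparsity K"
  shows "runs_to n f scale_prog s (scale_bound (10000 + m) * 3 + 7)
    (\<lambda>s'. \<exists>L. valid_scale K L \<and> nat_of s' SCALE = 2 ^ L
      \<and> real_of s' BUDGET = budget K L \<and> real_of s' PROB = 1 / 2 ^ L)" (is "runs_to _ _ _ _ _ ?Q")
proof -
  let ?d = "scale_bound (10000 + m)" and ?s = "set_nat SCALE 1 s"
  let ?e = "rnum 200000 \<otimes> (ROfNat (nvar SPARSITY) \<otimes> ROfNat (NAdd row_count one))"
  let ?B = "rassign BUDGET (ROfNat (nvar SCALE) \<oslash> (rnum 2 \<otimes> ROfNat (nvar SPARSITY))) ;;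
      rassign PROB (rnum 1 \<oslash> ROfNat (nvar SCALE))"
  have "scale_bound K \<le> ?d"
    unfolding scale_bound_def
    using sparsity(2) by (intro mult_le_mono) (auto simp: valid_sparsity_def)
  also have "\<dots> \<le> 2 ^ ?d" by (rule less_imp_le[OF less_exp])
  finally have bound_le: "scale_bound K \<le> 2 ^ (0 + ?d)" by simp
  have one_le: "2 ^ 0 \<le> 2 * scale_bound K"
    using sparsity(2) by (simp add: scale_bound_def valid_sparsity_def)
  have "rval ?e s' = real (scale_bound K)" if "same_except {SCALE} {} ?s s'" for s'
    using input sparsity(1) same_exceptD(1)[OF that]
    by (simp add: holds_input_def scale_bound_def algebra_simps)
  then have loop: "runs_to n f (double_loop SCALE ?e) ?s (?d * 3 + 1)
      (\<lambda>s'. \<exists>L. nat_of s' SCALE = 2 ^ L \<and> scale_bound K \<le> 2 ^ L \<and> 2 ^ L \<le> 2 * scale_bound K)"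
    by (intro runs_to_double_loop[OF _ one_le bound_le]) simp_all
  have "runs_to n f (double_loop SCALE ?e ;; ?B) ?s (Suc (?d * 3 + 1 + 3)) ?Q"
  proof (rule guarantees_Seq_runs_to[OF guarantees_frame[OF loop]])
    fix s' assume after_loop: "preserves (double_loop SCALE ?e) ?s s' \<and>
      (\<exists>L. nat_of s' SCALE = 2 ^ L \<and> scale_bound K \<le> 2 ^ L \<and> 2 ^ L \<le> 2 * scale_bound K)"
    then have "nat_of s' SPARSITY = K"
      using sparsity(1) by (simp add: same_except_def double_loop_def)
    with after_loop show "runs_to n f ?B s' 3 ?Q"
      by (intro runs_to_straight_line) (auto simp: valid_scale_def budget_def)
  qed
  from guarantees_Seq_straight_line[OF _ _ this, of "nassign SCALE one"]
  show ?thesis unfolding scale_prog_def by (rule guarantees_time_mono) (simp_all add: set_nat_def)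
qed

definition setup_time :: nat where
  "setup_time = n * (m * 14 + 17) + (2 * m + n) * 5 + scale_bound (10000 + m) * 3 + 19"

definition initialized :: "nat \<Rightarrow> nat \<Rightarrow> state \<Rightarrow> bool" where
  "initialized K L s \<longleftrightarrow> nat_of s SPARSITY = K \<and> items_ready n s
     \<and> (\<forall>r<2 * m + n. snd s (WEIGHT, 0, r) = 1) \<and> valid_scale K L \<and> nat_of s SCALE = 2 ^ L
     \<and> real_of s BUDGET = budget K L \<and> real_of s PROB = 1 / 2 ^ L"

lemma setup_prog_spec:
  "runs_to n f setup_prog (init_state n m S c) setup_time (\<lambda>s. \<exists>K L. initialized K L s)"
proof -
  let ?s = "set_nat SPARSITY 10000 (init_state n m S c)"
  let ?items = "for_loop ITEM item_count setup_item_prog"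
  let ?Q = "\<lambda>s. \<exists>K L. initialized K L s"
  let ?ti = "n * (m * 14 + 17) + 4" and ?tw = "(2 * m + n) * 5 + 4"
    and ?ts = "scale_bound (10000 + m) * 3 + 7"
  have input: "holds_input ?s" using holds_input_init by (simp add: holds_input_def)
  have "items_ready 0 ?s" by (simp add: items_ready_def valid_sparsity_def init_state_def)
  note items = guarantees_frame[OF setup_items_spec[OF input this]]
  have "runs_to n f (?items ;; weights_prog ;; scale_prog) ?s (Suc (?ti + Suc (?tw + ?ts))) ?Q"
  proof (rule guarantees_Seq_runs_to[OF items])
    fix s\<^sub>1 assume after_items: "preserves ?items ?s s\<^sub>1 \<and> items_ready n s\<^sub>1"
    then have input\<^sub>1: "holds_input s\<^sub>1" by (intro holds_input_frame[OF input]) auto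
    show "runs_to n f (weights_prog ;; scale_prog) s\<^sub>1 (Suc (?tw + ?ts)) ?Q"
    proof (rule guarantees_Seq_runs_to[OF guarantees_frame[OF weights_prog_spec[OF input\<^sub>1]]])
      fix s\<^sub>2 assume after_weights: "preserves weights_prog s\<^sub>1 s\<^sub>2
          \<and> (\<forall>r<2 * m + n. snd s\<^sub>2 (WEIGHT, 0, r) = 1)"
      then have input\<^sub>2: "holds_input s\<^sub>2" by (intro holds_input_frame[OF input\<^sub>1]) auto
      have ready: "items_ready n s\<^sub>2"
        using after_items after_weights by (simp add: items_ready_def same_except_def)
      then have "valid_sparsity (nat_of s\<^sub>2 SPARSITY)" by (simp add: items_ready_def)
      from guarantees_frame[OF scale_prog_spec[OF input\<^sub>2 refl this]]
      show "runs_to n f scale_prog s\<^sub>2 ?ts ?Q"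
      proof (rule guarantees_conseq)
        fix s\<^sub>3 assume "preserves scale_prog s\<^sub>2 s\<^sub>3 \<and> (\<exists>L. valid_scale (nat_of s\<^sub>2 SPARSITY) L
          \<and> nat_of s\<^sub>3 SCALE = 2 ^ L \<and> real_of s\<^sub>3 BUDGET = budget (nat_of s\<^sub>2 SPARSITY) L
          \<and> real_of s\<^sub>3 PROB = 1 / 2 ^ L)"
        moreover from this have "items_ready n s\<^sub>3" "\<forall>r<2 * m + n. snd s\<^sub>3 (WEIGHT, 0, r) = 1"
          "nat_of s\<^sub>3 SPARSITY = nat_of s\<^sub>2 SPARSITY"
          using ready after_weights by (simp_all add: items_ready_def same_except_def)
        ultimately show "?Q s\<^sub>3" by (auto simp: initialized_def)
      qed
    qed
  qed
  from guarantees_Seq_straight_line[OF _ _ this, of "nassign SPARSITY (NConst 10000)"]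
  show ?thesis
    unfolding setup_prog_def
    by (rule guarantees_time_mono) (simp_all add: set_nat_def setup_time_def)
qed

section \<open>Quality and running time of the algorithm\<close>

definition input_size :: nat where
  "input_size = n + m + 1"

lemma size_nonneg: "a < n \<Longrightarrow> j < m \<Longrightarrow> 0 \<le> S a j"
  and capacity_nonneg: "j < m \<Longrightarrow> 0 \<le> c j"
  using data by (simp_all add: nonneg_data_def)

lemma usage_nonneg: "a < n \<Longrightarrow> j < m \<Longrightarrow> 0 \<le> usage a j"
  using size_nonneg capacity_nonneg by (simp add: usage_def)

lemma usage_le_1: "a \<in> fitting \<Longrightarrow> j < m \<Longrightarrow> usage a j \<le> 1"
  using capacity_nonneg[of j] by (cases "c j = 0") (auto simp: usage_def fitting_def)

lemma fitting_subset: "fitting \<subseteq> {..<n}"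
  by (auto simp: fitting_def)

lemma feasible_subset: "feasible n m S c A \<Longrightarrow> A \<subseteq> {..<n}"
  by (simp add: feasible_def)

lemma finite_feasible: "feasible n m S c A \<Longrightarrow> finite A"
  using feasible_subset finite_subset by blast

lemma feasible_subset_fitting:
  assumes "feasible n m S c A"
  shows "A \<subseteq> fitting"
proof
  fix a assume a_in: "a \<in> A"
  have "S a j \<le> c j" if j_lt: "j < m" for j
  proof -
    have "S a j \<le> (\<Sum>i\<in>A. S i j)"
      using a_in j_lt feasible_subset[OF assms] finite_feasible[OF assms] size_nonneg
      by (intro member_le_sum) auto
    also have "\<dots> \<le> c j" using assms j_lt by (simp add: feasible_def)
    finally show ?thesis .
  qed
  then show "a \<in> fitting" using a_in feasible_subset[OF assms] by (auto simp: fitting_def)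
qed

lemma sum_usage_le_1:
  assumes "feasible n m S c A" "j < m"
  shows "(\<Sum>a\<in>A. usage a j) \<le> 1"
proof -
  have "(\<Sum>a\<in>A. S a j) / c j \<le> 1"
    using assms capacity_nonneg[OF assms(2)] by (cases "c j = 0") (simp_all add: feasible_def)
  then show ?thesis by (simp add: usage_def sum_divide_distrib)
qed

lemma sum_size_le_capacity:
  assumes "T \<subseteq> fitting" "j < m" "(\<Sum>a\<in>T. usage a j) \<le> 1"
  shows "(\<Sum>a\<in>T. S a j) \<le> c j"
proof (cases "c j = 0")
  case True
  have "S a j \<le> c j" if "a \<in> T" for a using that assms(1,2) by (auto simp: fitting_def)
  then show ?thesis using True by (simp add: sum_nonpos)
next
  case False
  then have "0 < c j" using capacity_nonneg[OF assms(2)] by simp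
  then show ?thesis using assms(3) by (simp add: usage_def sum_divide_distrib[symmetric])
qed

lemma coef_nonneg: "a < n \<Longrightarrow> 0 \<le> coef a r"
  using usage_nonneg[of a "r - m"] by (auto simp: coef_def big_part_def small_part_def)

lemma coef_le_1: "coef a r \<le> 1"
  by (auto simp: coef_def big_part_def small_part_def)

lemma sum_coef_le_1:
  assumes feasible: "feasible n m S c A"
  shows "(\<Sum>a\<in>A. coef a r) \<le> 1"
proof -
  have nonneg: "0 \<le> usage a j" if "a \<in> A" "j < m" for a j
    using that feasible_subset[OF feasible] by (intro usage_nonneg) auto
  consider (big) "r < m" | (small) "m \<le> r" "r < 2 * m" | (own) "2 * m \<le> r" by linarith
  then show ?thesis
  proof cases
    case big
    then show ?thesis
      using sum_big_part_le_1[OF finite_feasible[OF feasible] nonneg sum_usage_le_1[OF feasible]]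
      by (simp add: coef_def)
  next
    case small
    then have "(\<Sum>a\<in>A. coef a r) = (\<Sum>a\<in>A. small_part (usage a (r - m)))" by (simp add: coef_def)
    also have "\<dots> \<le> (\<Sum>a\<in>A. usage a (r - m))" using small nonneg by (intro sum_small_part_le) auto
    also have "\<dots> \<le> 1" using small by (intro sum_usage_le_1[OF feasible]) simp
    finally show ?thesis .
  next
    case own
    then have "(\<Sum>a\<in>A. coef a r) = (\<Sum>a\<in>A. if a = r - 2 * m then 1 else 0)"
      by (intro sum.cong) (auto simp: coef_def)
    also have "\<dots> \<le> 1" using finite_feasible[OF feasible] by simp
    finally show ?thesis .
  qed
qed

lemma budget_ge:
  assumes "valid_sparsity K" "valid_scale K L"
  shows "100000 * (real (2 * m + n) + 1) \<le> budget K L"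
proof -
  have "real (scale_bound K) \<le> real (2 ^ L)"
    using assms(2) by (simp only: of_nat_le_iff valid_scale_def)
  then show ?thesis
    using assms(1)
    by (simp add: budget_def scale_bound_def valid_sparsity_def le_divide_eq algebra_simps)
qed

lemma packing_program_instance:
  assumes feasible: "feasible n m S c A" and valid: "valid_sparsity K" "valid_scale K L"
  shows "packing_program n m coef fitting (budget K L) A f (1 / 2 ^ L) L"
proof unfold_locales
  have budget_large: "100000 * (real (2 * m + n) + 1) \<le> budget K L" by (rule budget_ge[OF valid])
  have "1 \<le> 100000 * (real (2 * m + n) + 1)" by simp
  then show "1 \<le> budget K L" using budget_large by (rule order_trans)
  show "monotone_set_fun fitting f" "submodular fitting f"
    using f_mono f_submodular fitting_subset unfolding monotone_set_fun_def submodular_def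
    by (meson subset_trans)+
  show "finite fitting" using fitting_subset finite_subset by blast
  show "coef a (2 * m + a) = 1" for a by (simp add: coef_def)
  then show "\<exists>r\<in>{..<2 * m + n}. 0 < coef a r" if "a \<in> fitting" for a
    using that fitting_subset by (intro bexI[of _ "2 * m + a"]) auto
  show "(\<Sum>a\<in>A. coef a r) \<le> 1" for r by (rule sum_coef_le_1[OF feasible])
qed (use fitting_subset feasible_subset_fitting[OF feasible] coef_nonneg coef_le_1 in auto)

lemma rep_initialized:
  assumes "initialized K L s" "preserves setup_prog (init_state n m S c) s"
  shows "packing_program.rep n m coef fitting (budget K L) (1 / 2 ^ L) L {} (\<lambda>_. 0) (\<lambda>_. 1) s"
    and "nat_of s HALT = 0"
proof -
  obtain A where feasible: "feasible n m S c A"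
    using data by (auto simp: feasible_def nonneg_data_def intro: that[of "{}"])
  have valid: "valid_sparsity K" "valid_scale K L"
    using assms(1) by (auto simp: initialized_def items_ready_def)
  interpret prog: packing_program n m coef fitting "budget K L" A f "1 / 2 ^ L" L
    by (rule packing_program_instance[OF feasible valid])
  note frame = same_exceptD[OF assms(2)]
  show "prog.rep {} (\<lambda>_. 0) (\<lambda>_. 1) s"
    using assms(1) unfolding prog.rep_def initialized_def items_ready_def
    by (simp add: frame init_state_def)
  show "nat_of s HALT = 0" by (simp add: frame init_state_def)
qed

lemma card_touched_le:
  assumes "packing_program n m coef fitting D A f p L" "a \<in> fitting"
  shows "card (conflict_risk.touched m coef a) \<le> item_degree a"
proof -
  interpret prog: packing_program n m coef fitting D A f p L by (rule assms(1))
  have "0 < S a j" if j_lt: "j < m" and pos: "0 < coef a j + coef a (m + j)" for j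
  proof -
    have "S a j \<noteq> 0" using pos j_lt by (auto simp: coef_def big_part_def small_part_def usage_def)
    moreover have "0 \<le> S a j" using size_nonneg j_lt assms(2) fitting_subset by blast
    ultimately show ?thesis by simp
  qed
  then show ?thesis unfolding prog.touched_def item_degree_def by (intro card_mono) auto
qed

lemma survivors_feasible:
  assumes "packing_program n m coef fitting D A f p L"
    and R_sub: "R \<subseteq> fitting" and load: "conflict_risk.loads_bounded m D load"
  shows "feasible n m S c (conflict_risk.survivors m coef p D R load)"
proof -
  interpret prog: packing_program n m coef fitting D A f p L by (rule assms(1))
  let ?T = "prog.survivors R load"
  have T_sub: "?T \<subseteq> fitting" using prog.survivors_subset R_sub by blast
  have "(\<Sum>a\<in>?T. S a j) \<le> c j" if j_lt: "j < m" for j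
  proof (rule sum_size_le_capacity[OF T_sub j_lt], rule prog.survivors_load_le_1[OF R_sub load j_lt])
    fix a assume "a \<in> fitting"
    then show "coef a j = big_part (usage a j) \<and> coef a (m + j) = small_part (usage a j)"
      "0 \<le> usage a j \<and> usage a j \<le> 1"
      using j_lt usage_nonneg usage_le_1 fitting_subset by (auto simp: coef_def)
  qed
  then show ?thesis using T_sub fitting_subset by (auto simp: feasible_def)
qed

lemma input_size_bounds:
  "1 \<le> input_size" "n \<le> input_size" "m \<le> input_size" "2 * m + n + 1 \<le> 2 * input_size"
  "10000 + m \<le> 10000 * input_size"
  by (auto simp: input_size_def)

lemma scale_bound_le:
  assumes "K \<le> 10000 + m"
  shows "scale_bound K \<le> 4 * 10 ^ 9 * input_size\<^sup>2"
proof -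
  have "scale_bound K \<le> 200000 * (10000 * input_size) * (2 * input_size)"
    unfolding scale_bound_def using assms input_size_bounds by (intro mult_le_mono) auto
  then show ?thesis by (simp add: power2_eq_square)
qed

lemma scale_le:
  assumes "valid_sparsity K" "valid_scale K L"
  shows "2 ^ L \<le> 8 * 10 ^ 9 * input_size\<^sup>2"
  using assms scale_bound_le[of K] by (simp add: valid_sparsity_def valid_scale_def)

lemma setup_time_le: "setup_time \<le> 13 * 10 ^ 9 * input_size\<^sup>2"
proof -
  let ?y = input_size
  note size = input_size_bounds
  have "n * (m * 14 + 17) \<le> ?y * (?y * 14 + ?y * 17)"
    using size by (intro mult_le_mono add_le_mono) auto
  then have items: "n * (m * 14 + 17) \<le> 31 * ?y\<^sup>2" by (simp add: power2_eq_square)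
  have rows: "2 * m + n \<le> 2 * ?y\<^sup>2" using mult_le_mono[OF size(4,1)] by (simp add: power2_eq_square)
  have "setup_time \<le> 31 * ?y\<^sup>2 + 2 * ?y\<^sup>2 * 5 + 4 * 10 ^ 9 * ?y\<^sup>2 * 3 + 19 * ?y\<^sup>2"
    unfolding setup_time_def using size(1)
    by (intro add_le_mono mult_le_mono1 items rows scale_bound_le) simp_all
  then show ?thesis by simp
qed

lemma total_time_le: "Suc (setup_time + 6 * 10 ^ 20 * input_size ^ 5) \<le> poly time_poly (n + m)"
proof -
  have "input_size\<^sup>2 \<le> input_size ^ 5" using input_size_bounds(1) by (intro power_increasing) auto
  then have "setup_time \<le> 13 * 10 ^ 9 * input_size ^ 5" using setup_time_le by simp
  moreover have "1 \<le> input_size ^ 5" using input_size_bounds(1) by simp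
  ultimately have "Suc (setup_time + 6 * 10 ^ 20 * input_size ^ 5) \<le> 10 ^ 21 * input_size ^ 5" by simp
  also have "\<dots> = poly time_poly (n + m)"
    by (simp only: time_poly_def poly_smult poly_power) (simp add: input_size_def add.commute)
  finally show ?thesis .
qed

lemma OPT_attained:
  obtains A where "feasible n m S c A" "OPT n m S c f = f A"
proof -
  have "feasible n m S c {}" using data by (simp add: feasible_def nonneg_data_def)
  moreover have "finite {T. feasible n m S c T}"
    by (rule finite_subset[of _ "Pow {..<n}"]) (auto simp: feasible_def)
  ultimately have "OPT n m S c f \<in> f ` {T. feasible n m S c T}"
    unfolding OPT_def by (intro Max_in) auto
  then show thesis using that by auto
qed

lemma OPT_nonneg: "0 \<le> OPT n m S c f"
  using OPT_attained f_nonneg feasible_subset by (metis nonneg_set_fun_def)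

lemma loop_output_spec:
  assumes init: "initialized K L s" "preserves setup_prog (init_state n m S c) s"
  shows "guarantees n f (main_loop ;; output_prog) s (loop_time n m L)
    (\<lambda>s. feasible n m S c (row_set n OUTPUT 0 s)) (\<lambda>s. f (row_set n OUTPUT 0 s))
    (OPT n m S c f / (17 / 4 * real K))"
proof -
  obtain A where feasible: "feasible n m S c A" and optimal: "OPT n m S c f = f A"
    by (rule OPT_attained)
  have valid: "valid_sparsity K" "valid_scale K L" and degree: "\<And>a. a < n \<Longrightarrow> item_degree a \<le> K"
    using init(1) by (auto simp: initialized_def items_ready_def)
  have K_ge: "10000 \<le> real K" using valid(1) by (simp add: valid_sparsity_def)
  define p where "p = 1 / (2 :: real) ^ L"
  have program: "packing_program n m coef fitting (budget K L) A f p L"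
    unfolding p_def by (rule packing_program_instance[OF feasible valid])
  interpret prog: packing_program n m coef fitting "budget K L" A f p L by (rule program)
  let ?\<Phi> = "prog.potential {} (\<lambda>_. 0) (\<lambda>_. 1) (\<lambda>_. 0)"
  have pD_eq: "p * budget K L = 1 / (2 * real K)" by (simp add: p_def budget_def)
  have inflation: "prog.inflation = 1 + 1 / (2 * real K) / (1 / 100)"
    by (simp only: prog.inflation_def pD_eq)
  have "budget K L \<le> 2 ^ L" using K_ge by (simp add: budget_def divide_le_eq)
  then have "guarantees n f (main_loop ;; output_prog) s (loop_time n m L)
      (\<lambda>s'. \<exists>R c. R \<subseteq> fitting \<and> prog.loads_bounded c \<and> row_set n OUTPUT 0 s' = prog.survivors R c)
      (\<lambda>s'. prog.inflation * (f (row_set n OUTPUT 0 s') - f {})) ?\<Phi>"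
    using rep_initialized[OF init] by (intro prog.main_loop_output_spec) (simp_all add: p_def)
  then have run: "guarantees n f (main_loop ;; output_prog) s (loop_time n m L)
      (\<lambda>s'. \<exists>R c. R \<subseteq> fitting \<and> prog.loads_bounded c \<and> row_set n OUTPUT 0 s' = prog.survivors R c)
      (\<lambda>s'. f (row_set n OUTPUT 0 s')) (?\<Phi> / prog.inflation + f {})"
    by (rule guarantees_affine) (use K_ge in \<open>simp add: inflation add_pos_nonneg\<close>)
  have "real (card (prog.touched a)) \<le> real K" if "a \<in> fitting" for a
    using card_touched_le[OF program that] degree[of a] that fitting_subset by fastforce
  then have "(f A - f {}) * (239 / 1000) / real K \<le> ?\<Phi>"
    using initial_potential_bound[OF K_ge budget_ge[OF valid] pD_eq prog.value_nonneg prog.p_pos]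
      prog.potential_init_ge[of "real K" "\<lambda>_. 0"]
    by (simp add: prog.horizon_def)
  then have "OPT n m S c f / (17 / 4 * real K) \<le> ?\<Phi> / prog.inflation + f {}"
    unfolding inflation optimal
    using discounted_value_ge[OF K_ge prog.value_nonneg, of "f {}"] f_nonneg
    by (simp add: nonneg_set_fun_def)
  with run show ?thesis
    by (rule guarantees_mono[OF _ order_refl]) (auto intro: survivors_feasible[OF program])
qed

theorem packing_algorithm_spec:
  "guarantees n f packing_algorithm (init_state n m S c) (poly time_poly (n + m))
    (\<lambda>s. feasible n m S c (row_set n OUTPUT 0 s)) (\<lambda>s. f (row_set n OUTPUT 0 s))
    (OPT n m S c f / (17 / 4 * real (max 10000 k)))"
  unfolding packing_algorithm_def
proof (rule guarantees_time_mono[OF guarantees_Seq_runs_to[OF guarantees_frame[OF setup_prog_spec]]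
    total_time_le])
  let ?run = "guarantees n f (main_loop ;; output_prog)"
  fix s assume "preserves setup_prog (init_state n m S c) s \<and> (\<exists>K L. initialized K L s)"
  then obtain K L where init: "initialized K L s" "preserves setup_prog (init_state n m S c) s" by blast
  then have valid: "valid_sparsity K" "valid_scale K L"
    by (auto simp: initialized_def items_ready_def)
  have "OPT n m S c f / (17 / 4 * real (max 10000 k)) \<le> OPT n m S c f / (17 / 4 * real K)"
    using valid(1) OPT_nonneg by (intro divide_left_mono) (auto simp: valid_sparsity_def)
  then show "?run s (6 * 10 ^ 20 * input_size ^ 5) (\<lambda>s. feasible n m S c (row_set n OUTPUT 0 s))
      (\<lambda>s. f (row_set n OUTPUT 0 s)) (OPT n m S c f / (17 / 4 * real (max 10000 k)))"
    by (rule guarantees_mono[OF loop_output_spec[OF init]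
        loop_time_le[OF input_size_bounds(1-4) scale_le[OF valid]]])
qed

end

section \<open>The main theorem\<close>

definition ratio_slack :: "nat \<Rightarrow> real" where
  "ratio_slack k = (if k < 10000 then 42500 else 0)"

lemma ratio_slack_smallo: "ratio_slack \<in> o(\<lambda>k. real k)"
proof (rule landau_o.smallI)
  fix \<epsilon> :: real assume "0 < \<epsilon>"
  then show "\<forall>\<^sub>F k in sequentially. norm (ratio_slack k) \<le> \<epsilon> * norm (real k)"
    by (intro eventually_mono[OF eventually_ge_at_top[of 10000]]) (simp add: ratio_slack_def)
qed

lemma exp_ratio_ge: "17 / 4 \<le> exp (1 :: real) ^ 2 / (exp 1 - 1)"
proof -
  have "(13 / 8 :: real) \<le> exp (1 / 2)"
    using exp_lower_Taylor_quadratic[of "1 / 2"] by (simp add: power2_eq_square)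
  then have "(13 / 8)\<^sup>2 \<le> (exp (1 / 2 :: real))\<^sup>2" by (intro power_mono) auto
  also have "\<dots> = exp 1" by (simp flip: exp_of_nat_mult)
  finally have e_ge: "169 / 64 \<le> exp (1 :: real)" by (simp add: power2_eq_square)
  have "0 \<le> (exp 1 - 169 / 64) * (exp (1 :: real) - 103 / 64)"
    using e_ge by (intro mult_nonneg_nonneg) auto
  then have "17 / 4 * (exp 1 - 1) \<le> exp (1 :: real) ^ 2"
    using e_ge by (simp add: power2_eq_square algebra_simps)
  then show ?thesis using e_ge by (simp add: le_divide_eq)
qed

lemma max_le_exp_ratio:
  "17 / 4 * real (max 10000 k) \<le> exp 1 ^ 2 / (exp 1 - 1) * real k + ratio_slack k"
proof (cases "k < 10000")
  case True
  have "0 \<le> exp (1 :: real) ^ 2 / (exp 1 - 1) * real k"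
    using exp_ratio_ge by (intro mult_nonneg_nonneg) auto
  with True show ?thesis by (simp add: ratio_slack_def)
next
  case False
  with mult_right_mono[OF exp_ratio_ge, of "real k"] show ?thesis by (simp add: ratio_slack_def)
qed

theorem theorem6:
  "\<exists>(P :: com) (p :: nat poly) (g :: nat \<Rightarrow> real).
     g \<in> o(\<lambda>k. real k) \<and>
     (\<forall>k. 0 < exp 1 ^ 2 / (exp 1 - 1) * real k + g k) \<and>
     (\<forall>(n :: nat) (m :: nat) (k :: nat) (S :: nat \<Rightarrow> nat \<Rightarrow> real) (c :: nat \<Rightarrow> real)
        (f :: nat set \<Rightarrow> real).
        nonneg_data n m S c \<and> column_sparse k n m S \<and>
        nonneg_set_fun {..<n} f \<and> monotone_set_fun {..<n} f \<and> submodular {..<n} f \<longrightarrow>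
        halts_within P n m S c f (poly p (n + m)) \<and>
        (\<forall>T \<in> set_pmf (out_dist P n m S c f (poly p (n + m))). feasible n m S c T) \<and>
        measure_pmf.expectation (out_dist P n m S c f (poly p (n + m))) f
          \<ge> OPT n m S c f / (exp 1 ^ 2 / (exp 1 - 1) * real k + g k))"
proof (intro exI conjI allI impI)
  show "ratio_slack \<in> o(\<lambda>k. real k)" by (rule ratio_slack_smallo)
  show denominator_pos: "0 < exp 1 ^ 2 / (exp 1 - 1) * real k + ratio_slack k" for k
    by (rule less_le_trans[OF _ max_le_exp_ratio]) simp
  fix n m k S c f
  assume "nonneg_data n m S c \<and> column_sparse k n m S \<and>
    nonneg_set_fun {..<n} f \<and> monotone_set_fun {..<n} f \<and> submodular {..<n} f"
  then interpret packing_instance n m k S c f by unfold_locales auto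
  note outcome = guarantees_out_dist[where Q = "feasible n m S c", OF packing_algorithm_spec]
  show "halts_within packing_algorithm n m S c f (poly time_poly (n + m))" by (rule outcome(1))
  show "\<forall>T \<in> set_pmf (out_dist packing_algorithm n m S c f (poly time_poly (n + m))). feasible n m S c T"
    using outcome(2) by blast
  have "OPT n m S c f / (exp 1 ^ 2 / (exp 1 - 1) * real k + ratio_slack k)
      \<le> OPT n m S c f / (17 / 4 * real (max 10000 k))"
    using OPT_nonneg max_le_exp_ratio denominator_pos by (intro divide_left_mono) auto
  also note outcome(3)
  finally show "OPT n m S c f / (exp 1 ^ 2 / (exp 1 - 1) * real k + ratio_slack k)
      \<le> measure_pmf.expectation (out_dist packing_algorithm n m S c f (poly time_poly (n + m))) f" .
qed

end
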